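(* If $\mathcal M$ is an internal $P^*$-algebra, then its nonstandard hull $\widehat{\mathcal M}$ is a $P^*$-algebra.
   Context: Work in a nonstandard universe (in the sense of Robinson's nonstandard analysis) that is $\kappa$-saturated for a sufficiently large uncountable cardinal $\kappa$. All $C^*$-algebras are unital. An internal $C^*$-algebra $\mathcal M$ is an internal object satisfying (by transfer) the definition of a $C^*$-algebra over ${}^*\mathbb C$, with norm valued in ${}^*\mathbb R$. For $r,s\in{}^*\mathbb R$, $r\approx s$ means $|r-s|<1/n$ for all standard $n\ge 1$; $r$ is finite ($|r|<\infty$) if $|r|<n$ for some standard $n$, and then ${}^\circ r\in\mathbb R$ is its standard part. Put $\mathrm{Fin}(\mathcal M)=\{a\in\mathcal M:\|a\|<\infty\}$; $a\approx b$ means $\|a-b\|\approx 0$; $\widehat a=\{x\in\mathcal M: x\approx a\}$. The nonstandard hull is $\widehat{\mathcal M}=\{\widehat a: a\in\mathrm{Fin}(\mathcal M)\}$ with $\widehat a+\widehat b=\widehat{a+b}$, $\widehat a\,\widehat b=\widehat{ab}$, $(\widehat a)^*=\widehat{a^*}$, unit $\widehat 1$, scalar multiplication induced likewise, and $\|\widehat a\|={}^\circ\|a\|$; it is an ordinary $C^*$-algebra. A (standard) $C^*$-algebra is a $P^*$-algebra if each of its self-adjoint elements is a norm limit of elements of the form $\sum_{i=0}^N\alpha_ip_i$, where $N\in\mathbb N$, $\alpha_i\in\mathbb C$ and the $p_i$ are projections of the algebra with $p_ip_j=0$ whenever $i\ne j$. An internal $P^*$-algebra is an internal $C^*$-algebra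 satisfying the transferred definition (with $N\in{}^*\mathbb N$, $\alpha_i\in{}^*\mathbb C$ and internal families of projections). *)

theory Defs
  imports Complex_Main "HOL-Library.Extended_Nat" "HOL-Algebra.Module"
begin

section \<open>$C^*$-algebras and $P^*$-algebras\<close>

text \<open>
  Algebras are carrier-based, extending the record of modules. The types of scalars and of norm
  values are parameters: they are \<^typ>\<open>complex\<close> and \<^typ>\<open>real\<close> for an ordinary
  $C^*$-algebra, while an internal algebra has scalars and norm values in the nonstandard universe.
\<close>

record ('s, 'a, 'r) star_algebra = "('s, 'a) module" +
  adj :: "'a \<Rightarrow> 'a"
  nrm :: "'a \<Rightarrow> 'r"

definition complex_ring :: "complex ring" where
  "complex_ring = \<lparr>carrier = UNIV, mult = (*), one = 1, zero = 0, add = (+)\<rparr>"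

text \<open>Unital $C^*$-algebras; the zero algebra is not excluded.\<close>

locale C_star_algebra =
  fixes A :: "(complex, 'a, real) star_algebra" (structure)
  assumes ring: "ring A"
    and module: "module complex_ring A"
    and smult_mult_left:
      "\<lbrakk>x \<in> carrier A; y \<in> carrier A\<rbrakk> \<Longrightarrow> (c \<odot> x) \<otimes> y = c \<odot> (x \<otimes> y)"
    and smult_mult_right:
      "\<lbrakk>x \<in> carrier A; y \<in> carrier A\<rbrakk> \<Longrightarrow> x \<otimes> (c \<odot> y) = c \<odot> (x \<otimes> y)"
    and nrm_nonneg: "x \<in> carrier A \<Longrightarrow> 0 \<le> nrm A x"
    and nrm_eq_0: "x \<in> carrier A \<Longrightarrow> nrm A x = 0 \<longleftrightarrow> x = \<zero>"
    and nrm_add: "\<lbrakk>x \<in> carrier A; y \<in> carrier A\<rbrakk> \<Longrightarrow> nrm A (x \<oplus> y) \<le> nrm A x + nrm A y"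
    and nrm_smult: "x \<in> carrier A \<Longrightarrow> nrm A (c \<odot> x) = cmod c * nrm A x"
    and nrm_mult: "\<lbrakk>x \<in> carrier A; y \<in> carrier A\<rbrakk> \<Longrightarrow> nrm A (x \<otimes> y) \<le> nrm A x * nrm A y"
    and complete:
      "\<lbrakk>range s \<subseteq> carrier A;
        \<forall>e>0. \<exists>K. \<forall>i\<ge>K. \<forall>j\<ge>K. nrm A (s i \<ominus> s j) < e\<rbrakk>
       \<Longrightarrow> \<exists>x\<in>carrier A. (\<lambda>i. nrm A (s i \<ominus> x)) \<longlonglongrightarrow> 0"
    and adj_closed: "x \<in> carrier A \<Longrightarrow> adj A x \<in> carrier A"
    and adj_adj: "x \<in> carrier A \<Longrightarrow> adj A (adj A x) = x"
    and adj_add: "\<lbrakk>x \<in> carrier A; y \<in> carrier A\<rbrakk> \<Longrightarrow> adj A (x \<oplus> y) = adj A x \<oplus> adj A y"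
    and adj_smult: "x \<in> carrier A \<Longrightarrow> adj A (c \<odot> x) = cnj c \<odot> adj A x"
    and adj_mult: "\<lbrakk>x \<in> carrier A; y \<in> carrier A\<rbrakk> \<Longrightarrow> adj A (x \<otimes> y) = adj A y \<otimes> adj A x"
    and C_star_identity: "x \<in> carrier A \<Longrightarrow> nrm A (adj A x \<otimes> x) = (nrm A x)\<^sup>2"

definition projections :: "(complex, 'a, real) star_algebra \<Rightarrow> 'a set" where
  "projections A = {p \<in> carrier A. p \<otimes>\<^bsub>A\<^esub> p = p \<and> adj A p = p}"

definition orthogonal_combinations :: "(complex, 'a, real) star_algebra \<Rightarrow> 'a set" where
  "orthogonal_combinations A =
    {x. \<exists>(N::nat) (\<alpha> :: nat \<Rightarrow> complex) p.
        (\<forall>i\<le>N. p i \<in> projections A) \<and>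
        (\<forall>i\<le>N. \<forall>j\<le>N. i \<noteq> j \<longrightarrow> p i \<otimes>\<^bsub>A\<^esub> p j = \<zero>\<^bsub>A\<^esub>) \<and>
        x = (\<Oplus>\<^bsub>A\<^esub>i\<in>{0..N}. \<alpha> i \<odot>\<^bsub>A\<^esub> p i)}"

definition P_star_algebra :: "(complex, 'a, real) star_algebra \<Rightarrow> bool" where
  "P_star_algebra A \<longleftrightarrow> C_star_algebra A \<and>
    (\<forall>a\<in>carrier A. adj A a = a \<longrightarrow>
      (\<exists>s. range s \<subseteq> orthogonal_combinations A \<and> (\<lambda>n. nrm A (a \<ominus>\<^bsub>A\<^esub> s n)) \<longlonglongrightarrow> 0))"


section \<open>Nonstandard universes\<close>

unbundle cardinal_syntax

text \<open>
  A nonstandard universe consists of a superstructure over a set of individuals containing the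
  complex numbers, an arbitrary membership structure, and the map $*$ from the first to the second.
  The second component may be a superstructure over ${}^*X$ with its true membership relation, but
  only the transfer principle is required of it.

  The superstructure has \<open>height\<close> $\theta \le \omega$. The usual case is
  $\theta = \infty$, where the universe is $\bigcup_n V_n(X)$; the finite heights, where the
  universe is $V_\theta(X)$, are included since a type containing all of $\bigcup_n V_n(X)$ for
  infinite $X$ cannot be constructed in HOL.
\<close>

record ('u, 'w) universe =
  height :: enat
  individuals :: "'u set"
  num :: "complex \<Rightarrow> 'u"
  elem :: "'u \<Rightarrow> 'u \<Rightarrow> bool"
  ielem :: "'w \<Rightarrow> 'w \<Rightarrow> bool"
  star :: "'u \<Rightarrow> 'w"

primrec level :: "('u, 'w) universe \<Rightarrow> nat \<Rightarrow> 'u set" where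
  "level U 0 = individuals U"
| "level U (Suc n) = individuals U \<union> {s. \<forall>x. elem U x s \<longrightarrow> x \<in> level U n}"

definition superstructure :: "('u, 'w) universe \<Rightarrow> bool" where
  "superstructure U \<longleftrightarrow>
    inj (num U) \<and> range (num U) \<subseteq> individuals U \<and>
    (\<forall>x. \<forall>a\<in>individuals U. \<not> elem U x a) \<and>
    (\<forall>s t. s \<notin> individuals U \<and> t \<notin> individuals U \<and> (\<forall>x. elem U x s \<longleftrightarrow> elem U x t) \<longrightarrow> s = t) \<and>
    (\<forall>n S. enat n < height U \<and> S \<subseteq> level U n \<longrightarrow>
      (\<exists>s. s \<notin> individuals U \<and> (\<forall>x. elem U x s \<longleftrightarrow> x \<in> S))) \<and>
    (\<forall>s. \<exists>n. enat n \<le> height U \<and> s \<in> level U n)"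

text \<open>Bounded formulas; variables are natural numbers, and \<open>BEx i j \<phi>\<close> is
  $\exists v_i \in v_j.\ \varphi$.\<close>

datatype bfm = Mem nat nat | Equ nat nat | Neg bfm | Conj bfm bfm | BEx nat nat bfm

primrec sat :: "('a \<Rightarrow> 'a \<Rightarrow> bool) \<Rightarrow> (nat \<Rightarrow> 'a) \<Rightarrow> bfm \<Rightarrow> bool" where
  "sat E v (Mem i j) \<longleftrightarrow> E (v i) (v j)"
| "sat E v (Equ i j) \<longleftrightarrow> v i = v j"
| "sat E v (Neg \<phi>) \<longleftrightarrow> \<not> sat E v \<phi>"
| "sat E v (Conj \<phi> \<psi>) \<longleftrightarrow> sat E v \<phi> \<and> sat E v \<psi>"
| "sat E v (BEx i j \<phi>) \<longleftrightarrow> (\<exists>x. E x (v j) \<and> sat E (v(i := x)) \<phi>)"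

definition transfer_principle :: "('u, 'w) universe \<Rightarrow> bool" where
  "transfer_principle U \<longleftrightarrow> (\<forall>\<phi> v. sat (elem U) v \<phi> \<longleftrightarrow> sat (ielem U) (star U \<circ> v) \<phi>)"

definition internal :: "('u, 'w) universe \<Rightarrow> 'w \<Rightarrow> bool" where
  "internal U x \<longleftrightarrow> (\<exists>a. ielem U x (star U a))"

definition saturated :: "'k rel \<Rightarrow> ('u, 'w) universe \<Rightarrow> bool" where
  "saturated \<kappa> U \<longleftrightarrow>
    (\<forall>F. (\<forall>b\<in>F. internal U b) \<and> |F| <o \<kappa> \<and>
         (\<forall>G. finite G \<and> G \<subseteq> F \<longrightarrow> (\<exists>x. \<forall>b\<in>G. ielem U x b)) \<longrightarrow>
         (\<exists>x. \<forall>b\<in>F. ielem U x b))"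

definition nonstandard_universe :: "'k rel \<Rightarrow> ('u, 'w) universe \<Rightarrow> bool" where
  "nonstandard_universe \<kappa> U \<longleftrightarrow> superstructure U \<and> transfer_principle U \<and> saturated \<kappa> U"


section \<open>Pairs, functions and algebras inside a membership structure\<close>

text \<open>These notions are given by bounded formulas, so that they make sense, and correspond to each
  other, on the standard and on the nonstandard side.\<close>

definition upair :: "('a \<Rightarrow> 'a \<Rightarrow> bool) \<Rightarrow> 'a \<Rightarrow> 'a \<Rightarrow> 'a \<Rightarrow> bool" where
  "upair E p x y \<longleftrightarrow> (\<forall>z. E z p \<longleftrightarrow> z = x \<or> z = y)"

text \<open>\<open>opair E p x y\<close>: $p$ is the Kuratowski pair $(x,y)$.\<close>

definition opair :: "('a \<Rightarrow> 'a \<Rightarrow> bool) \<Rightarrow> 'a \<Rightarrow> 'a \<Rightarrow> 'a \<Rightarrow> bool" where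
  "opair E p x y \<longleftrightarrow> (\<exists>s t. upair E s x x \<and> upair E t x y \<and> upair E p s t)"

definition otriple :: "('a \<Rightarrow> 'a \<Rightarrow> bool) \<Rightarrow> 'a \<Rightarrow> 'a \<Rightarrow> 'a \<Rightarrow> 'a \<Rightarrow> bool" where
  "otriple E p x y z \<longleftrightarrow> (\<exists>q. opair E q x y \<and> opair E p q z)"

definition is_map :: "('a \<Rightarrow> 'a \<Rightarrow> bool) \<Rightarrow> 'a \<Rightarrow> 'a set \<Rightarrow> 'a set \<Rightarrow> bool" where
  "is_map E f B C \<longleftrightarrow>
    (\<forall>p. E p f \<longrightarrow> (\<exists>x\<in>B. \<exists>y\<in>C. opair E p x y)) \<and>
    (\<forall>x\<in>B. \<exists>!y. \<exists>p. E p f \<and> opair E p x y)"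

definition is_map2 :: "('a \<Rightarrow> 'a \<Rightarrow> bool) \<Rightarrow> 'a \<Rightarrow> 'a set \<Rightarrow> 'a set \<Rightarrow> 'a set \<Rightarrow> bool" where
  "is_map2 E f B C D \<longleftrightarrow>
    (\<forall>p. E p f \<longrightarrow> (\<exists>x\<in>B. \<exists>y\<in>C. \<exists>z\<in>D. otriple E p x y z)) \<and>
    (\<forall>x\<in>B. \<forall>y\<in>C. \<exists>!z. \<exists>p. E p f \<and> otriple E p x y z)"

definition app :: "('a \<Rightarrow> 'a \<Rightarrow> bool) \<Rightarrow> 'a \<Rightarrow> 'a \<Rightarrow> 'a" where
  "app E f x = (THE y. \<exists>p. E p f \<and> opair E p x y)"

definition app2 :: "('a \<Rightarrow> 'a \<Rightarrow> bool) \<Rightarrow> 'a \<Rightarrow> 'a \<Rightarrow> 'a \<Rightarrow> 'a" where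
  "app2 E f x y = (THE z. \<exists>p. E p f \<and> otriple E p x y z)"

definition pfst :: "('a \<Rightarrow> 'a \<Rightarrow> bool) \<Rightarrow> 'a \<Rightarrow> 'a" where
  "pfst E p = (THE x. \<exists>y. opair E p x y)"

definition psnd :: "('a \<Rightarrow> 'a \<Rightarrow> bool) \<Rightarrow> 'a \<Rightarrow> 'a" where
  "psnd E p = (THE y. \<exists>x. opair E p x y)"

text \<open>\<open>coord E k u\<close> is the component with index $k$ of a tuple
  $u = (u_0, (u_1, (u_2, \dots)))$, for all but the last index.\<close>

definition coord :: "('a \<Rightarrow> 'a \<Rightarrow> bool) \<Rightarrow> nat \<Rightarrow> 'a \<Rightarrow> 'a" where
  "coord E k u = pfst E ((psnd E ^^ k) u)"

text \<open>As a set, an algebra is an octuple (carrier, multiplication, one, zero, addition, scalar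
  multiplication, involution, norm).\<close>

definition is_octuple :: "('a \<Rightarrow> 'a \<Rightarrow> bool) \<Rightarrow> 'a \<Rightarrow> bool" where
  "is_octuple E u \<longleftrightarrow> (\<forall>k<7. \<exists>x y. opair E ((psnd E ^^ k) u) x y)"

definition decode :: "('a \<Rightarrow> 'a \<Rightarrow> bool) \<Rightarrow> 'a \<Rightarrow> ('a, 'a, 'a) star_algebra" where
  "decode E u =
    \<lparr>carrier = {x. E x (coord E 0 u)},
     mult = app2 E (coord E 1 u),
     one = coord E 2 u,
     zero = coord E 3 u,
     add = app2 E (coord E 4 u),
     smult = app2 E (coord E 5 u),
     adj = app E (coord E 6 u),
     nrm = app E ((psnd E ^^ 7) u)\<rparr>"

definition rnum :: "('u, 'w) universe \<Rightarrow> real \<Rightarrow> 'u" where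
  "rnum U r = num U (complex_of_real r)"

definition codes_algebra :: "('u, 'w) universe \<Rightarrow> 'u \<Rightarrow> bool" where
  "codes_algebra U u \<longleftrightarrow>
    (let E = elem U; A = {x. E x (coord E 0 u)} in
      is_octuple E u \<and>
      is_map2 E (coord E 1 u) A A A \<and>
      coord E 2 u \<in> A \<and>
      coord E 3 u \<in> A \<and>
      is_map2 E (coord E 4 u) A A A \<and>
      is_map2 E (coord E 5 u) (range (num U)) A A \<and>
      is_map E (coord E 6 u) A A \<and>
      is_map E ((psnd E ^^ 7) u) A (range (rnum U)))"

definition standard_algebra :: "('u, 'w) universe \<Rightarrow> 'u \<Rightarrow> (complex, 'u, real) star_algebra" where
  "standard_algebra U u =
    (let D = decode (elem U) u in
      \<lparr>carrier = carrier D, mult = mult D, one = one D, zero = zero D, add = add D,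
       smult = (\<lambda>c. smult D (num U c)),
       adj = adj D,
       nrm = (\<lambda>x. THE r. nrm D x = rnum U r)\<rparr>)"

text \<open>
  An internal $P^*$-algebra is an object satisfying the transferred definition, that is, an element
  of ${}^*S$ for the set $S$ of all $P^*$-algebras in some $V_n(X)$. Any set of $P^*$-algebras in
  the superstructure is contained in one of this form.
\<close>

definition internal_P_star_algebra :: "('u, 'w) universe \<Rightarrow> 'w \<Rightarrow> bool" where
  "internal_P_star_algebra U m \<longleftrightarrow>
    (\<exists>S. (\<forall>u. elem U u S \<longrightarrow> codes_algebra U u \<and> P_star_algebra (standard_algebra U u)) \<and>
         ielem U m (star U S))"


section \<open>The nonstandard hull\<close>

definition set_of :: "('u, 'w) universe \<Rightarrow> 'u set \<Rightarrow> 'u" where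
  "set_of U S = (THE s. s \<notin> individuals U \<and> (\<forall>x. elem U x s \<longleftrightarrow> x \<in> S))"

text \<open>The extensions to the nonstandard reals of a property and of a binary relation of reals.\<close>

definition star_pred :: "('u, 'w) universe \<Rightarrow> (real \<Rightarrow> bool) \<Rightarrow> 'w \<Rightarrow> bool" where
  "star_pred U P x \<longleftrightarrow> ielem U x (star U (set_of U {rnum U r | r. P r}))"

definition star_rel :: "('u, 'w) universe \<Rightarrow> (real \<Rightarrow> real \<Rightarrow> bool) \<Rightarrow> 'w \<Rightarrow> 'w \<Rightarrow> bool" where
  "star_rel U R x y \<longleftrightarrow>
    (\<exists>p. opair (ielem U) p x y \<and>
         ielem U p (star U (set_of U {p. \<exists>r s. R r s \<and> opair (elem U) p (rnum U r) (rnum U s)})))"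

definition finite_real :: "('u, 'w) universe \<Rightarrow> 'w \<Rightarrow> bool" where
  "finite_real U x \<longleftrightarrow> (\<exists>n::nat. star_pred U (\<lambda>r. \<bar>r\<bar> < real n) x)"

definition real_approx :: "('u, 'w) universe \<Rightarrow> 'w \<Rightarrow> 'w \<Rightarrow> bool" where
  "real_approx U x y \<longleftrightarrow> (\<forall>n::nat\<ge>1. star_rel U (\<lambda>r s. \<bar>r - s\<bar> < 1 / real n) x y)"

definition standard_part :: "('u, 'w) universe \<Rightarrow> 'w \<Rightarrow> real" where
  "standard_part U x = (THE r. real_approx U x (star U (rnum U r)))"

text \<open>In the remaining definitions \<open>m\<close> is an internal algebra, and
  \<open>decode (ielem U) m\<close> unpacks its operations.\<close>

definition Fin :: "('u, 'w) universe \<Rightarrow> 'w \<Rightarrow> 'w set" where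
  "Fin U m = (let M = decode (ielem U) m in {a \<in> carrier M. finite_real U (nrm M a)})"

definition hat :: "('u, 'w) universe \<Rightarrow> 'w \<Rightarrow> 'w \<Rightarrow> 'w set" where
  "hat U m a =
    (let M = decode (ielem U) m in
      {x \<in> carrier M. real_approx U (nrm M (x \<ominus>\<^bsub>M\<^esub> a)) (star U (rnum U 0))})"

text \<open>The operations are defined through representatives: \<open>THE C. \<exists>a\<in>A. \<dots>\<close> is the value
  obtained from any representative \<open>a\<close> of the class \<open>A\<close>.\<close>

definition nonstandard_hull :: "('u, 'w) universe \<Rightarrow> 'w \<Rightarrow> (complex, 'w set, real) star_algebra" where
  "nonstandard_hull U m =
    (let M = decode (ielem U) m in
      \<lparr>carrier = hat U m ` Fin U m,
       mult = (\<lambda>A B. THE C. \<exists>a\<in>A. \<exists>b\<in>B. C = hat U m (a \<otimes>\<^bsub>M\<^esub> b)),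
       one = hat U m \<one>\<^bsub>M\<^esub>,
       zero = hat U m \<zero>\<^bsub>M\<^esub>,
       add = (\<lambda>A B. THE C. \<exists>a\<in>A. \<exists>b\<in>B. C = hat U m (a \<oplus>\<^bsub>M\<^esub> b)),
       smult = (\<lambda>c A. THE C. \<exists>a\<in>A. C = hat U m (star U (num U c) \<odot>\<^bsub>M\<^esub> a)),
       adj = (\<lambda>A. THE C. \<exists>a\<in>A. C = hat U m (adj M a)),
       nrm = (\<lambda>A. THE r. \<exists>a\<in>A. r = standard_part U (nrm M a))\<rparr>)"

end

(*
  A transfer principle for C*-algebras: replace the norm of x by the set of those properties of
  reals that it satisfies. On the standard side this is a principal ultrafilter. On the internal
  side, with *P for the extension of a property P, it is an ultrafilter from which standard parts
  and infinitesimal distances can be recovered. In this language the axioms of a C*-algebra are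
  first-order sentences with standard constants, and so no arithmetic of hyperreals is needed.

  In a P*-algebra the projections of an orthogonal combination can be grouped according to the
  point of a finite grid of complex numbers nearest to their coefficients. So the self-adjoint
  elements x of norm less than b are approximated up to a given error by combinations of a number
  of projections, and with coefficients, that depend on neither x nor the algebra. This is also
  such a first-order sentence. Hence it holds in the internal algebra with a standard number of
  projections, and passes to the hull, whose completeness follows from saturation.
*)
theory Submission
  imports Defs
begin

section \<open>Bounded formulas with named variables and constants\<close>

text \<open>The transferred definition, read literally, approximates by sums of hyperfinitely many
  projections with coefficients in \<open>*C\<close>, and the class of such a sum need not be a
  finite combination in the hull. This is the obstacle: the number of summands has to be bounded by
  a standard number before transfer. Three facts about a combination y of orthogonal projections p_i
  with coefficients \<alpha>_i give the bound. If p_i is nonzero, then |\<alpha>_i| \<le> ||y||, so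
  all relevant coefficients lie in a fixed disc. Moving every coefficient by at most \<delta> moves
  y by at most \<delta>, however many projections there are. Projections with equal coefficients may
  be added. Transfer applies to bounded formulas over bare membership only, whereas the operations
  are graphs of Kuratowski pairs evaluated by definite descriptions; hence the translation of an
  algebraic language into set theory. As a formula can compare a norm with standard reals only,
  inequalities between norms become statements about thresholds: ||x|| < a and ||y|| < b imply ||x +
  y|| < a + b.\<close>

datatype 'v bform =
    BMem 'v 'v
  | BEqu 'v 'v
  | BNeg "'v bform"
  | BConj "'v bform" "'v bform"
  | BBex 'v 'v "'v bform"

primrec bsat :: "('a \<Rightarrow> 'a \<Rightarrow> bool) \<Rightarrow> ('v \<Rightarrow> 'a) \<Rightarrow> 'v bform \<Rightarrow> bool" where
  "bsat E v (BMem x y) \<longleftrightarrow> E (v x) (v y)"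
| "bsat E v (BEqu x y) \<longleftrightarrow> v x = v y"
| "bsat E v (BNeg \<phi>) \<longleftrightarrow> \<not> bsat E v \<phi>"
| "bsat E v (BConj \<phi> \<psi>) \<longleftrightarrow> bsat E v \<phi> \<and> bsat E v \<psi>"
| "bsat E v (BBex x y \<phi>) \<longleftrightarrow> (\<exists>a. E a (v y) \<and> bsat E (v(x := a)) \<phi>)"

primrec bfm_of :: "('v \<Rightarrow> nat) \<Rightarrow> 'v bform \<Rightarrow> bfm" where
  "bfm_of g (BMem x y) = Mem (g x) (g y)"
| "bfm_of g (BEqu x y) = Equ (g x) (g y)"
| "bfm_of g (BNeg \<phi>) = Neg (bfm_of g \<phi>)"
| "bfm_of g (BConj \<phi> \<psi>) = Conj (bfm_of g \<phi>) (bfm_of g \<psi>)"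
| "bfm_of g (BBex x y \<phi>) = BEx (g x) (g y) (bfm_of g \<phi>)"

lemma finite_set_bform: "finite (set_bform \<phi>)"
  by (induction \<phi>) auto

text \<open>Injectivity of \<open>g\<close> on all variables of the formula keeps the update at a
  bound variable from changing the value of another one.\<close>

lemma sat_bfm_of:
  assumes "inj_on g V" "set_bform \<phi> \<subseteq> V" "\<forall>x\<in>V. w (g x) = v x"
  shows "sat E w (bfm_of g \<phi>) \<longleftrightarrow> bsat E v \<phi>"
  using assms(2,3)
proof (induction \<phi> arbitrary: v w)
  case (BBex x y \<phi>)
  have "sat E (w(g x := a)) (bfm_of g \<phi>) \<longleftrightarrow> bsat E (v(x := a)) \<phi>" for a
  proof (rule BBex.IH)
    show "\<forall>z\<in>V. (w(g x := a)) (g z) = (v(x := a)) z"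
      using BBex.prems assms(1) by (auto simp: inj_on_def)
  qed (use BBex.prems in auto)
  then show ?case using BBex.prems by auto
qed auto

text \<open>A formula has finitely many variables, so they embed into the natural numbers. Hence the
  variables may come from any type, and the objects of the superstructure themselves can name
  variables that serve as constants.\<close>

lemma bounded_transfer:
  assumes "transfer_principle U"
  shows "bsat (elem U) v \<phi> \<longleftrightarrow> bsat (ielem U) (star U \<circ> v) \<phi>"
proof -
  obtain g :: "_ \<Rightarrow> nat" where g: "inj_on g (set_bform \<phi>)"
    using finite_imp_inj_to_nat_seg[OF finite_set_bform[of \<phi>]] by blast
  define w where "w = v \<circ> inv_into (set_bform \<phi>) g"
  have w: "\<forall>x\<in>set_bform \<phi>. w (g x) = v x"
    using g by (simp add: w_def)
  have "bsat (elem U) v \<phi> \<longleftrightarrow> sat (elem U) w (bfm_of g \<phi>)"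
    using sat_bfm_of[OF g order_refl w] by simp
  also have "\<dots> \<longleftrightarrow> sat (ielem U) (star U \<circ> w) (bfm_of g \<phi>)"
    using assms by (simp add: transfer_principle_def)
  also have "\<dots> \<longleftrightarrow> bsat (ielem U) (star U \<circ> v) \<phi>"
    using w by (intro sat_bfm_of[OF g order_refl]) simp
  finally show ?thesis .
qed

abbreviation BAll :: "'v \<Rightarrow> 'v \<Rightarrow> 'v bform \<Rightarrow> 'v bform" where
  "BAll x y \<phi> \<equiv> BNeg (BBex x y (BNeg \<phi>))"

abbreviation BImp :: "'v bform \<Rightarrow> 'v bform \<Rightarrow> 'v bform" where
  "BImp \<phi> \<psi> \<equiv> BNeg (BConj \<phi> (BNeg \<psi>))"

text \<open>\<open>X i\<close> are the variables of an algebraic formula, \<open>T i\<close> auxiliary variables, \<open>K i\<close> and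
  \<open>W i\<close> the components and the tails of a tuple, and \<open>C c\<close> a constant.\<close>

datatype 'c var = X nat | T nat | K nat | W nat | C 'c

text \<open>\<open>low n x\<close>: the variable \<open>x\<close> is none of \<open>T n\<close>, \<open>T (n + 1)\<close>, \<dots>, which may
  therefore be bound in formulas about \<open>x\<close>.\<close>

fun low :: "nat \<Rightarrow> 'c var \<Rightarrow> bool" where
  "low n (T i) \<longleftrightarrow> i < n"
| "low n _ \<longleftrightarrow> True"

lemma low_rules:
  "low n x \<Longrightarrow> low (Suc n) x"
  "low 0 x \<Longrightarrow> low (numeral k) x"
  "low n x \<Longrightarrow> x \<noteq> T n"
  "low n x \<Longrightarrow> T n \<noteq> x"
  by (cases x; auto)+

section \<open>Bounded formulas for pairs and triples\<close>

definition upair_form :: "nat \<Rightarrow> 'c var \<Rightarrow> 'c var \<Rightarrow> 'c var \<Rightarrow> 'c var bform" where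
  "upair_form n p x y = BConj (BMem x p) (BConj (BMem y p)
     (BAll (T n) p (BImp (BNeg (BEqu (T n) x)) (BEqu (T n) y))))"

definition opair_form :: "nat \<Rightarrow> 'c var \<Rightarrow> 'c var \<Rightarrow> 'c var \<Rightarrow> 'c var bform" where
  "opair_form n p x y = BBex (T n) p (BBex (T (Suc n)) p
     (BConj (upair_form (n + 2) (T n) x x)
       (BConj (upair_form (n + 2) (T (Suc n)) x y) (upair_form (n + 2) p (T n) (T (Suc n))))))"

text \<open>The inner pair is not an element of the triple \<open>p\<close> but of an element of it,
  so the intermediate set \<open>T n\<close> is quantified as well.\<close>

definition otriple_form ::
    "nat \<Rightarrow> 'c var \<Rightarrow> 'c var \<Rightarrow> 'c var \<Rightarrow> 'c var \<Rightarrow> 'c var bform" where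
  "otriple_form n p x y z = BBex (T n) p (BBex (T (Suc n)) (T n)
     (BConj (opair_form (n + 2) (T (Suc n)) x y) (opair_form (n + 2) p (T (Suc n)) z)))"

lemma bsat_upair_form:
  assumes "low n p" "low n x" "low n y"
  shows "bsat E v (upair_form n p x y) \<longleftrightarrow> upair E (v p) (v x) (v y)"
  using assms by (auto simp: upair_form_def upair_def low_rules)

lemma upair_elem: "upair E p x y \<Longrightarrow> E x p" "upair E p x y \<Longrightarrow> E y p"
  by (auto simp: upair_def)

text \<open>The two sets whose existence \<open>opair\<close> asserts are elements of
  \<open>p\<close>, so bounding the quantifiers by \<open>p\<close> loses nothing.\<close>

lemma bsat_opair_form:
  assumes "low n p" "low n x" "low n y"
  shows "bsat E v (opair_form n p x y) \<longleftrightarrow> opair E (v p) (v x) (v y)"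
  using assms
  by (auto simp: opair_form_def opair_def bsat_upair_form low_rules dest: upair_elem)

lemma opair_fst_mem: "opair E p x y \<Longrightarrow> \<exists>s. E s p \<and> E x s"
  by (auto simp: opair_def upair_def)

lemma bsat_otriple_form:
  assumes "low n p" "low n x" "low n y" "low n z"
  shows "bsat E v (otriple_form n p x y z) \<longleftrightarrow> otriple E (v p) (v x) (v y) (v z)"
proof -
  have "bsat E v (otriple_form n p x y z) \<longleftrightarrow>
    (\<exists>s. E s (v p) \<and> (\<exists>q. E q s \<and> opair E q (v x) (v y) \<and> opair E (v p) q (v z)))"
    using assms by (simp add: otriple_form_def bsat_opair_form low_rules)
  also have "\<dots> \<longleftrightarrow> otriple E (v p) (v x) (v y) (v z)"
    unfolding otriple_def by (meson opair_fst_mem)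
  finally show ?thesis .
qed

text \<open>Only elements are compared, and extensionality is never invoked, so this holds in an
  arbitrary membership structure and in particular on the nonstandard side.\<close>

lemma opair_inj:
  assumes "opair E p x y" "opair E p x' y'"
  shows "x = x' \<and> y = y'"
  using assms unfolding opair_def upair_def by metis

lemma pfst_eq: "opair E p x y \<Longrightarrow> pfst E p = x"
  unfolding pfst_def by (rule the_equality) (auto dest: opair_inj)

lemma psnd_eq: "opair E p x y \<Longrightarrow> psnd E p = y"
  unfolding psnd_def by (rule the_equality) (auto dest: opair_inj)

section \<open>Maps given by their graphs\<close>

text \<open>\<open>app\<close> and \<open>app2\<close> are definite descriptions, for which bounded
  formulas have no syntax. Formulas speak of graphs instead; \<open>graph1_app\<close> and
  \<open>graph2_app2\<close> lead back to the operations.\<close>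

definition graph1 :: "('a \<Rightarrow> 'a \<Rightarrow> bool) \<Rightarrow> 'a \<Rightarrow> 'a \<Rightarrow> 'a \<Rightarrow> bool" where
  "graph1 E f x y \<longleftrightarrow> (\<exists>p. E p f \<and> opair E p x y)"

definition graph2 :: "('a \<Rightarrow> 'a \<Rightarrow> bool) \<Rightarrow> 'a \<Rightarrow> 'a \<Rightarrow> 'a \<Rightarrow> 'a \<Rightarrow> bool" where
  "graph2 E f x y z \<longleftrightarrow> (\<exists>p. E p f \<and> otriple E p x y z)"

definition valued_in :: "('a \<Rightarrow> 'a \<Rightarrow> bool) \<Rightarrow> 'a \<Rightarrow> 'a \<Rightarrow> bool" where
  "valued_in E f B \<longleftrightarrow> (\<forall>p. E p f \<longrightarrow> (\<exists>q y. E y B \<and> opair E p q y))"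

text \<open>A bounded formula can state uniqueness only among the values in \<open>B\<close>;
  \<open>valued_in\<close> excludes values elsewhere.\<close>

definition fun1 :: "('a \<Rightarrow> 'a \<Rightarrow> bool) \<Rightarrow> 'a \<Rightarrow> 'a \<Rightarrow> 'a \<Rightarrow> bool" where
  "fun1 E f A B \<longleftrightarrow> valued_in E f B \<and>
    (\<forall>x. E x A \<longrightarrow> (\<exists>y. E y B \<and> graph1 E f x y \<and> (\<forall>z. graph1 E f x z \<longrightarrow> E z B \<longrightarrow> z = y)))"

text \<open>This one shape, with values in the set of the second arguments, serves multiplication,
  addition and scalar multiplication.\<close>

definition fun2 :: "('a \<Rightarrow> 'a \<Rightarrow> bool) \<Rightarrow> 'a \<Rightarrow> 'a \<Rightarrow> 'a \<Rightarrow> bool" where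
  "fun2 E f A B \<longleftrightarrow> valued_in E f B \<and>
    (\<forall>x. E x A \<longrightarrow> (\<forall>x'. E x' B \<longrightarrow>
      (\<exists>y. E y B \<and> graph2 E f x x' y \<and> (\<forall>z. graph2 E f x x' z \<longrightarrow> E z B \<longrightarrow> z = y))))"

definition graph1_form :: "nat \<Rightarrow> 'c var \<Rightarrow> 'c var \<Rightarrow> 'c var \<Rightarrow> 'c var bform" where
  "graph1_form n f x y = BBex (T n) f (opair_form (Suc n) (T n) x y)"

definition graph2_form :: "nat \<Rightarrow> 'c var \<Rightarrow> 'c var \<Rightarrow> 'c var \<Rightarrow> 'c var \<Rightarrow> 'c var bform" where
  "graph2_form n f x y z = BBex (T n) f (otriple_form (Suc n) (T n) x y z)"

definition valued_in_form :: "'c var \<Rightarrow> 'c var \<Rightarrow> 'c var bform" where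
  "valued_in_form f B =
    BAll (T 0) f (BBex (T 1) (T 0) (BBex (T 2) (T 1) (BBex (T 3) B (opair_form 4 (T 0) (T 2) (T 3)))))"

definition fun1_form :: "'c var \<Rightarrow> 'c var \<Rightarrow> 'c var \<Rightarrow> 'c var bform" where
  "fun1_form f A B = BConj (valued_in_form f B)
    (BAll (T 0) A (BBex (T 1) B (BConj (graph1_form 3 f (T 0) (T 1))
      (BAll (T 2) B (BImp (graph1_form 3 f (T 0) (T 2)) (BEqu (T 2) (T 1)))))))"

definition fun2_form :: "'c var \<Rightarrow> 'c var \<Rightarrow> 'c var \<Rightarrow> 'c var bform" where
  "fun2_form f A B = BConj (valued_in_form f B)
    (BAll (T 0) A (BAll (T 1) B (BBex (T 2) B (BConj (graph2_form 4 f (T 0) (T 1) (T 2))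
      (BAll (T 3) B (BImp (graph2_form 4 f (T 0) (T 1) (T 3)) (BEqu (T 3) (T 2))))))))"

lemma bsat_graph1_form:
  assumes "low n f" "low n x" "low n y"
  shows "bsat E v (graph1_form n f x y) \<longleftrightarrow> graph1 E (v f) (v x) (v y)"
  using assms
  by (auto simp: graph1_form_def graph1_def bsat_opair_form low_rules)

lemma bsat_graph2_form:
  assumes "low n f" "low n x" "low n y" "low n z"
  shows "bsat E v (graph2_form n f x y z) \<longleftrightarrow> graph2 E (v f) (v x) (v y) (v z)"
  using assms
  by (auto simp: graph2_form_def graph2_def bsat_otriple_form low_rules)

lemma bsat_valued_in_form:
  assumes "low 0 f" "low 0 B"
  shows "bsat E v (valued_in_form f B) \<longleftrightarrow> valued_in E (v f) (v B)"
proof -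
  have "bsat E v (valued_in_form f B) \<longleftrightarrow>
    (\<forall>p. E p (v f) \<longrightarrow> (\<exists>s. E s p \<and> (\<exists>q. E q s \<and> (\<exists>y. E y (v B) \<and> opair E p q y))))"
    using assms by (simp add: valued_in_form_def bsat_opair_form low_rules)
  also have "\<dots> \<longleftrightarrow> valued_in E (v f) (v B)"
    unfolding valued_in_def by (meson opair_fst_mem)
  finally show ?thesis .
qed

lemma bsat_fun1_form:
  assumes "low 0 f" "low 0 A" "low 0 B"
  shows "bsat E v (fun1_form f A B) \<longleftrightarrow> fun1 E (v f) (v A) (v B)"
  using assms
  by (simp add: fun1_form_def fun1_def bsat_valued_in_form bsat_graph1_form low_rules) blast

lemma bsat_fun2_form:
  assumes "low 0 f" "low 0 A" "low 0 B"
  shows "bsat E v (fun2_form f A B) \<longleftrightarrow> fun2 E (v f) (v A) (v B)"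
  using assms
  by (simp add: fun2_form_def fun2_def bsat_valued_in_form bsat_graph2_form low_rules)

lemma valued_in_graph1: "valued_in E f B \<Longrightarrow> graph1 E f x y \<Longrightarrow> E y B"
  unfolding valued_in_def graph1_def by (elim exE conjE) (drule spec, drule (1) mp, auto dest: opair_inj)

lemma valued_in_graph2: "valued_in E f B \<Longrightarrow> graph2 E f x x' y \<Longrightarrow> E y B"
  unfolding valued_in_def graph2_def otriple_def
  by (elim exE conjE) (drule spec, drule (1) mp, auto dest: opair_inj)

lemma graph1_app:
  assumes "fun1 E f A B" "E x A"
  shows "E (app E f x) B" "graph1 E f x y \<longleftrightarrow> y = app E f x"
proof -
  obtain y0 where y0: "E y0 B" "graph1 E f x y0" "\<forall>z. graph1 E f x z \<longrightarrow> E z B \<longrightarrow> z = y0"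
    using assms unfolding fun1_def by auto
  have v: "valued_in E f B" using assms by (simp add: fun1_def)
  have *: "graph1 E f x z \<longleftrightarrow> z = y0" for z
    using y0 valued_in_graph1[OF v] by metis
  then have "app E f x = y0"
    unfolding app_def graph1_def by simp
  with * y0(1) show "E (app E f x) B" "graph1 E f x y \<longleftrightarrow> y = app E f x" by metis+
qed

lemma graph2_app2:
  assumes "fun2 E f A B" "E x A" "E x' B"
  shows "E (app2 E f x x') B" "graph2 E f x x' y \<longleftrightarrow> y = app2 E f x x'"
proof -
  have "\<exists>y. E y B \<and> graph2 E f x x' y \<and> (\<forall>z. graph2 E f x x' z \<longrightarrow> E z B \<longrightarrow> z = y)"
    using assms unfolding fun2_def by simp
  then obtain y0 where
    y0: "E y0 B" "graph2 E f x x' y0" "\<forall>z. graph2 E f x x' z \<longrightarrow> E z B \<longrightarrow> z = y0"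
    by auto
  have v: "valued_in E f B" using assms by (simp add: fun2_def)
  have *: "graph2 E f x x' z \<longleftrightarrow> z = y0" for z
    using y0 valued_in_graph2[OF v] by metis
  then have "app2 E f x x' = y0"
    unfolding app2_def graph2_def by simp
  with * y0(1) show "E (app2 E f x x') B" "graph2 E f x x' y \<longleftrightarrow> y = app2 E f x x'" by metis+
qed

lemma fun1_if_is_map:
  assumes "is_map E f {x. E x A} {y. E y B}"
  shows "fun1 E f A B"
proof -
  have v: "valued_in E f B"
    unfolding valued_in_def
  proof (intro allI impI)
    fix p assume "E p f"
    then have "\<exists>x\<in>{x. E x A}. \<exists>y\<in>{y. E y B}. opair E p x y"
      using assms unfolding is_map_def by simp
    then show "\<exists>q y. E y B \<and> opair E p q y" by auto
  qed
  show ?thesis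
    unfolding fun1_def
  proof (intro conjI allI impI v)
    fix x assume "E x A"
    then have "\<exists>!y. graph1 E f x y"
      using assms unfolding is_map_def graph1_def by simp
    then show "\<exists>y. E y B \<and> graph1 E f x y \<and> (\<forall>z. graph1 E f x z \<longrightarrow> E z B \<longrightarrow> z = y)"
      using valued_in_graph1[OF v] by metis
  qed
qed

lemma fun2_if_is_map2:
  assumes "is_map2 E f {x. E x A} {y. E y B} {y. E y B}"
  shows "fun2 E f A B"
proof -
  have v: "valued_in E f B"
    unfolding valued_in_def
  proof (intro allI impI)
    fix p assume "E p f"
    then have "\<exists>x\<in>{x. E x A}. \<exists>y\<in>{y. E y B}. \<exists>z\<in>{y. E y B}. otriple E p x y z"
      using assms unfolding is_map2_def by simp
    then show "\<exists>q y. E y B \<and> opair E p q y" unfolding otriple_def by auto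
  qed
  show ?thesis
    unfolding fun2_def
  proof (intro conjI allI impI v)
    fix x x' assume "E x A" "E x' B"
    then have "\<exists>!y. graph2 E f x x' y"
      using assms unfolding is_map2_def graph2_def by simp
    then show "\<exists>y. E y B \<and> graph2 E f x x' y \<and> (\<forall>z. graph2 E f x x' z \<longrightarrow> E z B \<longrightarrow> z = y)"
      using valued_in_graph2[OF v] by metis
  qed
qed

section \<open>Decoding algebras and the transfer of algebraic formulas\<close>

definition nums :: "('u, 'w) universe \<Rightarrow> 'u" where
  "nums U = set_of U (range (num U))"

definition reals_with :: "('u, 'w) universe \<Rightarrow> (real \<Rightarrow> bool) \<Rightarrow> 'u" where
  "reals_with U P = set_of U {rnum U r |r. P r}"

text \<open>The two readings of a code, as a standard or as an internal algebra, are the cases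
  \<open>E = elem U\<close>, \<open>\<iota> = id\<close> and \<open>E = ielem U\<close>, \<open>\<iota> = star U\<close> of the following definitions.
  The norm of \<open>x\<close> is replaced by the ultrafilter of the properties that it has.\<close>

definition alg :: "('u, 'w) universe \<Rightarrow> ('a \<Rightarrow> 'a \<Rightarrow> bool) \<Rightarrow> ('u \<Rightarrow> 'a) \<Rightarrow> 'a \<Rightarrow>
    (complex, 'a, (real \<Rightarrow> bool) \<Rightarrow> bool) star_algebra" where
  "alg U E \<iota> u =
    (let D = decode E u in
      \<lparr>carrier = carrier D, mult = mult D, one = one D, zero = zero D, add = add D,
       smult = (\<lambda>c. smult D (\<iota> (num U c))), adj = adj D,
       nrm = (\<lambda>x P. x \<in> carrier D \<and> E (nrm D x) (\<iota> (reals_with U P)))\<rparr>)"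

definition code :: "('u, 'w) universe \<Rightarrow> ('a \<Rightarrow> 'a \<Rightarrow> bool) \<Rightarrow> ('u \<Rightarrow> 'a) \<Rightarrow> 'a \<Rightarrow> bool" where
  "code U E \<iota> u \<longleftrightarrow>
    (let A = coord E 0 u in
      is_octuple E u \<and>
      fun2 E (coord E 1 u) A A \<and> E (coord E 2 u) A \<and> E (coord E 3 u) A \<and>
      fun2 E (coord E 4 u) A A \<and> fun2 E (coord E 5 u) (\<iota> (nums U)) A \<and>
      fun1 E (coord E 6 u) A A \<and> fun1 E ((psnd E ^^ 7) u) A (\<iota> (reals_with U (\<lambda>_. True))))"

text \<open>The clause \<open>is_octuple\<close> of \<open>code\<close> has no counterpart here:
  \<open>split_form\<close> establishes it while extracting the components.\<close>

definition code_form :: "('u, 'w) universe \<Rightarrow> 'u var bform" where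
  "code_form U =
    BConj (fun2_form (K 1) (K 0) (K 0)) (BConj (BMem (K 2) (K 0)) (BConj (BMem (K 3) (K 0))
    (BConj (fun2_form (K 4) (K 0) (K 0)) (BConj (fun2_form (K 5) (C (nums U)) (K 0))
    (BConj (fun1_form (K 6) (K 0) (K 0)) (fun1_form (W 7) (K 0) (C (reals_with U (\<lambda>_. True)))))))))"

text \<open>\<open>W 7\<close>, the last tail, is the norm. The variables \<open>K j\<close> with
  \<open>7 \<le> j\<close> are left free, so they can be bound without disturbing the
  decoding.\<close>

definition decodes :: "('a \<Rightarrow> 'a \<Rightarrow> bool) \<Rightarrow> ('u \<Rightarrow> 'a) \<Rightarrow> 'a \<Rightarrow> ('u var \<Rightarrow> 'a) \<Rightarrow> bool" where
  "decodes E \<iota> u v \<longleftrightarrow>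
    (\<forall>k<7. v (K k) = coord E k u) \<and> v (W 7) = (psnd E ^^ 7) u \<and> (\<forall>c. v (C c) = \<iota> c)"

lemma decodes_upd [simp]:
  "decodes E \<iota> u (v(X i := a)) = decodes E \<iota> u v"
  "decodes E \<iota> u (v(T i := a)) = decodes E \<iota> u v"
  "7 \<le> j \<Longrightarrow> decodes E \<iota> u (v(K j := a)) = decodes E \<iota> u v"
  by (auto simp: decodes_def)

lemma decodes_val:
  assumes "decodes E \<iota> u v"
  shows "k < 7 \<Longrightarrow> v (K k) = coord E k u" "v (W 7) = (psnd E ^^ 7) u" "v (C c) = \<iota> c"
  using assms by (auto simp: decodes_def)

lemma bsat_code_form:
  assumes "decodes E \<iota> u v"
  shows "code U E \<iota> u \<longleftrightarrow> is_octuple E u \<and> bsat E v (code_form U)"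
  unfolding code_def code_form_def Let_def
  by (simp add: bsat_fun1_form bsat_fun2_form decodes_val[OF assms])

text \<open>Both components of a Kuratowski pair are elements of its elements, whence the bounds
  \<open>T 0\<close> and \<open>T 1\<close>. Folding over \<open>[0..<7]\<close> unpacks the whole
  tuple, each step continuing with the tail \<open>W (Suc k)\<close>.\<close>

definition split_form :: "nat \<Rightarrow> 'c var bform \<Rightarrow> 'c var bform" where
  "split_form k \<phi> = BBex (T 0) (W k) (BBex (T 1) (W k) (BBex (K k) (T 0) (BBex (W (Suc k)) (T 1)
     (BConj (opair_form 2 (W k) (K k) (W (Suc k))) \<phi>))))"

lemma bsat_split_form:
  "bsat E v (split_form k \<phi>) \<longleftrightarrow>
    (\<exists>s. E s (v (W k)) \<and> (\<exists>t. E t (v (W k)) \<and> (\<exists>x. E x s \<and> (\<exists>y. E y t \<and>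
      opair E (v (W k)) x y \<and> bsat E (v(T 0 := s, T 1 := t, K k := x, W (Suc k) := y)) \<phi>))))"
  by (simp add: split_form_def bsat_opair_form)

lemma opair_split_mem:
  "opair E p x y \<Longrightarrow> \<exists>s. E s p \<and> (\<exists>t. E t p \<and> E x s \<and> E y t)"
proof -
  assume "opair E p x y"
  then obtain s t where "upair E s x x" "upair E t x y" "upair E p s t"
    unfolding opair_def by blast
  then show ?thesis
    using upair_elem[of E s x x] upair_elem[of E t x y] upair_elem[of E p s t] by blast
qed

lemma decode_step:
  assumes "opair E ((psnd E ^^ k) u) x y"
  shows "x = coord E k u" "y = (psnd E ^^ Suc k) u"
  using pfst_eq[OF assms] psnd_eq[OF assms] by (simp_all add: coord_def)

lemma bsat_split_formI:
  assumes "\<And>v. decodes E \<iota> u v \<Longrightarrow> bsat E v \<phi>" "is_octuple E u"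
    and "k \<le> 7" "v (W k) = (psnd E ^^ k) u" "\<forall>j<k. v (K j) = coord E j u" "\<forall>c. v (C c) = \<iota> c"
  shows "bsat E v (foldr split_form [k..<7] \<phi>)"
  using assms(3-6)
proof (induction "7 - k" arbitrary: k v)
  case 0
  then show ?case by (auto simp: decodes_def intro!: assms(1))
next
  case (Suc n)
  then have k: "k < 7" by simp
  then obtain x y where xy: "opair E (v (W k)) x y"
    using assms(2) Suc.prems(2) unfolding is_octuple_def by metis
  then obtain s t where st: "E s (v (W k))" "E t (v (W k))" "E x s" "E y t"
    using opair_split_mem[OF xy] by blast
  define v' where "v' = v(T 0 := s, T 1 := t, K k := x, W (Suc k) := y)"
  have "bsat E v' (foldr split_form [Suc k..<7] \<phi>)"
  proof (rule Suc.hyps(1))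
    show "v' (W (Suc k)) = (psnd E ^^ Suc k) u"
      using decode_step[OF xy[unfolded Suc.prems(2)]] by (simp add: v'_def)
    show "\<forall>j<Suc k. v' (K j) = coord E j u"
      using decode_step[OF xy[unfolded Suc.prems(2)]] Suc.prems(3) by (auto simp: v'_def less_Suc_eq)
    show "\<forall>c. v' (C c) = \<iota> c"
      using Suc.prems(4) by (simp add: v'_def)
  qed (use Suc in auto)
  then have "bsat E v (split_form k (foldr split_form [Suc k..<7] \<phi>))"
    using st xy unfolding bsat_split_form v'_def by blast
  then show ?case using k by (simp add: upt_conv_Cons)
qed

text \<open>The premise on all \<open>j < k\<close> collects the pairs met so far; at
  \<open>k = 7\<close> it has become \<open>is_octuple\<close>.\<close>

lemma bsat_split_formD:
  assumes "bsat E v (foldr split_form [k..<7] \<phi>)"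
    and "k \<le> 7" "v (W k) = (psnd E ^^ k) u" "\<forall>j<k. v (K j) = coord E j u" "\<forall>c. v (C c) = \<iota> c"
    and "\<forall>j<k. \<exists>x y. opair E ((psnd E ^^ j) u) x y"
  shows "\<exists>v'. decodes E \<iota> u v' \<and> is_octuple E u \<and> bsat E v' \<phi>"
  using assms
proof (induction "7 - k" arbitrary: k v)
  case 0
  then have "k = 7" by simp
  with 0 show ?case by (intro exI[of _ v]) (auto simp: decodes_def is_octuple_def)
next
  case (Suc n)
  then have k: "k < 7" by simp
  then have "bsat E v (split_form k (foldr split_form [Suc k..<7] \<phi>))"
    using Suc.prems(1) by (simp add: upt_conv_Cons)
  then obtain s t x y where "opair E (v (W k)) x y" and
    sat: "bsat E (v(T 0 := s, T 1 := t, K k := x, W (Suc k) := y)) (foldr split_form [Suc k..<7] \<phi>)"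
    unfolding bsat_split_form by blast
  then have xy: "opair E (v (W k)) x y" by simp
  define v' where "v' = v(T 0 := s, T 1 := t, K k := x, W (Suc k) := y)"
  have "\<exists>w. decodes E \<iota> u w \<and> is_octuple E u \<and> bsat E w \<phi>"
  proof (rule Suc.hyps(1))
    show "bsat E v' (foldr split_form [Suc k..<7] \<phi>)"
      using sat by (simp add: v'_def)
    show "v' (W (Suc k)) = (psnd E ^^ Suc k) u"
      using decode_step[OF xy[unfolded Suc.prems(3)]] by (simp add: v'_def)
    show "\<forall>j<Suc k. v' (K j) = coord E j u"
      using decode_step[OF xy[unfolded Suc.prems(3)]] Suc.prems(4) by (auto simp: v'_def less_Suc_eq)
    show "\<forall>c. v' (C c) = \<iota> c"
      using Suc.prems(5) by (simp add: v'_def)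
    show "\<forall>j<Suc k. \<exists>x y. opair E ((psnd E ^^ j) u) x y"
      using xy Suc.prems(3,6) by (auto simp: less_Suc_eq)
  qed (use Suc in auto)
  then show ?case by (simp add: v'_def)
qed

text \<open>What is transferred is a single bounded sentence: every \<open>u\<close> in
  \<open>S\<close> has components that satisfy \<open>code_form\<close> and \<open>\<phi>\<close>.
  Its nonstandard version quantifies over the elements of \<open>star U S\<close>, and
  \<open>m\<close> is one of them.\<close>

lemma code_transfer:
  assumes "transfer_principle U"
    and "\<And>u v. elem U u S \<Longrightarrow> decodes (elem U) id u v \<Longrightarrow> bsat (elem U) v \<phi>"
    and "\<And>u. elem U u S \<Longrightarrow> code U (elem U) id u"
    and m: "ielem U m (star U S)"
  shows "code U (ielem U) (star U) m \<and>
    (\<exists>v. decodes (ielem U) (star U) m v \<and> bsat (ielem U) v \<phi>)"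
proof -
  let ?\<psi> = "foldr split_form [0..<7] (BConj (code_form U) \<phi>)"
  \<comment> \<open>The default \<open>S\<close> is an arbitrary choice, as \<open>\<phi>\<close> is
    assumed for every valuation that decodes \<open>u\<close>.\<close>
  define v where "v = (\<lambda>x. case x of C c \<Rightarrow> c | _ \<Rightarrow> S)"
  have sat: "bsat (elem U) w ?\<psi>" if "elem U u S" "w (W 0) = u" "\<forall>c. w (C c) = c" for u w
    using that assms(2,3)
    by (intro bsat_split_formI[where \<iota> = id and u = u])
       (auto simp: bsat_code_form[of "elem U" id u, symmetric] code_def Let_def
          dest: bsat_code_form[of _ _ _ _ U])
  have "bsat (elem U) v (BAll (W 0) (C S) ?\<psi>)"
    unfolding bsat.simps by (auto simp: v_def intro!: sat)
  then have "bsat (ielem U) (star U \<circ> v) (BAll (W 0) (C S) ?\<psi>)"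
    using bounded_transfer[OF assms(1)] by blast
  then have *: "bsat (ielem U) ((star U \<circ> v)(W 0 := m)) ?\<psi>"
    using m unfolding bsat.simps by (simp add: v_def del: upt_rec_numeral foldr.simps)
  obtain w where w: "decodes (ielem U) (star U) m w" "is_octuple (ielem U) m"
      "bsat (ielem U) w (BConj (code_form U) \<phi>)"
    using bsat_split_formD[OF *, of m "star U"] by (auto simp: v_def)
  then show ?thesis
    using bsat_code_form[OF w(1), of U] by auto
qed

section \<open>The first-order language of star-algebras\<close>

datatype aterm =
    AVar nat
  | AOne
  | AZero
  | AMult aterm aterm
  | AAdd aterm aterm
  | ASmult complex aterm
  | AAdj aterm

text \<open>Standard scalars enter as unary function symbols and properties of norms as unary
  predicates. So quantifiers range over the carrier only, and no variable stands for a scalar or for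
  a norm.\<close>

datatype aform =
    AEq aterm aterm
  | ANrm "real \<Rightarrow> bool" aterm
  | ANeg aform
  | AConj aform aform
  | AEx nat aform

primrec tval :: "(complex, 'a, 'r) star_algebra \<Rightarrow> (nat \<Rightarrow> 'a) \<Rightarrow> aterm \<Rightarrow> 'a" where
  "tval D e (AVar i) = e i"
| "tval D e AOne = \<one>\<^bsub>D\<^esub>"
| "tval D e AZero = \<zero>\<^bsub>D\<^esub>"
| "tval D e (AMult s t) = tval D e s \<otimes>\<^bsub>D\<^esub> tval D e t"
| "tval D e (AAdd s t) = tval D e s \<oplus>\<^bsub>D\<^esub> tval D e t"
| "tval D e (ASmult c t) = c \<odot>\<^bsub>D\<^esub> tval D e t"
| "tval D e (AAdj t) = adj D (tval D e t)"

primrec holds ::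
    "(complex, 'a, (real \<Rightarrow> bool) \<Rightarrow> bool) star_algebra \<Rightarrow> (nat \<Rightarrow> 'a) \<Rightarrow> aform \<Rightarrow> bool" where
  "holds D e (AEq s t) \<longleftrightarrow> tval D e s = tval D e t"
| "holds D e (ANrm P t) \<longleftrightarrow> nrm D (tval D e t) P"
| "holds D e (ANeg \<phi>) \<longleftrightarrow> \<not> holds D e \<phi>"
| "holds D e (AConj \<phi> \<psi>) \<longleftrightarrow> holds D e \<phi> \<and> holds D e \<psi>"
| "holds D e (AEx i \<phi>) \<longleftrightarrow> (\<exists>x\<in>carrier D. holds D (e(i := x)) \<phi>)"

primrec tvars :: "aterm \<Rightarrow> nat set" where
  "tvars (AVar i) = {i}"
| "tvars AOne = {}"
| "tvars AZero = {}"
| "tvars (AMult s t) = tvars s \<union> tvars t"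
| "tvars (AAdd s t) = tvars s \<union> tvars t"
| "tvars (ASmult c t) = tvars t"
| "tvars (AAdj t) = tvars t"

primrec fvars :: "aform \<Rightarrow> nat set" where
  "fvars (AEq s t) = tvars s \<union> tvars t"
| "fvars (ANrm P t) = tvars t"
| "fvars (ANeg \<phi>) = fvars \<phi>"
| "fvars (AConj \<phi> \<psi>) = fvars \<phi> \<union> fvars \<psi>"
| "fvars (AEx i \<phi>) = fvars \<phi> - {i}"

abbreviation AAll :: "nat \<Rightarrow> aform \<Rightarrow> aform" where
  "AAll i \<phi> \<equiv> ANeg (AEx i (ANeg \<phi>))"

abbreviation AImp :: "aform \<Rightarrow> aform \<Rightarrow> aform" where
  "AImp \<phi> \<psi> \<equiv> ANeg (AConj \<phi> (ANeg \<psi>))"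

abbreviation AIff :: "aform \<Rightarrow> aform \<Rightarrow> aform" where
  "AIff \<phi> \<psi> \<equiv> AConj (AImp \<phi> \<psi>) (AImp \<psi> \<phi>)"

text \<open>\<open>term_form U n t y\<close> says that \<open>y\<close> is the value of \<open>t\<close>.\<close>

primrec term_form :: "('u, 'w) universe \<Rightarrow> nat \<Rightarrow> aterm \<Rightarrow> 'u var \<Rightarrow> 'u var bform" where
  "term_form U n (AVar i) y = BEqu y (X i)"
| "term_form U n AOne y = BEqu y (K 2)"
| "term_form U n AZero y = BEqu y (K 3)"
| "term_form U n (AMult s t) y = BBex (T n) (K 0) (BBex (T (Suc n)) (K 0)
     (BConj (term_form U (n + 2) s (T n)) (BConj (term_form U (n + 2) t (T (Suc n)))
       (graph2_form (n + 2) (K 1) (T n) (T (Suc n)) y))))"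
| "term_form U n (AAdd s t) y = BBex (T n) (K 0) (BBex (T (Suc n)) (K 0)
     (BConj (term_form U (n + 2) s (T n)) (BConj (term_form U (n + 2) t (T (Suc n)))
       (graph2_form (n + 2) (K 4) (T n) (T (Suc n)) y))))"
| "term_form U n (ASmult c t) y = BBex (T n) (K 0)
     (BConj (term_form U (Suc n) t (T n)) (graph2_form (Suc n) (K 5) (C (num U c)) (T n) y))"
| "term_form U n (AAdj t) y = BBex (T n) (K 0)
     (BConj (term_form U (Suc n) t (T n)) (graph1_form (Suc n) (K 6) (T n) y))"

primrec form_of :: "('u, 'w) universe \<Rightarrow> aform \<Rightarrow> 'u var bform" where
  "form_of U (AEq s t) = BBex (T 0) (K 0) (BConj (term_form U 1 s (T 0)) (term_form U 1 t (T 0)))"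
| "form_of U (ANrm P t) = BBex (T 0) (K 0) (BConj (term_form U 1 t (T 0))
     (BBex (T 1) (C (reals_with U P)) (graph1_form 2 (W 7) (T 0) (T 1))))"
| "form_of U (ANeg \<phi>) = BNeg (form_of U \<phi>)"
| "form_of U (AConj \<phi> \<psi>) = BConj (form_of U \<phi>) (form_of U \<psi>)"
| "form_of U (AEx i \<phi>) = BBex (X i) (K 0) (form_of U \<phi>)"

locale algebra_code =
  fixes U :: "('u, 'w) universe" and E :: "'a \<Rightarrow> 'a \<Rightarrow> bool" and \<iota> :: "'u \<Rightarrow> 'a" and u :: 'a
  assumes code: "code U E \<iota> u"
    and num_mem: "E (\<iota> (num U c)) (\<iota> (nums U))"
begin

abbreviation "D \<equiv> alg U E \<iota> u"

lemma mem_carrier: "x \<in> carrier D \<longleftrightarrow> E x (coord E 0 u)"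
  by (simp add: alg_def decode_def Let_def)

lemma one_zero: "\<one>\<^bsub>D\<^esub> = coord E 2 u" "\<zero>\<^bsub>D\<^esub> = coord E 3 u"
  by (simp_all add: alg_def decode_def Let_def)

lemma one_zero_closed: "\<one>\<^bsub>D\<^esub> \<in> carrier D" "\<zero>\<^bsub>D\<^esub> \<in> carrier D"
  using code by (simp_all add: code_def Let_def mem_carrier one_zero)

lemma mult_graph:
  assumes "x \<in> carrier D" "y \<in> carrier D"
  shows "x \<otimes>\<^bsub>D\<^esub> y \<in> carrier D" "graph2 E (coord E 1 u) x y z \<longleftrightarrow> z = x \<otimes>\<^bsub>D\<^esub> y"
  using code assms graph2_app2[of E "coord E 1 u" "coord E 0 u" "coord E 0 u" x y]
  unfolding mem_carrier by (simp_all add: code_def alg_def decode_def Let_def)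

lemma add_graph:
  assumes "x \<in> carrier D" "y \<in> carrier D"
  shows "x \<oplus>\<^bsub>D\<^esub> y \<in> carrier D" "graph2 E (coord E 4 u) x y z \<longleftrightarrow> z = x \<oplus>\<^bsub>D\<^esub> y"
  using code assms graph2_app2[of E "coord E 4 u" "coord E 0 u" "coord E 0 u" x y]
  unfolding mem_carrier by (simp_all add: code_def alg_def decode_def Let_def)

lemma smult_graph:
  assumes "x \<in> carrier D"
  shows "c \<odot>\<^bsub>D\<^esub> x \<in> carrier D" "graph2 E (coord E 5 u) (\<iota> (num U c)) x z \<longleftrightarrow> z = c \<odot>\<^bsub>D\<^esub> x"
  using code assms graph2_app2[of E "coord E 5 u" "\<iota> (nums U)" "coord E 0 u" "\<iota> (num U c)" x] num_mem
  unfolding mem_carrier by (simp_all add: code_def alg_def decode_def Let_def)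

lemma adj_graph:
  assumes "x \<in> carrier D"
  shows "adj D x \<in> carrier D" "graph1 E (coord E 6 u) x z \<longleftrightarrow> z = adj D x"
  using code assms graph1_app[of E "coord E 6 u" "coord E 0 u" "coord E 0 u" x]
  unfolding mem_carrier by (simp_all add: code_def alg_def decode_def Let_def)

lemma nrm_graph:
  assumes "x \<in> carrier D"
  shows "nrm D x P \<longleftrightarrow> (\<exists>r. E r (\<iota> (reals_with U P)) \<and> graph1 E ((psnd E ^^ 7) u) x r)"
proof -
  have "fun1 E ((psnd E ^^ 7) u) (coord E 0 u) (\<iota> (reals_with U (\<lambda>_. True)))"
    using code by (simp add: code_def Let_def)
  then have "graph1 E ((psnd E ^^ 7) u) x r \<longleftrightarrow> r = app E ((psnd E ^^ 7) u) x" for r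
    using assms unfolding mem_carrier by (rule graph1_app)
  moreover have "nrm D x P \<longleftrightarrow> E (app E ((psnd E ^^ 7) u) x) (\<iota> (reals_with U P))"
    using assms unfolding mem_carrier by (simp add: alg_def decode_def Let_def)
  ultimately show ?thesis by simp
qed

lemma tval_closed: "\<forall>i\<in>tvars t. e i \<in> carrier D \<Longrightarrow> tval D e t \<in> carrier D"
  by (induction t) (auto simp: one_zero_closed mult_graph(1) add_graph(1) smult_graph(1) adj_graph(1))

text \<open>The values of subterms are quantified over the carrier \<open>K 0\<close>. Hence the
  premise that the variables take values there, under which \<open>tval_closed\<close>
  applies.\<close>

lemma bsat_term_form:
  assumes "decodes E \<iota> u v" "\<forall>i\<in>tvars t. v (X i) \<in> carrier D" "low n y"
  shows "bsat E v (term_form U n t y) \<longleftrightarrow> v y = tval D (\<lambda>i. v (X i)) t"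
  using assms
proof (induction t arbitrary: v n y)
  case (AMult s t)
  have closed: "tval D (\<lambda>i. v (X i)) s \<in> carrier D" "tval D (\<lambda>i. v (X i)) t \<in> carrier D"
    using AMult.prems by (auto intro!: tval_closed)
  have "bsat E (v(T n := a, T (Suc n) := b)) (term_form U (Suc (Suc n)) s (T n)) \<longleftrightarrow>
      a = tval D (\<lambda>i. v (X i)) s" for a b
    using AMult.prems by (subst AMult.IH(1)) auto
  moreover have "bsat E (v(T n := a, T (Suc n) := b)) (term_form U (Suc (Suc n)) t (T (Suc n))) \<longleftrightarrow>
      b = tval D (\<lambda>i. v (X i)) t" for a b
    using AMult.prems by (subst AMult.IH(2)) auto
  ultimately show ?case
    using AMult.prems(3) closed mult_graph(2)[OF closed, of "v y"]
    by (auto simp: decodes_val(1)[OF AMult.prems(1)] bsat_graph2_form low_rules simp flip: mem_carrier)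
next
  case (AAdd s t)
  have closed: "tval D (\<lambda>i. v (X i)) s \<in> carrier D" "tval D (\<lambda>i. v (X i)) t \<in> carrier D"
    using AAdd.prems by (auto intro!: tval_closed)
  have "bsat E (v(T n := a, T (Suc n) := b)) (term_form U (Suc (Suc n)) s (T n)) \<longleftrightarrow>
      a = tval D (\<lambda>i. v (X i)) s" for a b
    using AAdd.prems by (subst AAdd.IH(1)) auto
  moreover have "bsat E (v(T n := a, T (Suc n) := b)) (term_form U (Suc (Suc n)) t (T (Suc n))) \<longleftrightarrow>
      b = tval D (\<lambda>i. v (X i)) t" for a b
    using AAdd.prems by (subst AAdd.IH(2)) auto
  ultimately show ?case
    using AAdd.prems(3) closed add_graph(2)[OF closed, of "v y"]
    by (auto simp: decodes_val(1)[OF AAdd.prems(1)] bsat_graph2_form low_rules simp flip: mem_carrier)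
next
  case (ASmult c t)
  have closed: "tval D (\<lambda>i. v (X i)) t \<in> carrier D"
    using ASmult.prems by (auto intro!: tval_closed)
  have "bsat E (v(T n := a)) (term_form U (Suc n) t (T n)) \<longleftrightarrow> a = tval D (\<lambda>i. v (X i)) t" for a
    using ASmult.prems by (subst ASmult.IH) auto
  then show ?case
    using ASmult.prems(3) closed smult_graph(2)[OF closed, of c "v y"]
    by (auto simp: decodes_val[OF ASmult.prems(1)] bsat_graph2_form low_rules simp flip: mem_carrier)
next
  case (AAdj t)
  have closed: "tval D (\<lambda>i. v (X i)) t \<in> carrier D"
    using AAdj.prems by (auto intro!: tval_closed)
  have "bsat E (v(T n := a)) (term_form U (Suc n) t (T n)) \<longleftrightarrow> a = tval D (\<lambda>i. v (X i)) t" for a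
    using AAdj.prems by (subst AAdj.IH) auto
  then show ?case
    using AAdj.prems(3) closed adj_graph(2)[OF closed, of "v y"]
    by (auto simp: decodes_val(1)[OF AAdj.prems(1)] bsat_graph1_form low_rules simp flip: mem_carrier)
qed (auto simp: decodes_val(1) one_zero)

lemma upd_X: "(\<lambda>i. (v(X j := a)) (X i)) = (\<lambda>i. v (X i))(j := a)"
  by auto

lemma bsat_form_of:
  assumes "decodes E \<iota> u v" "\<forall>i\<in>fvars \<phi>. v (X i) \<in> carrier D"
  shows "bsat E v (form_of U \<phi>) \<longleftrightarrow> holds D (\<lambda>i. v (X i)) \<phi>"
  using assms
proof (induction \<phi> arbitrary: v)
  case (AEq s t)
  have "tval D (\<lambda>i. v (X i)) s \<in> carrier D" "tval D (\<lambda>i. v (X i)) t \<in> carrier D"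
    using AEq.prems by (auto intro!: tval_closed)
  then show ?case
    using AEq.prems by (auto simp: bsat_term_form decodes_val(1)[OF AEq.prems(1)] simp flip: mem_carrier)
next
  case (ANrm P t)
  have "tval D (\<lambda>i. v (X i)) t \<in> carrier D"
    using ANrm.prems by (auto intro!: tval_closed)
  then show ?case
    using ANrm.prems
    by (auto simp: bsat_term_form decodes_val[OF ANrm.prems(1)] bsat_graph1_form nrm_graph
        simp flip: mem_carrier)
next
  case (AEx i \<phi>)
  have "bsat E (v(X i := a)) (form_of U \<phi>) \<longleftrightarrow> holds D ((\<lambda>i. v (X i))(i := a)) \<phi>"
    if "a \<in> carrier D" for a
  proof -
    have "bsat E (v(X i := a)) (form_of U \<phi>) \<longleftrightarrow> holds D (\<lambda>j. (v(X i := a)) (X j)) \<phi>"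
      by (rule AEx.IH, subst decodes_upd) (use that AEx.prems in auto)
    then show ?thesis by (simp only: upd_X)
  qed
  then show ?case
    by (auto simp: decodes_val(1)[OF AEx.prems(1)] simp flip: mem_carrier)
qed auto

end

lemma tval_cong: "\<forall>i\<in>tvars t. e i = e' i \<Longrightarrow> tval D e t = tval D e' t"
  by (induction t) auto

lemma holds_cong: "\<forall>i\<in>fvars \<phi>. e i = e' i \<Longrightarrow> holds D e \<phi> \<longleftrightarrow> holds D e' \<phi>"
proof (induction \<phi> arbitrary: e e')
  case (AEq s t)
  then show ?case using tval_cong[of s e e' D] tval_cong[of t e e' D] by auto
next
  case (ANrm P t)
  then show ?case using tval_cong[of t e e' D] by auto
next
  case (AConj \<phi> \<psi>)
  then show ?case by (metis UnI1 UnI2 fvars.simps(4) holds.simps(4))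
next
  case (AEx i \<phi>)
  have "holds D (e(i := x)) \<phi> \<longleftrightarrow> holds D (e'(i := x)) \<phi>" for x
    using AEx.prems by (intro AEx.IH) auto
  then show ?case by simp
qed auto

section \<open>Sets in the superstructure\<close>

lemma superstructureD:
  assumes "superstructure U"
  shows "inj (num U)" "range (num U) \<subseteq> individuals U"
    "\<forall>x. \<forall>a\<in>individuals U. \<not> elem U x a"
    "\<forall>s t. s \<notin> individuals U \<and> t \<notin> individuals U \<and> (\<forall>x. elem U x s \<longleftrightarrow> elem U x t) \<longrightarrow> s = t"
    "\<forall>n S. enat n < height U \<and> S \<subseteq> level U n \<longrightarrow>
      (\<exists>s. s \<notin> individuals U \<and> (\<forall>x. elem U x s \<longleftrightarrow> x \<in> S))"
    "\<forall>s. \<exists>n. enat n \<le> height U \<and> s \<in> level U n"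
  using assms[unfolded superstructure_def] by - (elim conjE; assumption)+

lemma level_elem:
  assumes "superstructure U" "elem U x y" "y \<in> level U n"
  shows "\<exists>k. n = Suc k \<and> x \<in> level U k"
  using superstructureD(3)[OF assms(1)] assms(2,3) by (cases n) auto

lemma elem_set_of:
  assumes "superstructure U" "S \<subseteq> level U n" "enat n < height U"
  shows "elem U x (set_of U S) \<longleftrightarrow> x \<in> S"
proof -
  obtain s where s: "s \<notin> individuals U" "\<forall>x. elem U x s \<longleftrightarrow> x \<in> S"
    using superstructureD(5)[OF assms(1)] assms(2,3) by blast
  have "set_of U S = s"
    unfolding set_of_def
    by (rule the_equality) (use superstructureD(4)[OF assms(1)] s in auto)
  with s show ?thesis by simp
qed

lemma num_level: "superstructure U \<Longrightarrow> num U c \<in> level U n"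
  using superstructureD(2) by (cases n) auto

text \<open>As the algebra contains its unit, the graph of scalar multiplication contains a triple
  that starts with \<open>num U 0\<close>, and this number lies five membership steps below the
  graph. For a universe of finite height this guarantees that sets of reals and of pairs of reals
  exist.\<close>

lemma codes_algebra_height:
  assumes U: "superstructure U" and "codes_algebra U u"
  shows "enat 5 \<le> height U"
proof -
  have "is_map2 (elem U) (coord (elem U) 5 u) (range (num U))
      {x. elem U x (coord (elem U) 0 u)} {x. elem U x (coord (elem U) 0 u)}"
    and "elem U (coord (elem U) 2 u) (coord (elem U) 0 u)"
    using assms(2) by (simp_all add: codes_algebra_def Let_def)
  then obtain p z where p: "elem U p (coord (elem U) 5 u)"
      "otriple (elem U) p (num U 0) (coord (elem U) 2 u) z"
    unfolding is_map2_def by blast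
  then obtain q where q: "opair (elem U) q (num U 0) (coord (elem U) 2 u)" "opair (elem U) p q z"
    by (auto simp: otriple_def)
  obtain s where s: "elem U s q" "elem U (num U 0) s"
    using opair_fst_mem[OF q(1)] by blast
  obtain t where t: "elem U t p" "elem U q t"
    using opair_fst_mem[OF q(2)] by blast
  obtain n where n: "enat n \<le> height U" "coord (elem U) 5 u \<in> level U n"
    using superstructureD(6)[OF U] by blast
  obtain n1 where "n = Suc n1" "p \<in> level U n1" using level_elem[OF U p(1) n(2)] by blast
  moreover from this obtain n2 where "n1 = Suc n2" "t \<in> level U n2"
    using level_elem[OF U t(1)] by blast
  moreover from this obtain n3 where "n2 = Suc n3" "q \<in> level U n3"
    using level_elem[OF U t(2)] by blast
  moreover from this obtain n4 where "n3 = Suc n4" "s \<in> level U n4"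
    using level_elem[OF U s(1)] by blast
  moreover from this obtain n5 where "n4 = Suc n5"
    using level_elem[OF U s(2)] by blast
  ultimately have "5 \<le> n" by simp
  then show ?thesis using n(1) by (meson enat_ord_simps(1) order_trans)
qed

text \<open>The norm of \<open>x\<close> is replaced by the principal ultrafilter that it generates.\<close>

definition filter_norm ::
    "(complex, 'a, real) star_algebra \<Rightarrow> (complex, 'a, (real \<Rightarrow> bool) \<Rightarrow> bool) star_algebra" where
  "filter_norm A = \<lparr>carrier = carrier A, mult = mult A, one = one A, zero = zero A, add = add A,
     smult = smult A, adj = adj A, nrm = (\<lambda>x P. x \<in> carrier A \<and> P (nrm A x))\<rparr>"

context
  fixes U :: "('u, 'w) universe"
  assumes U: "superstructure U" and height: "enat 5 \<le> height U"
begin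

lemma height_pos: "enat 0 < height U"
  using height by (cases "height U") auto

lemma elem_nums: "elem U x (nums U) \<longleftrightarrow> x \<in> range (num U)"
  unfolding nums_def using num_level[OF U, of _ 0] by (intro elem_set_of[OF U _ height_pos]) auto

lemma elem_reals_with: "elem U x (reals_with U P) \<longleftrightarrow> (\<exists>r. x = rnum U r \<and> P r)"
proof -
  have "elem U x (reals_with U P) \<longleftrightarrow> x \<in> {rnum U r |r. P r}"
    unfolding reals_with_def rnum_def using num_level[OF U, of _ 0]
    by (intro elem_set_of[OF U _ height_pos]) auto
  then show ?thesis by auto
qed

lemma rnum_inject: "rnum U r = rnum U s \<longleftrightarrow> r = s"
  using superstructureD(1)[OF U] by (auto simp: rnum_def inj_eq)

lemma code_if_codes_algebra:
  assumes "codes_algebra U u"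
  shows "code U (elem U) id u"
proof -
  have 1: "{x. elem U x (nums U)} = range (num U)"
    by (auto simp: elem_nums)
  have 2: "{x. elem U x (reals_with U (\<lambda>_. True))} = range (rnum U)"
    by (auto simp: elem_reals_with)
  show ?thesis
    using assms unfolding codes_algebra_def code_def Let_def
    by (auto intro!: fun2_if_is_map2 fun1_if_is_map simp: 1 2)
qed

lemma alg_standard:
  assumes "codes_algebra U u"
  shows "alg U (elem U) id u = filter_norm (standard_algebra U u)"
proof -
  let ?f = "app (elem U) ((psnd (elem U) ^^ 7) u)"
  have "elem U (?f x) (reals_with U P) \<longleftrightarrow> P (THE r. ?f x = rnum U r)"
    if "elem U x (coord (elem U) 0 u)" for x P
  proof -
    have "fun1 (elem U) ((psnd (elem U) ^^ 7) u) (coord (elem U) 0 u) (reals_with U (\<lambda>_. True))"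
      using code_if_codes_algebra[OF assms] by (simp add: code_def Let_def)
    then have "elem U (?f x) (reals_with U (\<lambda>_. True))"
      using that by (rule graph1_app(1))
    then obtain r where r: "?f x = rnum U r" by (auto simp: elem_reals_with)
    then show ?thesis by (auto simp: elem_reals_with rnum_inject)
  qed
  then show ?thesis
    by (auto simp: alg_def filter_norm_def standard_algebra_def decode_def Let_def fun_eq_iff)
qed

lemma algebra_code_standard:
  assumes "codes_algebra U u"
  shows "algebra_code U (elem U) id u"
  by unfold_locales (use code_if_codes_algebra[OF assms] in \<open>auto simp: elem_nums\<close>)

end

section \<open>The algebraic laws\<close>

text \<open>Negatives are written with the scalar -1, since the language has no symbol for them. All
  laws are equations in at most three variables; as equations they survive both the transfer and the
  passage to the quotient.\<close>

inductive law :: "aterm \<Rightarrow> aterm \<Rightarrow> bool" where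
  "law (AAdd (AAdd (AVar 0) (AVar 1)) (AVar 2)) (AAdd (AVar 0) (AAdd (AVar 1) (AVar 2)))"
| "law (AAdd (AVar 0) (AVar 1)) (AAdd (AVar 1) (AVar 0))"
| "law (AAdd AZero (AVar 0)) (AVar 0)"
| "law (AAdd (AVar 0) (ASmult (- 1) (AVar 0))) AZero"
| "law (AMult (AMult (AVar 0) (AVar 1)) (AVar 2)) (AMult (AVar 0) (AMult (AVar 1) (AVar 2)))"
| "law (AMult AOne (AVar 0)) (AVar 0)"
| "law (AMult (AVar 0) AOne) (AVar 0)"
| "law (AMult (AAdd (AVar 0) (AVar 1)) (AVar 2)) (AAdd (AMult (AVar 0) (AVar 2)) (AMult (AVar 1) (AVar 2)))"
| "law (AMult (AVar 2) (AAdd (AVar 0) (AVar 1))) (AAdd (AMult (AVar 2) (AVar 0)) (AMult (AVar 2) (AVar 1)))"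
| "law (ASmult (c + d) (AVar 0)) (AAdd (ASmult c (AVar 0)) (ASmult d (AVar 0)))"
| "law (ASmult c (AAdd (AVar 0) (AVar 1))) (AAdd (ASmult c (AVar 0)) (ASmult c (AVar 1)))"
| "law (ASmult (c * d) (AVar 0)) (ASmult c (ASmult d (AVar 0)))"
| "law (ASmult 1 (AVar 0)) (AVar 0)"
| "law (AMult (ASmult c (AVar 0)) (AVar 1)) (ASmult c (AMult (AVar 0) (AVar 1)))"
| "law (AMult (AVar 0) (ASmult c (AVar 1))) (ASmult c (AMult (AVar 0) (AVar 1)))"
| "law (AAdj (AAdj (AVar 0))) (AVar 0)"
| "law (AAdj (AAdd (AVar 0) (AVar 1))) (AAdd (AAdj (AVar 0)) (AAdj (AVar 1)))"
| "law (AAdj (ASmult c (AVar 0))) (ASmult (cnj c) (AAdj (AVar 0)))"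
| "law (AAdj (AMult (AVar 0) (AVar 1))) (AMult (AAdj (AVar 1)) (AAdj (AVar 0)))"

lemma complex_ring_simps [simp]:
  "carrier complex_ring = UNIV" "x \<otimes>\<^bsub>complex_ring\<^esub> y = x * y" "\<one>\<^bsub>complex_ring\<^esub> = 1"
  "\<zero>\<^bsub>complex_ring\<^esub> = 0" "x \<oplus>\<^bsub>complex_ring\<^esub> y = x + y"
  by (simp_all add: complex_ring_def)

lemma cring_complex_ring: "cring complex_ring"
proof (rule cringI)
  show "abelian_group complex_ring"
    by (rule abelian_groupI) (auto intro: exI[of _ "- x" for x])
  show "Group.comm_monoid complex_ring"
    by (rule comm_monoidI) auto
qed (simp add: distrib_right)

text \<open>The norm is left out, so that one locale covers the standard algebras, the internal
  algebra and the hull, whose norms take values in different types.\<close>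

locale star_alg =
  fixes A :: "(complex, 'a, 'r) star_algebra" (structure)
  assumes closed_one: "\<one> \<in> carrier A"
    and closed_zero: "\<zero> \<in> carrier A"
    and closed_mult: "\<lbrakk>x \<in> carrier A; y \<in> carrier A\<rbrakk> \<Longrightarrow> x \<otimes> y \<in> carrier A"
    and closed_add: "\<lbrakk>x \<in> carrier A; y \<in> carrier A\<rbrakk> \<Longrightarrow> x \<oplus> y \<in> carrier A"
    and closed_smult: "x \<in> carrier A \<Longrightarrow> c \<odot> x \<in> carrier A"
    and closed_adj: "x \<in> carrier A \<Longrightarrow> adj A x \<in> carrier A"
    and laws: "\<lbrakk>law s t; range e \<subseteq> carrier A\<rbrakk> \<Longrightarrow> tval A e s = tval A e t"
begin

lemma law3:
  assumes "law s t" "x \<in> carrier A" "y \<in> carrier A" "z \<in> carrier A"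
  shows "tval A (\<lambda>i. if i = 0 then x else if i = 1 then y else z) s =
    tval A (\<lambda>i. if i = 0 then x else if i = 1 then y else z) t"
  by (rule laws) (use assms in auto)

lemma abelian_group_A: "abelian_group A"
proof (rule abelian_groupI)
  fix x assume "x \<in> carrier A"
  then show "\<exists>y\<in>carrier A. y \<oplus> x = \<zero>"
    using law3[OF law.intros(4), of x x x] law3[OF law.intros(2), of x "(- 1) \<odot> x" x] closed_smult[of x "- 1"]
    by (intro bexI[of _ "(- 1) \<odot> x"]) auto
next
  fix x y z assume "x \<in> carrier A" "y \<in> carrier A" "z \<in> carrier A"
  then show "x \<oplus> y \<oplus> z = x \<oplus> (y \<oplus> z)"
    using law3[OF law.intros(1), of x y z] by simp
next
  fix x y assume "x \<in> carrier A" "y \<in> carrier A"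
  then show "x \<oplus> y = y \<oplus> x"
    using law3[OF law.intros(2), of x y y] by simp
next
  fix x assume "x \<in> carrier A"
  then show "\<zero> \<oplus> x = x"
    using law3[OF law.intros(3), of x x x] by simp
qed (simp_all add: closed_add closed_zero)

lemma monoid_A: "Group.monoid A"
proof (rule monoidI)
  fix x y z assume "x \<in> carrier A" "y \<in> carrier A" "z \<in> carrier A"
  then show "x \<otimes> y \<otimes> z = x \<otimes> (y \<otimes> z)"
    using law3[OF law.intros(5), of x y z] by simp
next
  fix x assume "x \<in> carrier A"
  then show "\<one> \<otimes> x = x" "x \<otimes> \<one> = x"
    using law3[OF law.intros(6), of x x x] law3[OF law.intros(7), of x x x] by simp_all
qed (simp_all add: closed_mult closed_one)

lemma ring_A: "ring A"
proof (rule ringI[OF abelian_group_A monoid_A])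
  fix x y z assume "x \<in> carrier A" "y \<in> carrier A" "z \<in> carrier A"
  then show "(x \<oplus> y) \<otimes> z = x \<otimes> z \<oplus> y \<otimes> z" "z \<otimes> (x \<oplus> y) = z \<otimes> x \<oplus> z \<otimes> y"
    using law3[OF law.intros(8), of x y z] law3[OF law.intros(9), of x y z] by simp_all
qed

lemma module_A: "module complex_ring A"
proof (rule moduleI[OF cring_complex_ring abelian_group_A])
  fix c d x assume "x \<in> carrier A"
  then show "(c \<oplus>\<^bsub>complex_ring\<^esub> d) \<odot> x = c \<odot> x \<oplus> d \<odot> x"
    "(c \<otimes>\<^bsub>complex_ring\<^esub> d) \<odot> x = c \<odot> (d \<odot> x)" "\<one>\<^bsub>complex_ring\<^esub> \<odot> x = x"
    using law3[OF law.intros(10), of x x x c d] law3[OF law.intros(12), of x x x c d]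
      law3[OF law.intros(13), of x x x] by simp_all
next
  fix c x y assume "x \<in> carrier A" "y \<in> carrier A"
  then show "c \<odot> (x \<oplus> y) = c \<odot> x \<oplus> c \<odot> y"
    using law3[OF law.intros(11), of x y y c] by simp
qed (simp add: closed_smult)

sublocale ring A by (rule ring_A)

sublocale M: module complex_ring A by (rule module_A)

lemma smult_mult:
  assumes "x \<in> carrier A" "y \<in> carrier A"
  shows "(c \<odot> x) \<otimes> y = c \<odot> (x \<otimes> y)" "x \<otimes> (c \<odot> y) = c \<odot> (x \<otimes> y)"
  using assms law3[OF law.intros(14), of x y y c] law3[OF law.intros(15), of x y y c] by simp_all

lemma adj_laws:
  assumes "x \<in> carrier A" "y \<in> carrier A"
  shows "adj A (adj A x) = x" "adj A (x \<oplus> y) = adj A x \<oplus> adj A y"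
    "adj A (c \<odot> x) = cnj c \<odot> adj A x" "adj A (x \<otimes> y) = adj A y \<otimes> adj A x"
  using assms law3[OF law.intros(16), of x y y] law3[OF law.intros(17), of x y y]
    law3[OF law.intros(18), of x y y c] law3[OF law.intros(19), of x y y] by simp_all

text \<open>\<open>\<ominus>\<close> rests on an inverse picked by description; the right-hand side
  is a term of the language.\<close>

lemma minus_smult:
  assumes "x \<in> carrier A" "y \<in> carrier A"
  shows "x \<ominus> y = x \<oplus> (- 1) \<odot> y"
proof -
  have "(- 1) \<odot> y = \<ominus> y"
    using law3[OF law.intros(4), of y y y] assms closed_smult[of y "- 1"] a_comm[of y "(- 1) \<odot> y"]
    by (intro minus_equality[symmetric]) auto
  then show ?thesis by (simp add: a_minus_def)
qed

lemma adj_zero [simp]: "adj A \<zero> = \<zero>"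
  using adj_laws(3)[of \<zero> \<zero> 0] M.smult_l_null[of "adj A \<zero>"] M.smult_l_null[of \<zero>] closed_adj closed_zero
  by simp

end

lemma star_algI:
  fixes A (structure)
  assumes "ring A" "module complex_ring A"
    and "\<And>c x y. \<lbrakk>x \<in> carrier A; y \<in> carrier A\<rbrakk> \<Longrightarrow> (c \<odot> x) \<otimes> y = c \<odot> (x \<otimes> y)"
    and "\<And>c x y. \<lbrakk>x \<in> carrier A; y \<in> carrier A\<rbrakk> \<Longrightarrow> x \<otimes> (c \<odot> y) = c \<odot> (x \<otimes> y)"
    and "\<And>x. x \<in> carrier A \<Longrightarrow> adj A x \<in> carrier A"
    and "\<And>x. x \<in> carrier A \<Longrightarrow> adj A (adj A x) = x"
    and "\<And>x y. \<lbrakk>x \<in> carrier A; y \<in> carrier A\<rbrakk> \<Longrightarrow> adj A (x \<oplus> y) = adj A x \<oplus> adj A y"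
    and "\<And>c x. x \<in> carrier A \<Longrightarrow> adj A (c \<odot> x) = cnj c \<odot> adj A x"
    and "\<And>x y. \<lbrakk>x \<in> carrier A; y \<in> carrier A\<rbrakk> \<Longrightarrow> adj A (x \<otimes> y) = adj A y \<otimes> adj A x"
  shows "star_alg A"
proof -
  interpret ring A by fact
  interpret M: module complex_ring A by fact
  have smult_closed: "c \<odot> x \<in> carrier A" if "x \<in> carrier A" for c x
    using that M.smult_closed[of c x] by simp
  have smult: "(c + d) \<odot> x = c \<odot> x \<oplus> d \<odot> x" "(c * d) \<odot> x = c \<odot> (d \<odot> x)" "1 \<odot> x = x"
      "0 \<odot> x = \<zero>" if "x \<in> carrier A" for c d x
    using that M.smult_l_distr[of c d x] M.smult_assoc1[of c d x] M.smult_one[of x] M.smult_l_null[of x]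
    by simp_all
  have smult_add: "c \<odot> (x \<oplus> y) = c \<odot> x \<oplus> c \<odot> y" if "x \<in> carrier A" "y \<in> carrier A" for c x y
    using that M.smult_r_distr[of c x y] by simp
  have neg: "x \<oplus> (- 1) \<odot> x = \<zero>" if "x \<in> carrier A" for x
    using smult(1)[OF that, of 1 "- 1"] smult(3,4)[OF that] by simp
  show ?thesis
  proof
    fix s t and e :: "nat \<Rightarrow> 'a"
    assume st: "law s t" and "range e \<subseteq> carrier A"
    then have "e i \<in> carrier A" for i by auto
    with st show "tval A e s = tval A e t"
      by cases (simp_all add: assms smult_closed smult smult_add neg a_ac m_assoc l_distr r_distr)
  qed (simp_all add: assms smult_closed)
qed

context C_star_algebra
begin

sublocale star_alg A
  by (rule star_algI) (fact ring module smult_mult_left smult_mult_right adj_closed adj_adj adj_add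
    adj_smult adj_mult)+

end

section \<open>Approximation with prescribed coefficients\<close>

text \<open>\<open>orth A [c\<^sub>1, \<dots>, c\<^sub>k] q y\<close>: there are orthogonal projections with sum \<open>q\<close> whose
  combination with coefficients \<open>c\<^sub>i\<close> is \<open>y\<close>.\<close>

primrec orth :: "(complex, 'a, 'r) star_algebra \<Rightarrow> complex list \<Rightarrow> 'a \<Rightarrow> 'a \<Rightarrow> bool" where
  "orth A [] q y \<longleftrightarrow> q = \<zero>\<^bsub>A\<^esub> \<and> y = \<zero>\<^bsub>A\<^esub>"
| "orth A (c # cs) q y \<longleftrightarrow> (\<exists>q'\<in>carrier A. \<exists>y'\<in>carrier A. \<exists>p\<in>carrier A.
     orth A cs q' y' \<and> p \<otimes>\<^bsub>A\<^esub> p = p \<and> adj A p = p \<and> p \<otimes>\<^bsub>A\<^esub> q' = \<zero>\<^bsub>A\<^esub> \<and> q' \<otimes>\<^bsub>A\<^esub> p = \<zero>\<^bsub>A\<^esub> \<and>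
     q = q' \<oplus>\<^bsub>A\<^esub> p \<and> y = y' \<oplus>\<^bsub>A\<^esub> c \<odot>\<^bsub>A\<^esub> p)"

context C_star_algebra
begin

text \<open>\<open>orth\<close> asks a new projection \<open>r\<close> only to be orthogonal to the
  sum \<open>q'\<close> of the others. As \<open>q'\<close> acts as a unit on each of them,
  \<open>r \<otimes> p i = (r \<otimes> q') \<otimes> p i = \<zero>\<close>; therefore the unit
  property is carried along in the induction.\<close>

lemma orth_imp_combination:
  assumes "orth A cs q y" "q \<in> carrier A"
  shows "\<exists>\<alpha> p. (\<forall>i<length cs. p i \<in> projections A \<and> q \<otimes> p i = p i \<and> p i \<otimes> q = p i) \<and>
    (\<forall>i<length cs. \<forall>j<length cs. i \<noteq> j \<longrightarrow> p i \<otimes> p j = \<zero>) \<and>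
    y = (\<Oplus>i\<in>{..<length cs}. \<alpha> i \<odot> p i)"
  using assms
proof (induction cs arbitrary: q y)
  case Nil
  then show ?case by simp
next
  case (Cons c cs)
  then obtain q' y' r where r: "q' \<in> carrier A" "y' \<in> carrier A" "r \<in> carrier A" "orth A cs q' y'"
      "r \<otimes> r = r" "adj A r = r" "r \<otimes> q' = \<zero>" "q' \<otimes> r = \<zero>"
    and qy: "q = q' \<oplus> r" "y = y' \<oplus> c \<odot> r"
    by auto
  obtain \<alpha> p where p: "\<forall>i<length cs. p i \<in> projections A \<and> q' \<otimes> p i = p i \<and> p i \<otimes> q' = p i"
      "\<forall>i<length cs. \<forall>j<length cs. i \<noteq> j \<longrightarrow> p i \<otimes> p j = \<zero>"
      "y' = (\<Oplus>i\<in>{..<length cs}. \<alpha> i \<odot> p i)"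
    using Cons.IH[OF r(4,1)] by auto
  define p' where "p' = p(length cs := r)"
  define \<alpha>' where "\<alpha>' = \<alpha>(length cs := c)"
  have pc: "p i \<in> carrier A" if "i < length cs" for i
    using p(1) that by (auto simp: projections_def)
  have rp: "r \<otimes> p i = \<zero>" "p i \<otimes> r = \<zero>" if "i < length cs" for i
  proof -
    have "q' \<otimes> p i = p i" "p i \<otimes> q' = p i" using p(1) that by simp_all
    then have "r \<otimes> p i = (r \<otimes> q') \<otimes> p i" "p i \<otimes> r = p i \<otimes> (q' \<otimes> r)"
      using m_assoc[OF r(3,1) pc[OF that]] m_assoc[OF pc[OF that] r(1,3)] by simp_all
    then show "r \<otimes> p i = \<zero>" "p i \<otimes> r = \<zero>" using r(7,8) pc[OF that] by simp_all
  qed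
  have "\<forall>i<Suc (length cs). p' i \<in> projections A \<and> q \<otimes> p' i = p' i \<and> p' i \<otimes> q = p' i"
    using r p(1) rp pc by (auto simp: p'_def qy less_Suc_eq projections_def l_distr r_distr)
  moreover have "\<forall>i<Suc (length cs). \<forall>j<Suc (length cs). i \<noteq> j \<longrightarrow> p' i \<otimes> p' j = \<zero>"
    using p(2) rp by (auto simp: p'_def less_Suc_eq)
  moreover have "y = (\<Oplus>i\<in>{..<Suc (length cs)}. \<alpha>' i \<odot> p' i)"
  proof -
    have "(\<Oplus>i\<in>{..<Suc (length cs)}. \<alpha>' i \<odot> p' i) = c \<odot> r \<oplus> (\<Oplus>i\<in>{..<length cs}. \<alpha>' i \<odot> p' i)"
      unfolding lessThan_Suc
      using r(3) pc by (subst finsum_insert) (auto simp: p'_def \<alpha>'_def closed_smult)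
    also have "(\<Oplus>i\<in>{..<length cs}. \<alpha>' i \<odot> p' i) = y'"
      unfolding p(3) using pc by (intro finsum_cong') (auto simp: p'_def \<alpha>'_def closed_smult)
    finally show ?thesis
      using r by (simp add: qy a_comm closed_smult)
  qed
  ultimately show ?case by (intro exI[of _ \<alpha>'] exI[of _ p']) simp
qed

lemma orth_imp_orthogonal_combinations:
  assumes "orth A cs q y" "q \<in> carrier A"
  shows "y \<in> orthogonal_combinations A"
proof -
  let ?n = "length cs"
  obtain \<alpha> p where p: "\<forall>i<?n. p i \<in> projections A"
      "\<forall>i<?n. \<forall>j<?n. i \<noteq> j \<longrightarrow> p i \<otimes> p j = \<zero>" "y = (\<Oplus>i\<in>{..<?n}. \<alpha> i \<odot> p i)"
    using orth_imp_combination[OF assms] by auto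
  \<comment> \<open>The definition sums over \<open>{0..N}\<close>, which is never empty. A zero
    projection at index \<open>?n\<close> pads the sum and settles the empty list.\<close>
  define p' where "p' = p(?n := \<zero>)"
  have pc: "p i \<in> carrier A" if "i < ?n" for i
    using p(1) that by (auto simp: projections_def)
  have "{0..?n} = insert ?n {..<?n}" by auto
  then have "(\<Oplus>i\<in>{0..?n}. \<alpha> i \<odot> p' i) = \<alpha> ?n \<odot> \<zero> \<oplus> (\<Oplus>i\<in>{..<?n}. \<alpha> i \<odot> p' i)"
    using pc by (simp add: p'_def closed_smult Pi_def)
  also have "\<alpha> ?n \<odot> \<zero> = \<zero>" using M.smult_r_null by simp
  also have "(\<Oplus>i\<in>{..<?n}. \<alpha> i \<odot> p' i) = y"
    unfolding p(3) using pc by (intro finsum_cong') (auto simp: p'_def closed_smult)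
  finally have "y = (\<Oplus>i\<in>{0..?n}. \<alpha> i \<odot> p' i)"
    using pc by (simp add: p(3) closed_smult Pi_def)
  moreover have "\<forall>i\<le>?n. p' i \<in> projections A"
    using p(1) by (auto simp: p'_def projections_def)
  moreover have "\<forall>i\<le>?n. \<forall>j\<le>?n. i \<noteq> j \<longrightarrow> p' i \<otimes> p' j = \<zero>"
    using p(2) pc by (auto simp: p'_def)
  ultimately show ?thesis
    unfolding orthogonal_combinations_def by blast
qed

text \<open>For a projection the C*-identity reads \<open>t = t\<^sup>2\<close> with
  \<open>t = nrm A p\<close>.\<close>

lemma nrm_projection: "p \<in> projections A \<Longrightarrow> nrm A p = 0 \<or> nrm A p = 1"
  using C_star_identity[of p] by (auto simp: projections_def power2_eq_square)

text \<open>||x||^2 = ||x* x|| \<le> ||x*|| ||x||. Cancel ||x||, then apply the result to x* as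
  well.\<close>

lemma nrm_adj: "x \<in> carrier A \<Longrightarrow> nrm A (adj A x) = nrm A x"
proof -
  have le: "nrm A x \<le> nrm A (adj A x)" if "x \<in> carrier A" for x
  proof (cases "nrm A x = 0")
    case False
    have "nrm A x * nrm A x \<le> nrm A (adj A x) * nrm A x"
      using C_star_identity[OF that] nrm_mult[OF adj_closed[OF that] that] by (simp add: power2_eq_square)
    then show ?thesis using False nrm_nonneg[OF that] by simp
  qed (use nrm_nonneg adj_closed that in simp)
  assume "x \<in> carrier A"
  then show ?thesis using le[of x] le[of "adj A x"] adj_closed adj_adj by fastforce
qed


section \<open>Linear combinations of finitely many orthogonal projections\<close>

context
  fixes I :: "'i set" and p :: "'i \<Rightarrow> 'a"
  assumes fin: "finite I" and projs: "\<forall>i\<in>I. p i \<in> projections A"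
    and orths: "\<forall>i\<in>I. \<forall>j\<in>I. i \<noteq> j \<longrightarrow> p i \<otimes> p j = \<zero>"
begin

lemma proj: "i \<in> I \<Longrightarrow> p i \<in> projections A"
  using projs by blast

lemma orthogonal: "i \<in> I \<Longrightarrow> j \<in> I \<Longrightarrow> i \<noteq> j \<Longrightarrow> p i \<otimes> p j = \<zero>"
  using orths by blast

text \<open>The lemmas below make \<open>comb\<close> a star-homomorphism from the functions on
  \<open>I\<close> with pointwise operations. Identities between combinations thus reduce to
  identities between coefficients, and indicator functions give the sums of subfamilies of
  projections.\<close>

abbreviation comb :: "('i \<Rightarrow> complex) \<Rightarrow> 'a" where
  "comb \<gamma> \<equiv> \<Oplus>i\<in>I. \<gamma> i \<odot> p i"

lemma p_closed: "i \<in> I \<Longrightarrow> p i \<in> carrier A"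
  using proj by (auto simp: projections_def)

lemma comb_closed: "comb \<gamma> \<in> carrier A"
  using p_closed closed_smult by (intro finsum_closed) auto

lemma comb_cong: "(\<And>i. i \<in> I \<Longrightarrow> \<gamma> i = \<delta> i) \<Longrightarrow> comb \<gamma> = comb \<delta>"
  using p_closed closed_smult by (intro finsum_cong') auto

lemma comb_add: "comb \<gamma> \<oplus> comb \<delta> = comb (\<lambda>i. \<gamma> i + \<delta> i)"
proof -
  have "comb (\<lambda>i. \<gamma> i + \<delta> i) = (\<Oplus>i\<in>I. \<gamma> i \<odot> p i \<oplus> \<delta> i \<odot> p i)"
    using p_closed closed_smult M.smult_l_distr by (intro finsum_cong') auto
  also have "\<dots> = comb \<gamma> \<oplus> comb \<delta>"
    using p_closed closed_smult by (intro finsum_addf) auto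
  finally show ?thesis by simp
qed

lemma comb_smult: "c \<odot> comb \<gamma> = comb (\<lambda>i. c * \<gamma> i)"
proof -
  have "c \<odot> comb \<gamma> = (\<Oplus>i\<in>I. c \<odot> (\<gamma> i \<odot> p i))"
    using p_closed closed_smult fin by (intro M.finsum_smult_ldistr) auto
  also have "\<dots> = comb (\<lambda>i. c * \<gamma> i)"
    using p_closed closed_smult M.smult_assoc1 by (intro finsum_cong') auto
  finally show ?thesis .
qed

lemma comb_zero: "comb (\<lambda>_. 0) = \<zero>"
  using p_closed M.smult_l_null by (intro add.finprod_one_eqI) auto

lemma comb_mult_p:
  assumes "j \<in> I"
  shows "comb \<gamma> \<otimes> p j = \<gamma> j \<odot> p j"
proof -
  have "comb \<gamma> \<otimes> p j = (\<Oplus>i\<in>I. (\<gamma> i \<odot> p i) \<otimes> p j)"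
    using p_closed closed_smult fin assms by (intro finsum_ldistr) auto
  also have "\<dots> = (\<Oplus>i\<in>I. if j = i then \<gamma> i \<odot> p i else \<zero>)"
  proof (rule finsum_cong')
    show "(\<gamma> i \<odot> p i) \<otimes> p j = (if j = i then \<gamma> i \<odot> p i else \<zero>)" if "i \<in> I" for i
      using that assms p_closed proj orthogonal[of i j] smult_mult(1)[of "p i" "p j" "\<gamma> i"] M.smult_r_null[of "\<gamma> i"]
      by (auto simp: projections_def)
  qed (use p_closed closed_smult in auto)
  also have "\<dots> = \<gamma> j \<odot> p j"
    using p_closed closed_smult fin assms by (intro add.finprod_singleton) auto
  finally show ?thesis .
qed

lemma comb_mult: "comb \<gamma> \<otimes> comb \<delta> = comb (\<lambda>i. \<gamma> i * \<delta> i)"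
proof -
  have "comb \<gamma> \<otimes> comb \<delta> = (\<Oplus>j\<in>I. comb \<gamma> \<otimes> (\<delta> j \<odot> p j))"
    using p_closed closed_smult fin comb_closed by (intro finsum_rdistr) auto
  also have "\<dots> = (\<Oplus>j\<in>I. (\<gamma> j * \<delta> j) \<odot> p j)"
  proof (rule finsum_cong')
    show "comb \<gamma> \<otimes> (\<delta> j \<odot> p j) = (\<gamma> j * \<delta> j) \<odot> p j" if "j \<in> I" for j
      using that p_closed[OF that] smult_mult(2)[OF comb_closed, of "p j" \<gamma> "\<delta> j"]
        M.smult_assoc1[of "\<delta> j" "\<gamma> j" "p j"]
      by (simp add: comb_mult_p mult.commute)
  qed (use p_closed closed_smult in auto)
  finally show ?thesis .
qed

lemma adj_comb: "adj A (comb \<gamma>) = comb (\<lambda>i. cnj (\<gamma> i))"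
proof -
  have "adj A (\<Oplus>i\<in>J. \<gamma> i \<odot> p i) = (\<Oplus>i\<in>J. cnj (\<gamma> i) \<odot> p i)" if "J \<subseteq> I" for J
    using finite_subset[OF that fin] that
  proof (induction J)
    case (insert i J)
    then have "i \<in> I" "\<gamma> j \<odot> p j \<in> carrier A" if "j \<in> insert i J" for j
      using p_closed closed_smult that by auto
    moreover from this have "adj A (p i) = p i" "p i \<in> carrier A"
      using proj by (auto simp: projections_def)
    ultimately show ?case
      using insert p_closed closed_smult
      by (subst (1 2) finsum_insert) (auto simp: adj_add adj_smult Pi_def subset_iff intro!: finsum_closed)
  qed simp
  then show ?thesis by blast
qed

text \<open>Each use of the C*-identity passes from y to y* y, which replaces the coefficients by
  their squared moduli and \<open>b\<close> by its square, while the factor \<open>card I\<close>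
  stays the same. The case \<open>k = 0\<close> is the triangle inequality.\<close>

lemma nrm_comb_power: "(\<And>i. i \<in> I \<Longrightarrow> cmod (\<gamma> i) \<le> b) \<Longrightarrow> nrm A (comb \<gamma>) ^ 2 ^ k \<le> real (card I) * b ^ 2 ^ k"
proof (induction k arbitrary: \<gamma> b)
  case 0
  have "nrm A (\<Oplus>i\<in>J. \<gamma> i \<odot> p i) \<le> real (card J) * b" if "J \<subseteq> I" for J
    using finite_subset[OF that fin] that
  proof (induction J)
    case empty
    then show ?case using nrm_eq_0[of \<zero>] by simp
  next
    case (insert i J)
    then have i: "i \<in> I" and J: "J \<subseteq> I" by auto
    have "nrm A (\<gamma> i \<odot> p i) \<le> b * 1"
      using 0[OF i] nrm_projection[OF proj[OF i]] nrm_smult[OF p_closed[OF i]] order_trans[OF norm_ge_zero 0[OF i]]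
      by auto
    moreover have "(\<Oplus>j\<in>insert i J. \<gamma> j \<odot> p j) = \<gamma> i \<odot> p i \<oplus> (\<Oplus>j\<in>J. \<gamma> j \<odot> p j)"
      using insert i J p_closed closed_smult by (intro finsum_insert) auto
    moreover have "(\<Oplus>j\<in>J. \<gamma> j \<odot> p j) \<in> carrier A"
      using J p_closed closed_smult by (intro finsum_closed) auto
    ultimately show ?case
      using insert.IH[OF J] nrm_add[of "\<gamma> i \<odot> p i" "\<Oplus>j\<in>J. \<gamma> j \<odot> p j"] insert.hyps
        closed_smult[OF p_closed[OF i]]
      by (simp add: distrib_right)
  qed
  from this[OF order_refl] show ?case by simp
next
  case (Suc k)
  have "nrm A (comb \<gamma>) ^ 2 = nrm A (comb (\<lambda>i. cnj (\<gamma> i) * \<gamma> i))"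
    using C_star_identity[OF comb_closed] by (simp add: adj_comb comb_mult)
  then have "nrm A (comb \<gamma>) ^ 2 ^ Suc k = nrm A (comb (\<lambda>i. cnj (\<gamma> i) * \<gamma> i)) ^ 2 ^ k"
    by (simp add: power_mult)
  also have "\<dots> \<le> real (card I) * (b ^ 2) ^ 2 ^ k"
    using Suc.prems by (intro Suc.IH) (auto simp: norm_mult power2_eq_square intro!: mult_mono intro: order_trans[OF norm_ge_zero])
  finally show ?case by (simp add: power_mult)
qed

text \<open>The power trick turns the trivial bound \<open>card I * b\<close> into \<open>b\<close>.\<close>

lemma nrm_comb_le:
  assumes "\<And>i. i \<in> I \<Longrightarrow> cmod (\<gamma> i) \<le> b" "0 < b"
  shows "nrm A (comb \<gamma>) \<le> b"
proof (rule ccontr)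
  assume "\<not> ?thesis"
  then have "1 < nrm A (comb \<gamma>) / b" using assms(2) by simp
  then obtain n where n: "real (card I) < (nrm A (comb \<gamma>) / b) ^ n"
    using real_arch_pow by blast
  also have "\<dots> \<le> (nrm A (comb \<gamma>) / b) ^ 2 ^ n"
    using \<open>1 < nrm A (comb \<gamma>) / b\<close> by (intro power_increasing) (auto intro: less_imp_le)
  finally show False
    using nrm_comb_power[where \<gamma> = \<gamma> and b = b and k = n, OF assms(1)] assms(2) by (simp add: power_divide field_simps)
qed

text \<open>Multiplication by \<open>p i\<close> isolates \<open>\<gamma> i \<odot> p i\<close>, and
  a nonzero projection has norm 1. The coefficient of a zero projection is unconstrained, hence the
  premise.\<close>

lemma coefficient_le: "i \<in> I \<Longrightarrow> p i \<noteq> \<zero> \<Longrightarrow> cmod (\<gamma> i) \<le> nrm A (comb \<gamma>)"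
  using nrm_mult[OF comb_closed p_closed[of i], of \<gamma>] nrm_projection[OF proj[of i]] nrm_eq_0[OF p_closed[of i]]
    nrm_smult[OF p_closed[of i], of "\<gamma> i"]
  by (auto simp: comb_mult_p)

text \<open>The projections whose coefficient is the head \<open>c\<close> are merged into the
  single projection \<open>?r\<close>, and the remaining indices \<open>J'\<close> are left to the
  tail; this is why the statement is about a set \<open>J\<close> of indices. A value repeated in
  \<open>cs\<close> merely contributes a zero projection.\<close>

lemma orth_comb:
  assumes "\<gamma> ` J \<subseteq> set cs"
  shows "orth A cs (comb (\<lambda>i. if i \<in> J then 1 else 0)) (comb (\<lambda>i. if i \<in> J then \<gamma> i else 0))"
  using assms
proof (induction cs arbitrary: J)
  case Nil
  then show ?case by (simp add: comb_zero)
next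
  case (Cons c cs)
  define J' where "J' = {i\<in>J. \<gamma> i \<noteq> c}"
  let ?r = "comb (\<lambda>i. if i \<in> J - J' then 1 else 0)"
  have "orth A cs (comb (\<lambda>i. if i \<in> J' then 1 else 0)) (comb (\<lambda>i. if i \<in> J' then \<gamma> i else 0))"
    using Cons.prems by (intro Cons.IH) (auto simp: J'_def)
  moreover have "?r \<otimes> ?r = ?r" "adj A ?r = ?r"
    unfolding comb_mult adj_comb by (auto intro!: comb_cong)
  moreover have "?r \<otimes> comb (\<lambda>i. if i \<in> J' then 1 else 0) = \<zero>"
      "comb (\<lambda>i. if i \<in> J' then 1 else 0) \<otimes> ?r = \<zero>"
    unfolding comb_mult comb_zero[symmetric] by (auto intro!: comb_cong)
  moreover have "comb (\<lambda>i. if i \<in> J then 1 else 0) = comb (\<lambda>i. if i \<in> J' then 1 else 0) \<oplus> ?r"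
      "comb (\<lambda>i. if i \<in> J then \<gamma> i else 0) = comb (\<lambda>i. if i \<in> J' then \<gamma> i else 0) \<oplus> c \<odot> ?r"
    unfolding comb_smult comb_add by (auto intro!: comb_cong simp: J'_def)
  ultimately show ?case
    unfolding orth.simps
    by (intro bexI[of _ "comb (\<lambda>i. if i \<in> J' then 1 else 0)"]
        bexI[of _ "comb (\<lambda>i. if i \<in> J' then \<gamma> i else 0)"] bexI[of _ ?r] conjI comb_closed)
qed

end

end

section \<open>Rounding coefficients to a finite grid\<close>

lemma complex_grid:
  assumes "0 < \<delta>"
  shows "\<exists>cs. \<forall>z. cmod z \<le> R \<longrightarrow> (\<exists>c\<in>set cs. cmod (z - c) < \<delta>)"
proof -
  \<comment> \<open>The mesh 1/n is below \<delta>/2, so rounding down either coordinate costs less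
    than \<delta>/2.\<close>
  obtain n :: nat where n: "2 / \<delta> < real n" using reals_Archimedean2 by blast
  have n0: "0 < real n" using n assms by (meson divide_pos_pos less_trans zero_less_numeral)
  define m where "m = \<lceil>\<bar>R\<bar> * real n\<rceil> + 1"
  define G where "G = (\<lambda>(a, b). Complex (real_of_int a / n) (real_of_int b / n)) ` ({- m..m} \<times> {- m..m})"
  obtain cs where cs: "set cs = G"
    using finite_list[of G] by (auto simp: G_def)
  have *: "\<exists>a\<in>{- m..m}. \<bar>x - real_of_int a / n\<bar> < \<delta> / 2" if "\<bar>x\<bar> \<le> \<bar>R\<bar>" for x
  proof (intro bexI[of _ "\<lfloor>x * n\<rfloor>"])
    have "\<bar>x * n\<bar> \<le> \<bar>R\<bar> * n" using that by (simp add: abs_mult mult_right_mono)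
    then show "\<lfloor>x * n\<rfloor> \<in> {- m..m}" unfolding m_def by simp linarith
    have "\<bar>x * n - \<lfloor>x * n\<rfloor>\<bar> \<le> 1" by linarith
    moreover have "1 < \<delta> / 2 * n" using n assms by (simp add: field_simps)
    ultimately have "\<bar>x * n - \<lfloor>x * n\<rfloor>\<bar> < \<delta> / 2 * n" by simp
    moreover have "x - real_of_int \<lfloor>x * n\<rfloor> / n = (x * n - \<lfloor>x * n\<rfloor>) / n"
      using n0 by (simp add: field_simps)
    ultimately show "\<bar>x - real_of_int \<lfloor>x * n\<rfloor> / n\<bar> < \<delta> / 2"
      using n0 by (simp add: pos_divide_less_eq)
  qed
  have "\<exists>c\<in>set cs. cmod (z - c) < \<delta>" if "cmod z \<le> R" for z
  proof -
    have "\<bar>Re z\<bar> \<le> \<bar>R\<bar>" "\<bar>Im z\<bar> \<le> \<bar>R\<bar>"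
      using that abs_Re_le_cmod[of z] abs_Im_le_cmod[of z] by linarith+
    with * obtain a b where ab: "a \<in> {- m..m}" "b \<in> {- m..m}" "\<bar>Re z - real_of_int a / n\<bar> < \<delta> / 2"
        "\<bar>Im z - real_of_int b / n\<bar> < \<delta> / 2"
      by meson
    have "cmod (z - Complex (real_of_int a / n) (real_of_int b / n)) < \<delta>"
      using cmod_le[of "z - Complex (real_of_int a / n) (real_of_int b / n)"] ab by simp
    moreover have "Complex (real_of_int a / n) (real_of_int b / n) \<in> set cs"
      unfolding cs G_def using ab by (intro image_eqI[of _ _ "(a, b)"]) auto
    ultimately show ?thesis by blast
  qed
  then show ?thesis by blast
qed

text \<open>The order of the quantifiers makes the approximation property transferable with a standard
  number of summands.\<close>

lemma P_star_algebra_uniform: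
  assumes "0 < \<delta>"
  shows "\<exists>cs. \<forall>A :: (complex, 'a, real) star_algebra. P_star_algebra A \<longrightarrow>
    (\<forall>x\<in>carrier A. adj A x = x \<longrightarrow> nrm A x < R \<longrightarrow>
      (\<exists>q\<in>carrier A. \<exists>y\<in>carrier A. orth A cs q y \<and> nrm A (x \<oplus>\<^bsub>A\<^esub> (- 1) \<odot>\<^bsub>A\<^esub> y) < \<delta>))"
proof -
  \<comment> \<open>The radius \<open>R + 1\<close> covers the coefficients of a combination at
    distance less than 1 from an element of norm below \<open>R\<close>. Half of \<delta> is spent
    on that combination, the other half on rounding.\<close>
  obtain cs where cs: "\<forall>z. cmod z \<le> R + 1 \<longrightarrow> (\<exists>c\<in>set cs. cmod (z - c) < \<delta> / 2)"
    using complex_grid[of "\<delta> / 2" "R + 1"] assms by auto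
  have "\<exists>q\<in>carrier A. \<exists>y\<in>carrier A. orth A cs q y \<and> nrm A (x \<oplus>\<^bsub>A\<^esub> (- 1) \<odot>\<^bsub>A\<^esub> y) < \<delta>"
    if A: "P_star_algebra A" and x: "x \<in> carrier A" "adj A x = x" "nrm A x < R"
    for A :: "(complex, 'a, real) star_algebra" and x
  proof -
    interpret C_star_algebra A using A by (simp add: P_star_algebra_def)
    obtain s where s: "range s \<subseteq> orthogonal_combinations A" "(\<lambda>n. nrm A (x \<ominus>\<^bsub>A\<^esub> s n)) \<longlonglongrightarrow> 0"
      using A x unfolding P_star_algebra_def by blast
    have "\<forall>\<^sub>F n in sequentially. nrm A (x \<ominus>\<^bsub>A\<^esub> s n) < min (\<delta> / 2) 1"
      using order_tendstoD(2)[OF s(2), of "min (\<delta> / 2) 1"] assms by simp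
    then obtain n where n: "nrm A (x \<ominus>\<^bsub>A\<^esub> s n) < min (\<delta> / 2) 1"
      using eventually_happens'[OF sequentially_bot] by blast
    obtain N \<alpha> p where proj: "\<forall>i\<le>N. p i \<in> projections A"
        and orthogonal: "\<forall>i\<le>N. \<forall>j\<le>N. i \<noteq> j \<longrightarrow> p i \<otimes>\<^bsub>A\<^esub> p j = \<zero>\<^bsub>A\<^esub>"
        and y: "s n = (\<Oplus>\<^bsub>A\<^esub>i\<in>{0..N::nat}. \<alpha> i \<odot>\<^bsub>A\<^esub> p i)"
      using s(1) unfolding orthogonal_combinations_def by blast
    let ?S = "\<lambda>\<gamma>. \<Oplus>\<^bsub>A\<^esub>i\<in>{0..N}. \<gamma> i \<odot>\<^bsub>A\<^esub> p i"
    have I: "finite {0..N}" "\<forall>i\<in>{0..N}. p i \<in> projections A"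
      "\<forall>i\<in>{0..N}. \<forall>j\<in>{0..N}. i \<noteq> j \<longrightarrow> p i \<otimes>\<^bsub>A\<^esub> p j = \<zero>\<^bsub>A\<^esub>"
      using proj orthogonal by auto
    have small: "nrm A (s n) < R + 1"
    proof -
      have "s n = x \<oplus>\<^bsub>A\<^esub> (- 1) \<odot>\<^bsub>A\<^esub> (x \<ominus>\<^bsub>A\<^esub> s n)"
        using x comb_closed[OF I, where \<gamma> = \<alpha>] minus_smult[of x "x \<ominus>\<^bsub>A\<^esub> s n"] y
        by (simp add: minus_smult[symmetric] minus_eq minus_add a_assoc[symmetric] r_neg)
      then have "nrm A (s n) \<le> nrm A x + nrm A (x \<ominus>\<^bsub>A\<^esub> s n)"
        using nrm_add[of x "(- 1) \<odot>\<^bsub>A\<^esub> (x \<ominus>\<^bsub>A\<^esub> s n)"] x comb_closed[OF I, where \<gamma> = \<alpha>] y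
          nrm_smult[of "x \<ominus>\<^bsub>A\<^esub> s n" "- 1"] closed_smult[of "x \<ominus>\<^bsub>A\<^esub> s n" "- 1"]
        by simp
      then show ?thesis using n x by simp
    qed
    \<comment> \<open>At a zero projection the coefficient may lie outside the disc, so any grid
      point is accepted there; for this the list only has to be nonempty.\<close>
    define \<gamma> where "\<gamma> i = (SOME c. c \<in> set cs \<and> (p i \<noteq> \<zero>\<^bsub>A\<^esub> \<longrightarrow> cmod (\<alpha> i - c) < \<delta> / 2))" for i
    have \<gamma>: "\<gamma> i \<in> set cs \<and> (p i \<noteq> \<zero>\<^bsub>A\<^esub> \<longrightarrow> cmod (\<alpha> i - \<gamma> i) < \<delta> / 2)" if "i \<le> N" for i
    proof -
      have "p i \<noteq> \<zero>\<^bsub>A\<^esub> \<Longrightarrow> cmod (\<alpha> i) \<le> R + 1"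
        using coefficient_le[OF I, of i \<alpha>] that small y by auto
      moreover have "\<exists>c. c \<in> set cs"
      proof -
        have "cmod 0 \<le> R + 1" using small nrm_nonneg[of "s n"] comb_closed[OF I, where \<gamma> = \<alpha>] y by simp
        then show ?thesis using cs by blast
      qed
      ultimately have "\<exists>c. c \<in> set cs \<and> (p i \<noteq> \<zero>\<^bsub>A\<^esub> \<longrightarrow> cmod (\<alpha> i - c) < \<delta> / 2)"
        using cs by blast
      then show ?thesis unfolding \<gamma>_def by (rule someI_ex)
    qed
    have "nrm A (s n \<oplus>\<^bsub>A\<^esub> (- 1) \<odot>\<^bsub>A\<^esub> ?S \<gamma>) \<le> \<delta> / 2"
    proof -
      have "s n \<oplus>\<^bsub>A\<^esub> (- 1) \<odot>\<^bsub>A\<^esub> ?S \<gamma> = ?S (\<lambda>i. \<alpha> i + - 1 * \<gamma> i)"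
        unfolding y comb_smult[OF I] comb_add[OF I] ..
      \<comment> \<open>At zero projections the coefficient differences may be large without
        changing the sum; setting them to 0 makes \<open>nrm_comb_le\<close> applicable.\<close>
      also have "\<dots> = ?S (\<lambda>i. if p i = \<zero>\<^bsub>A\<^esub> then 0 else \<alpha> i - \<gamma> i)"
        using p_closed[OF I] closed_smult M.smult_r_null M.smult_l_null by (intro finsum_cong') auto
      also have "nrm A \<dots> \<le> \<delta> / 2"
        using \<gamma> assms by (intro nrm_comb_le[OF I]) (auto intro: less_imp_le)
      finally show ?thesis .
    qed
    moreover have "x \<oplus>\<^bsub>A\<^esub> (- 1) \<odot>\<^bsub>A\<^esub> ?S \<gamma> = (x \<ominus>\<^bsub>A\<^esub> s n) \<oplus>\<^bsub>A\<^esub> (s n \<oplus>\<^bsub>A\<^esub> (- 1) \<odot>\<^bsub>A\<^esub> ?S \<gamma>)"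
      using x comb_closed[OF I, where \<gamma> = \<alpha>] comb_closed[OF I, where \<gamma> = \<gamma>] closed_smult[OF comb_closed[OF I, where \<gamma> = \<gamma>], of "- 1"] y
        a_assoc[of "x" "\<ominus>\<^bsub>A\<^esub> s n" "s n \<oplus>\<^bsub>A\<^esub> (- 1) \<odot>\<^bsub>A\<^esub> ?S \<gamma>"]
      by (simp add: minus_eq r_neg1)
    moreover have "nrm A ((x \<ominus>\<^bsub>A\<^esub> s n) \<oplus>\<^bsub>A\<^esub> (s n \<oplus>\<^bsub>A\<^esub> (- 1) \<odot>\<^bsub>A\<^esub> ?S \<gamma>)) \<le>
        nrm A (x \<ominus>\<^bsub>A\<^esub> s n) + nrm A (s n \<oplus>\<^bsub>A\<^esub> (- 1) \<odot>\<^bsub>A\<^esub> ?S \<gamma>)"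
      using x comb_closed[OF I, where \<gamma> = \<alpha>] closed_smult[OF comb_closed[OF I, where \<gamma> = \<gamma>], of "- 1"] y
      by (intro nrm_add) simp_all
    ultimately have "nrm A (x \<oplus>\<^bsub>A\<^esub> (- 1) \<odot>\<^bsub>A\<^esub> ?S \<gamma>) < \<delta>"
      using n by simp
    moreover have "orth A cs (?S (\<lambda>i. if i \<in> {0..N} then 1 else 0)) (?S (\<lambda>i. if i \<in> {0..N} then \<gamma> i else 0))"
      using \<gamma> by (intro orth_comb[OF I]) auto
    then have "orth A cs (?S (\<lambda>i. if i \<in> {0..N} then 1 else 0)) (?S \<gamma>)"
      using comb_cong[OF I, of "\<lambda>i. if i \<in> {0..N} then \<gamma> i else 0" \<gamma>] by simp
    ultimately show ?thesis
      by (intro bexI[of _ "?S (\<lambda>i. if i \<in> {0..N} then 1 else 0)"] bexI[of _ "?S \<gamma>"] conjI comb_closed[OF I])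
  qed
  then show ?thesis by blast
qed

section \<open>The hull of a hyper-normed algebra\<close>

text \<open>\<open>nrm_conj\<close> and \<open>nrm_not\<close> say that \<open>nrm D x\<close> is an
  ultrafilter of sets of reals. In \<open>approximation\<close> the list \<open>cs\<close> is chosen
  before \<open>x\<close>. The assumption \<open>saturation\<close> concerns sequences of
  balls.\<close>

locale hyper_alg = star_alg D
  for D :: "(complex, 'a, (real \<Rightarrow> bool) \<Rightarrow> bool) star_algebra" (structure) +
  assumes nrm_conj: "x \<in> carrier D \<Longrightarrow> nrm D x (\<lambda>r. P r \<and> Q r) \<longleftrightarrow> nrm D x P \<and> nrm D x Q"
    and nrm_not: "x \<in> carrier D \<Longrightarrow> nrm D x (\<lambda>r. \<not> P r) \<longleftrightarrow> \<not> nrm D x P"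
    and nrm_nonneg: "x \<in> carrier D \<Longrightarrow> nrm D x (\<lambda>r. 0 \<le> r)"
    and nrm_zero: "nrm D \<zero> (\<lambda>r. r = 0)"
    and nrm_add: "\<lbrakk>x \<in> carrier D; y \<in> carrier D; nrm D x (\<lambda>r. r < a); nrm D y (\<lambda>r. r < b)\<rbrakk>
      \<Longrightarrow> nrm D (x \<oplus> y) (\<lambda>r. r < a + b)"
    and nrm_mult: "\<lbrakk>x \<in> carrier D; y \<in> carrier D; nrm D x (\<lambda>r. r < a); nrm D y (\<lambda>r. r < b)\<rbrakk>
      \<Longrightarrow> nrm D (x \<otimes> y) (\<lambda>r. r < a * b)"
    and nrm_smult: "x \<in> carrier D \<Longrightarrow> nrm D (c \<odot> x) P \<longleftrightarrow> nrm D x (\<lambda>r. P (cmod c * r))"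
    and nrm_adj: "x \<in> carrier D \<Longrightarrow> nrm D (adj D x) P \<longleftrightarrow> nrm D x P"
    and nrm_star: "x \<in> carrier D \<Longrightarrow> nrm D (adj D x \<otimes> x) P \<longleftrightarrow> nrm D x (\<lambda>r. P (r\<^sup>2))"
    and nrm_proj: "\<lbrakk>p \<in> carrier D; p \<otimes> p = p; adj D p = p\<rbrakk> \<Longrightarrow> nrm D p (\<lambda>r. r < 2)"
    and approximation: "0 < \<delta> \<Longrightarrow> \<exists>cs. \<forall>x\<in>carrier D. adj D x = x \<longrightarrow> nrm D x (\<lambda>r. r < b) \<longrightarrow>
      (\<exists>q\<in>carrier D. \<exists>y\<in>carrier D. orth D cs q y \<and> nrm D (x \<oplus> (- 1) \<odot> y) (\<lambda>r. r < \<delta>))"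
    and saturation: "\<lbrakk>range f \<subseteq> carrier D;
        \<And>k. \<exists>x\<in>carrier D. \<forall>n\<le>k. nrm D (x \<oplus> (- 1) \<odot> f n) (\<lambda>r. r < \<epsilon> n)\<rbrakk>
      \<Longrightarrow> \<exists>x\<in>carrier D. \<forall>n::nat. nrm D (x \<oplus> (- 1) \<odot> f n) (\<lambda>r. r < \<epsilon> n)"
begin

section \<open>The limits of the norm ultrafilters\<close>

lemma nrm_mono:
  assumes "x \<in> carrier D" "nrm D x P" "\<And>r. P r \<Longrightarrow> Q r"
  shows "nrm D x Q"
proof -
  have "(\<lambda>r. P r \<and> Q r) = P" using assms(3) by auto
  then show ?thesis using nrm_conj[OF assms(1), of P Q] assms(2) by simp
qed

lemma nrm_ex:
  assumes "x \<in> carrier D" "nrm D x P"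
  shows "\<exists>r. P r"
proof (rule ccontr)
  assume "\<not> ?thesis"
  then have "nrm D x (\<lambda>r. \<not> P r)"
    using nrm_mono[OF assms] by blast
  then show False using nrm_not assms by blast
qed

text \<open>This is convergence of the ultrafilter \<open>nrm D x\<close> to \<open>t\<close> on the
  real line; the limit \<open>N x\<close> is the standard part of the norm.\<close>

definition near :: "'a \<Rightarrow> real \<Rightarrow> bool" where
  "near x t \<longleftrightarrow> (\<forall>\<epsilon>>0. nrm D x (\<lambda>r. \<bar>r - t\<bar> < \<epsilon>))"

definition N :: "'a \<Rightarrow> real" where
  "N x = (THE t. near x t)"

definition fin :: "'a set" where
  "fin = {x \<in> carrier D. \<exists>n::nat. nrm D x (\<lambda>r. \<bar>r\<bar> < real n)}"

lemma near_unique: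
  assumes "x \<in> carrier D" "near x s" "near x t"
  shows "s = t"
proof (rule ccontr)
  assume "s \<noteq> t"
  then have "0 < \<bar>s - t\<bar> / 2" by simp
  then have "nrm D x (\<lambda>r. \<bar>r - s\<bar> < \<bar>s - t\<bar> / 2 \<and> \<bar>r - t\<bar> < \<bar>s - t\<bar> / 2)"
    using assms by (simp only: nrm_conj near_def)
  from nrm_ex[OF assms(1) this] show False by (auto simp: field_simps abs_if split: if_splits)
qed

lemma finI:
  assumes "x \<in> carrier D" "nrm D x (\<lambda>r. r < b)"
  shows "x \<in> fin"
proof -
  obtain n :: nat where "b < n" using reals_Archimedean2 by blast
  moreover have "nrm D x (\<lambda>r. 0 \<le> r \<and> r < b)"
    using assms nrm_nonneg by (simp add: nrm_conj)
  ultimately have "nrm D x (\<lambda>r. \<bar>r\<bar> < real n)"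
    by (intro nrm_mono[OF assms(1) \<open>nrm D x (\<lambda>r. 0 \<le> r \<and> r < b)\<close>]) auto
  then show ?thesis using assms(1) by (auto simp: fin_def)
qed

lemma fin_carrier: "x \<in> fin \<Longrightarrow> x \<in> carrier D"
  by (simp add: fin_def)

lemma near_imp_fin:
  assumes "x \<in> carrier D" "near x t"
  shows "x \<in> fin"
proof (rule finI[OF assms(1)])
  have "nrm D x (\<lambda>r. \<bar>r - t\<bar> < 1)" using assms by (simp add: near_def)
  then show "nrm D x (\<lambda>r. r < t + 1)" by (rule nrm_mono[OF assms(1)]) auto
qed

text \<open>An ultrafilter that contains a bounded interval converges. Its limit is the supremum of
  the \<open>s\<close> for which the half-line from \<open>s\<close> upwards belongs to it.\<close>

lemma near_exists:
  assumes "x \<in> fin"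
  shows "\<exists>t. near x t"
proof -
  note x = fin_carrier[OF assms]
  obtain n :: nat where n: "nrm D x (\<lambda>r. \<bar>r\<bar> < n)" using assms by (auto simp: fin_def)
  define S where "S = {s. nrm D x (\<lambda>r. s \<le> r)}"
  have "- real n \<in> S"
    using nrm_mono[OF x n, of "\<lambda>r. - real n \<le> r"] by (auto simp: S_def)
  have bdd: "s \<le> n" if "s \<in> S" for s
  proof -
    have "nrm D x (\<lambda>r. \<bar>r\<bar> < n \<and> s \<le> r)" using n that x by (simp add: S_def nrm_conj)
    from nrm_ex[OF x this] show ?thesis by auto
  qed
  have "nrm D x (\<lambda>r. \<bar>r - Sup S\<bar> < \<epsilon>)" if "0 < \<epsilon>" for \<epsilon>
  proof -
    have "\<exists>s\<in>S. Sup S - \<epsilon> < s"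
      using \<open>- real n \<in> S\<close> bdd that by (intro less_cSupD) auto
    then obtain s where s: "nrm D x (\<lambda>r. s \<le> r)" "Sup S - \<epsilon> < s" by (auto simp: S_def)
    have "Sup S + \<epsilon> / 2 \<notin> S"
      using that bdd cSup_upper[of "Sup S + \<epsilon> / 2" S] by (fastforce simp: bdd_above_def)
    then have "nrm D x (\<lambda>r. \<not> Sup S + \<epsilon> / 2 \<le> r)"
      using x by (simp only: nrm_not S_def) simp
    with s x have "nrm D x (\<lambda>r. s \<le> r \<and> \<not> Sup S + \<epsilon> / 2 \<le> r)"
      by (simp only: nrm_conj)
    then show ?thesis
      by (rule nrm_mono[OF x]) (use s(2) that in \<open>auto simp: abs_if\<close>)
  qed
  then show ?thesis unfolding near_def by blast
qed

lemma N_eq: "x \<in> carrier D \<Longrightarrow> near x t \<Longrightarrow> N x = t"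
  unfolding N_def using near_unique by blast

lemma near_N: "x \<in> fin \<Longrightarrow> near x (N x)"
  using near_exists N_eq fin_carrier by metis

lemma N_less:
  assumes "x \<in> fin" "N x < b"
  shows "nrm D x (\<lambda>r. r < b)"
proof -
  have "nrm D x (\<lambda>r. \<bar>r - N x\<bar> < b - N x)"
    using near_N[OF assms(1)] assms(2) by (simp add: near_def)
  then show ?thesis by (rule nrm_mono[OF fin_carrier[OF assms(1)]]) auto
qed

text \<open>Standard parts preserve only weak inequalities: a norm may lie below \<open>b\<close> by
  an infinitesimal.\<close>

lemma N_le:
  assumes "x \<in> fin" "nrm D x (\<lambda>r. r < b)"
  shows "N x \<le> b"
proof (rule ccontr)
  assume "\<not> ?thesis"
  then have "nrm D x (\<lambda>r. \<bar>r - N x\<bar> < N x - b)"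
    using near_N[OF assms(1)] by (simp add: near_def)
  then have "nrm D x (\<lambda>r. \<bar>r - N x\<bar> < N x - b \<and> r < b)"
    using assms fin_carrier by (simp add: nrm_conj)
  from nrm_ex[OF fin_carrier[OF assms(1)] this] show False by auto
qed

lemma N_nonneg:
  assumes "x \<in> fin"
  shows "0 \<le> N x"
proof (rule ccontr)
  assume "\<not> ?thesis"
  then have "nrm D x (\<lambda>r. r < 0)" using N_less[OF assms] by simp
  then have "nrm D x (\<lambda>r. r < 0 \<and> 0 \<le> r)"
    using assms fin_carrier nrm_nonneg by (simp add: nrm_conj)
  from nrm_ex[OF fin_carrier[OF assms] this] show False by auto
qed

text \<open>The ultrafilter of \<open>y\<close> is the image of that of \<open>x\<close> under
  \<open>f\<close>, and continuous maps carry limits to limits. The applications are multiplication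
  by a modulus, the identity and squaring.\<close>

lemma N_continuous:
  assumes "x \<in> fin" "y \<in> carrier D" "\<And>P. nrm D y P \<longleftrightarrow> nrm D x (\<lambda>r. P (f r))" "isCont f (N x)"
  shows "y \<in> fin \<and> N y = f (N x)"
proof -
  have "near y (f (N x))"
    unfolding near_def
  proof (intro allI impI)
    fix \<epsilon> :: real assume "0 < \<epsilon>"
    then obtain d where d: "0 < d" "\<forall>r. r \<noteq> N x \<and> norm (r - N x) < d \<longrightarrow> norm (f r - f (N x)) < \<epsilon>"
      using assms(4) LIM_D[of f "f (N x)" "N x" \<epsilon>] unfolding isCont_def by blast
    have "nrm D x (\<lambda>r. \<bar>r - N x\<bar> < d)"
      using near_N[OF assms(1)] d(1) by (simp add: near_def)
    then have "nrm D x (\<lambda>r. \<bar>f r - f (N x)\<bar> < \<epsilon>)"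
    proof (rule nrm_mono[OF fin_carrier[OF assms(1)]])
      show "\<bar>f r - f (N x)\<bar> < \<epsilon>" if "\<bar>r - N x\<bar> < d" for r
        using d(2) that \<open>0 < \<epsilon>\<close> by (cases "r = N x") auto
    qed
    then show "nrm D y (\<lambda>r. \<bar>r - f (N x)\<bar> < \<epsilon>)" by (simp add: assms(3))
  qed
  then show ?thesis using N_eq near_imp_fin assms(2) by blast
qed

lemma N_zero: "\<zero> \<in> fin" "N \<zero> = 0"
proof -
  have "near \<zero> 0"
    unfolding near_def
  proof (intro allI impI)
    fix \<epsilon> :: real assume "0 < \<epsilon>"
    then show "nrm D \<zero> (\<lambda>r. \<bar>r - 0\<bar> < \<epsilon>)"
      by (intro nrm_mono[OF closed_zero nrm_zero]) auto
  qed
  then show "\<zero> \<in> fin" "N \<zero> = 0"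
    using near_imp_fin N_eq by auto
qed

text \<open>A projection has norm 0 or 1; the bound 2 in \<open>nrm_proj\<close> leaves room for a
  strict inequality.\<close>

lemma proj_fin: "\<lbrakk>p \<in> carrier D; p \<otimes> p = p; adj D p = p\<rbrakk> \<Longrightarrow> p \<in> fin"
  using finI nrm_proj by blast

lemma adj_one: "adj D \<one> = \<one>"
  using adj_laws(4)[of "adj D \<one>" \<one>] adj_laws(1)[of \<one> \<one>] closed_adj[of \<one>] by simp

lemma one_fin: "\<one> \<in> fin"
  using adj_one by (intro proj_fin) auto

lemma N_smult: "x \<in> fin \<Longrightarrow> c \<odot> x \<in> fin \<and> N (c \<odot> x) = cmod c * N x"
  by (intro N_continuous nrm_smult closed_smult fin_carrier) auto

lemma N_adj: "x \<in> fin \<Longrightarrow> adj D x \<in> fin \<and> N (adj D x) = N x"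
  by (intro N_continuous nrm_adj closed_adj fin_carrier) auto

lemma N_star: "x \<in> fin \<Longrightarrow> adj D x \<otimes> x \<in> fin \<and> N (adj D x \<otimes> x) = (N x)\<^sup>2"
  by (intro N_continuous nrm_star closed_mult closed_adj fin_carrier) auto

lemma N_add:
  assumes "x \<in> fin" "y \<in> fin"
  shows "x \<oplus> y \<in> fin" "N (x \<oplus> y) \<le> N x + N y"
proof -
  have *: "nrm D (x \<oplus> y) (\<lambda>r. r < N x + N y + \<epsilon>)" if "0 < \<epsilon>" for \<epsilon>
    using nrm_add[OF fin_carrier[OF assms(1)] fin_carrier[OF assms(2)], of "N x + \<epsilon> / 2" "N y + \<epsilon> / 2"]
      N_less[OF assms(1)] N_less[OF assms(2)] that by (simp add: algebra_simps)
  show fin: "x \<oplus> y \<in> fin"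
    using closed_add[OF fin_carrier[OF assms(1)] fin_carrier[OF assms(2)]] *[OF zero_less_one]
    by (rule finI)
  show "N (x \<oplus> y) \<le> N x + N y"
    by (rule field_le_epsilon, rule N_le[OF fin *])
qed

lemma N_mult:
  assumes "x \<in> fin" "y \<in> fin"
  shows "x \<otimes> y \<in> fin" "N (x \<otimes> y) \<le> N x * N y"
proof -
  have *: "nrm D (x \<otimes> y) (\<lambda>r. r < (N x + \<epsilon>) * (N y + \<epsilon>))" if "0 < \<epsilon>" for \<epsilon>
    using nrm_mult[OF fin_carrier[OF assms(1)] fin_carrier[OF assms(2)], of "N x + \<epsilon>" "N y + \<epsilon>"]
      N_less[OF assms(1)] N_less[OF assms(2)] that by simp
  show fin: "x \<otimes> y \<in> fin"
    using closed_mult[OF fin_carrier[OF assms(1)] fin_carrier[OF assms(2)]] *[OF zero_less_one]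
    by (rule finI)
  have "(\<lambda>n. (N x + inverse (real (Suc n))) * (N y + inverse (real (Suc n)))) \<longlonglongrightarrow> (N x + 0) * (N y + 0)"
    by (intro tendsto_intros LIMSEQ_inverse_real_of_nat)
  then show "N (x \<otimes> y) \<le> N x * N y"
    using N_le[OF fin *] by (intro LIMSEQ_le_const[where X = "\<lambda>n. (N x + inverse (real (Suc n))) * (N y + inverse (real (Suc n)))"]) auto
qed

abbreviation diff :: "'a \<Rightarrow> 'a \<Rightarrow> 'a" where
  "diff x y \<equiv> x \<oplus> (- 1) \<odot> y"

lemma diff_fin: "x \<in> fin \<Longrightarrow> y \<in> fin \<Longrightarrow> diff x y \<in> fin"
  using N_add(1) N_smult by blast

lemma diff_trans:
  assumes "x \<in> carrier D" "y \<in> carrier D" "z \<in> carrier D"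
  shows "diff x z = diff x y \<oplus> diff y z"
proof -
  have "x \<ominus> z = (x \<ominus> y) \<oplus> (y \<ominus> z)"
    using assms by (simp add: minus_eq a_assoc r_neg1)
  then show ?thesis using assms by (simp add: minus_smult)
qed

lemma diff_swap:
  assumes "x \<in> carrier D" "y \<in> carrier D"
  shows "diff y x = (- 1) \<odot> diff x y"
  using assms M.smult_r_distr[of "- 1" x "(- 1) \<odot> y"] M.smult_assoc1[of "- 1" "- 1" y] M.smult_one[of y]
    a_comm[of y "(- 1) \<odot> x"] closed_smult
  by simp

lemma N_diff_swap: "x \<in> fin \<Longrightarrow> y \<in> fin \<Longrightarrow> N (diff y x) = N (diff x y)"
  using diff_swap[of x y] N_smult[of "diff x y" "- 1"] diff_fin fin_carrier by auto

lemma N_diff_triangle: "x \<in> fin \<Longrightarrow> y \<in> fin \<Longrightarrow> z \<in> fin \<Longrightarrow> N (diff x z) \<le> N (diff x y) + N (diff y z)"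
  using diff_trans[of x y z] N_add(2)[of "diff x y" "diff y z"] diff_fin fin_carrier by auto

end

text \<open>The hull enters through a surjection \<open>h\<close> from the finite elements that
  identifies exactly the infinitely close ones. This keeps the definite descriptions of
  \<open>nonstandard_hull\<close> out of the argument.\<close>

locale alg_hull = hyper_alg D
  for D :: "(complex, 'a, (real \<Rightarrow> bool) \<Rightarrow> bool) star_algebra" (structure) +
  fixes Q :: "(complex, 'b, real) star_algebra" and h :: "'a \<Rightarrow> 'b"
  assumes carrier_Q: "carrier Q = h ` fin"
    and h_eq_iff: "\<lbrakk>x \<in> fin; y \<in> fin\<rbrakk> \<Longrightarrow> h x = h y \<longleftrightarrow> N (diff x y) = 0"
    and one_Q: "\<one>\<^bsub>Q\<^esub> = h \<one>"
    and zero_Q: "\<zero>\<^bsub>Q\<^esub> = h \<zero>"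
    and mult_Q: "\<lbrakk>x \<in> fin; y \<in> fin\<rbrakk> \<Longrightarrow> h x \<otimes>\<^bsub>Q\<^esub> h y = h (x \<otimes> y)"
    and add_Q: "\<lbrakk>x \<in> fin; y \<in> fin\<rbrakk> \<Longrightarrow> h x \<oplus>\<^bsub>Q\<^esub> h y = h (x \<oplus> y)"
    and smult_Q: "x \<in> fin \<Longrightarrow> c \<odot>\<^bsub>Q\<^esub> h x = h (c \<odot> x)"
    and adj_Q: "x \<in> fin \<Longrightarrow> adj Q (h x) = h (adj D x)"
    and nrm_Q: "x \<in> fin \<Longrightarrow> nrm Q (h x) = N x"
begin

lemma h_closed: "x \<in> fin \<Longrightarrow> h x \<in> carrier Q"
  by (simp add: carrier_Q)

text \<open>The finite elements are closed under all operations and \<open>h\<close> respects these,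
  so every equational law of \<open>D\<close> passes to \<open>Q\<close>.\<close>

lemma tval_Q:
  assumes "\<And>i. e i \<in> fin"
  shows "tval D e t \<in> fin \<and> tval Q (h \<circ> e) t = h (tval D e t)"
  by (induction t)
    (auto simp: assms one_fin one_Q N_zero zero_Q N_mult mult_Q N_add add_Q N_smult smult_Q N_adj adj_Q)

sublocale Q: star_alg Q
proof
  fix s t and e :: "nat \<Rightarrow> 'b"
  assume st: "law s t" and "range e \<subseteq> carrier Q"
  then have "\<forall>i. \<exists>x. x \<in> fin \<and> e i = h x"
    unfolding carrier_Q by blast
  then obtain f where f: "\<And>i. f i \<in> fin" "\<And>i. e i = h (f i)" by metis
  then have e: "e = h \<circ> f" by auto
  have "tval D f s = tval D f t"
    by (rule laws[OF st]) (use f fin_carrier in auto)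
  then show "tval Q e s = tval Q e t"
    using tval_Q[of f s] tval_Q[of f t] f(1) unfolding e by simp
qed (auto simp: carrier_Q one_fin one_Q N_zero zero_Q N_mult mult_Q N_add add_Q N_smult smult_Q N_adj adj_Q)

lemma diff_Q: "x \<in> fin \<Longrightarrow> y \<in> fin \<Longrightarrow> h x \<ominus>\<^bsub>Q\<^esub> h y = h (diff x y)"
  using Q.minus_smult[of "h x" "h y"] by (simp add: h_closed add_Q smult_Q N_smult)

text \<open>A Cauchy sequence gives balls of radius 1/(n+1) around representatives of suitable
  members. Finitely many of the balls have a common point, and by saturation all of them do; its
  class is the limit.\<close>

lemma complete_Q:
  assumes s: "range s \<subseteq> carrier Q"
    and Cauchy: "\<forall>e>0. \<exists>k. \<forall>i\<ge>k. \<forall>j\<ge>k. nrm Q (s i \<ominus>\<^bsub>Q\<^esub> s j) < e"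
  shows "\<exists>x\<in>carrier Q. (\<lambda>i. nrm Q (s i \<ominus>\<^bsub>Q\<^esub> x)) \<longlonglongrightarrow> 0"
proof -
  have "\<forall>i. \<exists>x. x \<in> fin \<and> s i = h x"
    using s unfolding carrier_Q by blast
  then obtain a where a: "\<And>i. a i \<in> fin" "\<And>i. s i = h (a i)" by metis
  let ?\<epsilon> = "\<lambda>n. 1 / real (Suc n)"
  have nrm_s: "nrm Q (s i \<ominus>\<^bsub>Q\<^esub> s j) = N (diff (a i) (a j))" for i j
    using a by (simp add: diff_Q nrm_Q diff_fin)
  have "\<exists>k. \<forall>i\<ge>k. \<forall>j\<ge>k. N (diff (a i) (a j)) < ?\<epsilon> n" for n
    using Cauchy[rule_format, of "?\<epsilon> n"] by (simp add: nrm_s)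
  then obtain k where k: "\<And>n i j. i \<ge> k n \<Longrightarrow> j \<ge> k n \<Longrightarrow> N (diff (a i) (a j)) < ?\<epsilon> n"
    by metis
  have "\<exists>x\<in>carrier D. \<forall>n::nat. nrm D (diff x ((a \<circ> k) n)) (\<lambda>r. r < ?\<epsilon> n)"
  proof (rule saturation)
    show "range (a \<circ> k) \<subseteq> carrier D" using a fin_carrier by auto
    fix m
    \<comment> \<open>A representative whose index is at least \<open>k n\<close> for every
      \<open>n \<le> m\<close> lies in all of these balls.\<close>
    let ?x = "a (Max (k ` {..m}))"
    have "nrm D (diff ?x ((a \<circ> k) n)) (\<lambda>r. r < ?\<epsilon> n)" if "n \<le> m" for n
      using k[of n "Max (k ` {..m})" "k n"] that a by (auto intro!: N_less diff_fin)
    then show "\<exists>x\<in>carrier D. \<forall>n\<le>m. nrm D (diff x ((a \<circ> k) n)) (\<lambda>r. r < ?\<epsilon> n)"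
      using a fin_carrier by blast
  qed
  then obtain x where x: "x \<in> carrier D" "\<And>n. nrm D (diff x (a (k n))) (\<lambda>r. r < ?\<epsilon> n)"
    by auto
  \<comment> \<open>Saturation yields a mere element of the carrier; the ball of radius 1 around the
    finite element \<open>a (k 0)\<close> makes it finite.\<close>
  have "diff x (a (k 0)) \<in> fin"
    using x a fin_carrier closed_smult by (intro finI[OF _ x(2)]) auto
  moreover have "diff x (a (k 0)) \<oplus> a (k 0) = x"
    using x a fin_carrier by (simp add: minus_smult[symmetric] minus_eq a_assoc l_neg)
  ultimately have fin: "x \<in> fin" using N_add(1) a by metis
  have "N (diff (a i) x) \<le> 2 * ?\<epsilon> n" if "i \<ge> k n" for i n
  proof -
    have "N (diff x (a (k n))) \<le> ?\<epsilon> n"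
      using x(2) diff_fin[OF fin a(1)] by (rule N_le[rotated])
    moreover have "N (diff (a i) (a (k n))) < ?\<epsilon> n" using k that by simp
    ultimately show ?thesis
      using N_diff_triangle[OF a(1) a(1) fin, of i "k n"] N_diff_swap[OF fin a(1), of "k n"] by simp
  qed
  note le = this
  have "(\<lambda>i. N (diff (a i) x)) \<longlonglongrightarrow> 0"
  proof (rule LIMSEQ_I)
    fix e :: real assume "0 < e"
    then obtain n where n: "2 / e < real n" using reals_Archimedean2 by blast
    then have "2 * ?\<epsilon> n < e"
      using \<open>0 < e\<close> by (simp add: field_simps)
    then have "norm (N (diff (a i) x) - 0) < e" if "i \<ge> k n" for i
      using le[OF that] N_nonneg[OF diff_fin[OF a(1) fin], of i] by simp
    then show "\<exists>m. \<forall>i\<ge>m. norm (N (diff (a i) x) - 0) < e" by blast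
  qed
  then have "(\<lambda>i. nrm Q (s i \<ominus>\<^bsub>Q\<^esub> h x)) \<longlonglongrightarrow> 0"
    using a fin by (simp add: diff_Q nrm_Q diff_fin)
  then show ?thesis using h_closed[OF fin] by blast
qed

lemma nrm_eq_0_Q: "x \<in> fin \<Longrightarrow> N x = 0 \<longleftrightarrow> h x = \<zero>\<^bsub>Q\<^esub>"
  using h_eq_iff[of x \<zero>] N_zero(1) M.smult_r_null[of "- 1"] fin_carrier[of x] by (simp add: zero_Q)

lemma nrm_zero_Q: "nrm Q \<zero>\<^bsub>Q\<^esub> = 0"
  by (simp add: zero_Q nrm_Q N_zero)

lemma C_star_algebra_Q: "C_star_algebra Q"
proof (rule C_star_algebra.intro, goal_cases)
  case 1 show ?case by (rule Q.ring_A)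
next
  case 2 show ?case by (rule Q.module_A)
next
  case 10 then show ?case using complete_Q by blast
qed (simp_all add: Q.smult_mult Q.adj_laws Q.closed_adj, auto simp: carrier_Q nrm_Q N_nonneg nrm_eq_0_Q nrm_zero_Q
  add_Q mult_Q adj_Q smult_Q N_add N_mult N_smult N_adj N_star)

text \<open>The list \<open>cs\<close> has standard length, so \<open>q\<close> and \<open>y\<close>
  are sums of a standard number of finite terms. An ordinary induction over \<open>cs\<close>
  therefore shows that they are finite.\<close>

lemma orth_Q:
  "\<lbrakk>orth D cs q y; q \<in> carrier D; y \<in> carrier D\<rbrakk> \<Longrightarrow> q \<in> fin \<and> y \<in> fin \<and> orth Q cs (h q) (h y)"
proof (induction cs arbitrary: q y)
  case Nil
  then show ?case by (simp add: N_zero zero_Q)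
next
  case (Cons c cs)
  then obtain q' y' p where p: "q' \<in> carrier D" "y' \<in> carrier D" "p \<in> carrier D" "orth D cs q' y'"
      "p \<otimes> p = p" "adj D p = p" "p \<otimes> q' = \<zero>" "q' \<otimes> p = \<zero>"
    and qy: "q = q' \<oplus> p" "y = y' \<oplus> c \<odot> p"
    by auto
  have IH: "q' \<in> fin" "y' \<in> fin" "orth Q cs (h q') (h y')" using Cons.IH p by auto
  moreover have "p \<in> fin" using proj_fin p by blast
  ultimately show ?case
    unfolding orth.simps
    by (intro conjI bexI[of _ "h q'"] bexI[of _ "h y'"] bexI[of _ "h p"])
      (simp_all add: qy p N_add N_smult mult_Q adj_Q add_Q smult_Q zero_Q h_closed)
qed

theorem P_star_algebra_Q: "P_star_algebra Q"
proof -
  interpret C: C_star_algebra Q by (rule C_star_algebra_Q)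
  have "\<exists>s. range s \<subseteq> orthogonal_combinations Q \<and> (\<lambda>n. nrm Q (a \<ominus>\<^bsub>Q\<^esub> s n)) \<longlonglongrightarrow> 0"
    if a: "a \<in> carrier Q" "adj Q a = a" for a
  proof -
    obtain x where x: "x \<in> fin" "a = h x" using a by (auto simp: carrier_Q)
    note xc = fin_carrier[OF x(1)]
    \<comment> \<open>A representative of a self-adjoint class is in general only infinitely close
      to its adjoint. Averaging it with the adjoint gives an exactly self-adjoint element of the
      same class.\<close>
    define b where "b = (1/2) \<odot> (x \<oplus> adj D x)"
    have b: "b \<in> fin" using x N_add N_smult N_adj by (simp add: b_def)
    have "adj D b = b"
      using xc closed_adj by (simp add: b_def adj_laws a_comm)
    have "h b = (1/2) \<odot>\<^bsub>Q\<^esub> (a \<oplus>\<^bsub>Q\<^esub> adj Q a)"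
      using x by (simp add: b_def add_Q smult_Q adj_Q N_add N_adj)
    also have "\<dots> = a"
      using a Q.M.smult_r_distr[of "1/2" a a] Q.M.smult_l_distr[of "1/2" "1/2" a] Q.M.smult_one[of a] by simp
    finally have hb: "h b = a" .
    have "\<exists>z\<in>orthogonal_combinations Q. nrm Q (a \<ominus>\<^bsub>Q\<^esub> z) \<le> inverse (real (Suc n))" for n
    proof -
      \<comment> \<open>\<open>N b\<close> is only the standard part of the norm of
        \<open>b\<close>; \<open>N b + 1\<close> is a strict bound for the norm itself.\<close>
      obtain cs where "\<forall>x\<in>carrier D. adj D x = x \<longrightarrow> nrm D x (\<lambda>r. r < N b + 1) \<longrightarrow>
          (\<exists>q\<in>carrier D. \<exists>y\<in>carrier D. orth D cs q y \<and> nrm D (diff x y) (\<lambda>r. r < inverse (real (Suc n))))"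
        using approximation[of "inverse (real (Suc n))" "N b + 1"] by auto
      then obtain q y where qy: "q \<in> carrier D" "y \<in> carrier D" "orth D cs q y"
          "nrm D (diff b y) (\<lambda>r. r < inverse (real (Suc n)))"
        using N_less[OF b, of "N b + 1"] \<open>adj D b = b\<close> fin_carrier[OF b] by auto
      then have fin: "q \<in> fin" "y \<in> fin" "orth Q cs (h q) (h y)" using orth_Q by auto
      have "h y \<in> orthogonal_combinations Q"
        using C.orth_imp_orthogonal_combinations[OF fin(3)] h_closed fin by blast
      moreover have "nrm Q (a \<ominus>\<^bsub>Q\<^esub> h y) \<le> inverse (real (Suc n))"
        using N_le[OF diff_fin[OF b fin(2)] qy(4)] b fin by (simp add: hb[symmetric] diff_Q nrm_Q diff_fin)
      ultimately show ?thesis by blast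
    qed
    then obtain s where s: "\<And>n. s n \<in> orthogonal_combinations Q"
        "\<And>n. nrm Q (a \<ominus>\<^bsub>Q\<^esub> s n) \<le> inverse (real (Suc n))"
      by metis
    have "s n \<in> carrier Q" for n
    proof -
      obtain N \<alpha> p where "\<forall>i\<le>N. p i \<in> projections Q" "s n = (\<Oplus>\<^bsub>Q\<^esub>i\<in>{0..N::nat}. \<alpha> i \<odot>\<^bsub>Q\<^esub> p i)"
        using s(1)[of n] unfolding orthogonal_combinations_def by blast
      then show ?thesis
        using Q.closed_smult by (auto simp: projections_def intro!: Q.finsum_closed)
    qed
    then have "0 \<le> nrm Q (a \<ominus>\<^bsub>Q\<^esub> s n)" for n
      using C.nrm_nonneg a by simp
    then have "(\<lambda>n. nrm Q (a \<ominus>\<^bsub>Q\<^esub> s n)) \<longlonglongrightarrow> 0"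
      using s(2) by (intro tendsto_sandwich[OF _ _ tendsto_const LIMSEQ_inverse_real_of_nat]) auto
    then show ?thesis using s(1) by blast
  qed
  then show ?thesis
    unfolding P_star_algebra_def using C_star_algebra_Q by blast
qed

end

section \<open>Classes of infinitely close elements\<close>

context hyper_alg
begin

definition cls :: "'a \<Rightarrow> 'a set" where
  "cls x = {y \<in> fin. N (diff y x) = 0}"

lemma cls_self: "x \<in> fin \<Longrightarrow> x \<in> cls x"
  using law3[OF law.intros(4), of x x x] fin_carrier[of x] N_zero(2) by (simp add: cls_def)

lemma cls_eqI:
  assumes "x \<in> fin" "y \<in> fin" "N (diff x y) = 0"
  shows "cls x = cls y"
proof -
  have "N (diff z x) = 0 \<longleftrightarrow> N (diff z y) = 0" if "z \<in> fin" for z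
    using N_diff_triangle[OF that assms(1,2)] N_diff_triangle[OF that assms(2,1)] N_diff_swap[OF assms(1,2)]
      N_nonneg[OF diff_fin[OF that assms(1)]] N_nonneg[OF diff_fin[OF that assms(2)]] assms(3)
    by auto
  then show ?thesis by (auto simp: cls_def)
qed

lemma cls_memD: "a \<in> cls x \<Longrightarrow> a \<in> fin" "a \<in> cls x \<Longrightarrow> N (diff a x) = 0"
  by (simp_all add: cls_def)

lemma cls_eq_iff:
  assumes "x \<in> fin" "y \<in> fin"
  shows "cls x = cls y \<longleftrightarrow> N (diff x y) = 0"
proof
  assume "cls x = cls y"
  then have "x \<in> cls y" using cls_self[OF assms(1)] by simp
  then show "N (diff x y) = 0" by (rule cls_memD)
qed (rule cls_eqI[OF assms])

text \<open>ab - xy = a(b - y) + (a - x)y, and the product of a finite and an infinitesimal element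
  is infinitesimal.\<close>

lemma cls_mult_cong:
  assumes "x \<in> fin" "y \<in> fin" "a \<in> cls x" "b \<in> cls y"
  shows "cls (a \<otimes> b) = cls (x \<otimes> y)"
proof (rule cls_eqI)
  note ab = cls_memD(1)[OF assms(3)] cls_memD(1)[OF assms(4)]
  note c = fin_carrier[OF assms(1)] fin_carrier[OF assms(2)] fin_carrier[OF ab(1)] fin_carrier[OF ab(2)]
  show fin: "a \<otimes> b \<in> fin" "x \<otimes> y \<in> fin" using ab assms N_mult by auto
  have "diff (a \<otimes> b) (x \<otimes> y) = a \<otimes> diff b y \<oplus> diff a x \<otimes> y"
    using c diff_trans[of "a \<otimes> b" "a \<otimes> y" "x \<otimes> y"] by (simp add: r_distr l_distr smult_mult closed_smult)
  then have "N (diff (a \<otimes> b) (x \<otimes> y)) \<le> N (a \<otimes> diff b y) + N (diff a x \<otimes> y)"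
    using N_add(2) N_mult(1) diff_fin ab assms by simp
  also have "\<dots> \<le> N a * N (diff b y) + N (diff a x) * N y"
    using N_mult(2) diff_fin ab assms by (intro add_mono) auto
  finally show "N (diff (a \<otimes> b) (x \<otimes> y)) = 0"
    using assms(3,4) N_nonneg[OF diff_fin[OF fin]] by (simp add: cls_def)
qed

lemma cls_add_cong:
  assumes "x \<in> fin" "y \<in> fin" "a \<in> cls x" "b \<in> cls y"
  shows "cls (a \<oplus> b) = cls (x \<oplus> y)"
proof (rule cls_eqI)
  note ab = cls_memD(1)[OF assms(3)] cls_memD(1)[OF assms(4)]
  note c = fin_carrier[OF assms(1)] fin_carrier[OF assms(2)] fin_carrier[OF ab(1)] fin_carrier[OF ab(2)]
  show fin: "a \<oplus> b \<in> fin" "x \<oplus> y \<in> fin" using ab assms N_add by auto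
  have "diff (a \<oplus> b) (x \<oplus> y) = diff a x \<oplus> diff b y"
    using c M.smult_r_distr[of "- 1" x y] by (simp add: a_ac closed_smult)
  then show "N (diff (a \<oplus> b) (x \<oplus> y)) = 0"
    using N_add(2)[of "diff a x" "diff b y"] diff_fin ab assms N_nonneg[OF diff_fin[OF fin]]
    by (simp add: cls_def)
qed

lemma cls_smult_cong:
  assumes "x \<in> fin" "a \<in> cls x"
  shows "cls (c \<odot> a) = cls (c \<odot> x)"
proof (rule cls_eqI)
  note a = cls_memD(1)[OF assms(2)]
  show "c \<odot> a \<in> fin" "c \<odot> x \<in> fin" using a assms N_smult by auto
  have "diff (c \<odot> a) (c \<odot> x) = c \<odot> diff a x"
    using fin_carrier[OF assms(1)] fin_carrier[OF a] M.smult_r_distr[of c a "(- 1) \<odot> x"]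
      M.smult_assoc1[of c "- 1" x] M.smult_assoc1[of "- 1" c x] by (simp add: closed_smult)
  then show "N (diff (c \<odot> a) (c \<odot> x)) = 0"
    using N_smult[OF diff_fin[OF a assms(1)], of c] assms by (simp add: cls_def)
qed

lemma cls_adj_cong:
  assumes "x \<in> fin" "a \<in> cls x"
  shows "cls (adj D a) = cls (adj D x)"
proof (rule cls_eqI)
  note a = cls_memD(1)[OF assms(2)]
  show "adj D a \<in> fin" "adj D x \<in> fin" using a assms N_adj by auto
  have "diff (adj D a) (adj D x) = adj D (diff a x)"
    using fin_carrier[OF assms(1)] fin_carrier[OF a] by (simp add: adj_laws closed_smult)
  then show "N (diff (adj D a) (adj D x)) = 0"
    using N_adj[OF diff_fin[OF a assms(1)]] assms by (simp add: cls_def)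
qed

text \<open>By the triangle inequality, two values of \<open>N\<close> differ by at most the value
  at the difference.\<close>

lemma N_cls:
  assumes "x \<in> fin" "a \<in> cls x"
  shows "N a = N x"
proof -
  note a = cls_memD(1)[OF assms(2)]
  have le: "N y \<le> N z + N (diff y z)" if "y \<in> fin" "z \<in> fin" for y z
  proof -
    have "y = z \<oplus> diff y z"
      using fin_carrier that by (simp add: minus_smult[symmetric] minus_eq a_ac r_neg1) (simp add: a_lcomm r_neg)
    then show ?thesis using N_add(2)[OF that(2) diff_fin[OF that]] by simp
  qed
  show ?thesis
    using le[OF a assms(1)] le[OF assms(1) a] N_diff_swap[OF a assms(1)] assms(2) by (simp add: cls_def)
qed

text \<open>\<open>hat\<close> ranges over the whole carrier but \<open>cls\<close> over finite
  elements only. They agree because an element infinitely close to a finite one is finite.\<close>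

lemma near_zero_diff:
  assumes "x \<in> fin" "y \<in> carrier D"
  shows "near (diff y x) 0 \<longleftrightarrow> y \<in> cls x"
proof
  have c: "diff y x \<in> carrier D" using assms fin_carrier closed_smult by auto
  assume near: "near (diff y x) 0"
  then have "diff y x \<in> fin" using near_imp_fin c by blast
  moreover have "diff y x \<oplus> x = y"
    using assms fin_carrier by (simp add: minus_smult[symmetric] minus_eq a_assoc l_neg)
  ultimately have "y \<in> fin" using N_add(1) assms(1) by metis
  then show "y \<in> cls x" using N_eq[OF c near] by (simp add: cls_def)
next
  assume "y \<in> cls x"
  then show "near (diff y x) 0"
    using near_N[OF diff_fin[OF cls_memD(1) assms(1)], of y x] cls_memD(2)[of y x] by simp
qed

lemma near_iff_inverse:
  assumes "x \<in> carrier D"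
  shows "near x t \<longleftrightarrow> (\<forall>n\<ge>1. nrm D x (\<lambda>r. \<bar>r - t\<bar> < 1 / real n))"
proof
  assume R: "\<forall>n\<ge>1. nrm D x (\<lambda>r. \<bar>r - t\<bar> < 1 / real n)"
  show "near x t"
    unfolding near_def
  proof (intro allI impI)
    fix \<epsilon> :: real assume "0 < \<epsilon>"
    then obtain n where n: "inverse (real (Suc n)) < \<epsilon>" using reals_Archimedean by blast
    have "nrm D x (\<lambda>r. \<bar>r - t\<bar> < 1 / real (Suc n))"
      using R[rule_format, of "Suc n"] by (simp del: of_nat_Suc)
    then show "nrm D x (\<lambda>r. \<bar>r - t\<bar> < \<epsilon>)"
      by (rule nrm_mono[OF assms]) (use n in \<open>simp add: inverse_eq_divide\<close>)
  qed
qed (simp add: near_def)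

end

text \<open>The variables \<open>n\<close> and \<open>n + 1\<close> hold q and y, the three bound
  ones q', y' and p. The recursive call may rebind \<open>n + 4\<close>; this is harmless, since
  only \<open>n + 2\<close> and \<open>n + 3\<close> can be free in it.\<close>

primrec orth_form :: "complex list \<Rightarrow> nat \<Rightarrow> aform" where
  "orth_form [] n = AConj (AEq (AVar n) AZero) (AEq (AVar (Suc n)) AZero)"
| "orth_form (c # cs) n = AEx (n + 2) (AEx (n + 3) (AEx (n + 4)
     (AConj (orth_form cs (n + 2))
     (AConj (AEq (AMult (AVar (n + 4)) (AVar (n + 4))) (AVar (n + 4)))
     (AConj (AEq (AAdj (AVar (n + 4))) (AVar (n + 4)))
     (AConj (AEq (AMult (AVar (n + 4)) (AVar (n + 2))) AZero)
     (AConj (AEq (AMult (AVar (n + 2)) (AVar (n + 4))) AZero)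
     (AConj (AEq (AVar n) (AAdd (AVar (n + 2)) (AVar (n + 4))))
       (AEq (AVar (Suc n)) (AAdd (AVar (n + 3)) (ASmult c (AVar (n + 4)))))))))))))"

lemma holds_orth_form: "holds D e (orth_form cs n) \<longleftrightarrow> orth D cs (e n) (e (Suc n))"
proof (induction cs arbitrary: e n)
  case (Cons c cs)
  have "holds D (e(n + 2 := q', n + 3 := y', n + 4 := p)) (orth_form cs (n + 2)) \<longleftrightarrow> orth D cs q' y'" for q' y' p
    by (subst Cons.IH) simp
  then show ?case by simp
qed simp

lemma fvars_orth_form: "fvars (orth_form cs n) \<subseteq> {n, Suc n}"
proof (induction cs arbitrary: n)
  case (Cons c cs)
  from Cons.IH[of "n + 2"] show ?case by auto
qed simp

lemma filter_norm_simps [simp]: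
  "carrier (filter_norm A) = carrier A" "mult (filter_norm A) = mult A" "one (filter_norm A) = one A"
  "zero (filter_norm A) = zero A" "add (filter_norm A) = add A" "smult (filter_norm A) = smult A"
  "adj (filter_norm A) = adj A" "nrm (filter_norm A) x P \<longleftrightarrow> x \<in> carrier A \<and> P (nrm A x)"
  by (simp_all add: filter_norm_def)

lemma tval_filter_norm [simp]: "tval (filter_norm A) e t = tval A e t"
  by (induction t) auto

lemma orth_filter_norm [simp]: "orth (filter_norm A) cs q y = orth A cs q y"
  by (induction cs arbitrary: q y) auto

lemma law_tvars: "law s t \<Longrightarrow> tvars s \<union> tvars t \<subseteq> {0, 1, 2}"
  by (induction rule: law.induct) auto

section \<open>Internal algebras\<close>

text \<open>Saturation is stated for sequences of internal sets, which keeps the cardinal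
  \<open>\<kappa>\<close> out of the argument; uncountability of \<open>\<kappa>\<close> provides
  this form.\<close>

locale internal_algebra =
  fixes U :: "('u, 'w) universe" and S :: 'u and m :: 'w
  assumes U: "superstructure U" and transfer: "transfer_principle U"
    and saturated: "\<And>b :: nat \<Rightarrow> 'w. \<lbrakk>\<And>n. internal U (b n); \<And>k. \<exists>x. \<forall>n\<le>k. ielem U x (b n)\<rbrakk>
      \<Longrightarrow> \<exists>x. \<forall>n. ielem U x (b n)"
    and S: "\<And>u. elem U u S \<Longrightarrow> codes_algebra U u \<and> P_star_algebra (standard_algebra U u)"
    and m: "ielem U m (star U S)"
begin

lemma bounded_transfer_const:
  assumes "\<And>v. (\<And>c. v (C c) = c) \<Longrightarrow> bsat (elem U) v \<phi>"
  shows "\<exists>v. (\<forall>c. v (C c) = star U c) \<and> bsat (ielem U) v \<phi>"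
proof -
  define v where "v = (\<lambda>x. case x of C c \<Rightarrow> c | _ \<Rightarrow> S)"
  have "bsat (elem U) v \<phi>" by (rule assms) (simp add: v_def)
  then have "bsat (ielem U) (star U \<circ> v) \<phi>"
    using bounded_transfer[OF transfer] by blast
  then show ?thesis by (intro exI[of _ "star U \<circ> v"]) (simp add: v_def)
qed

text \<open>Were \<open>S\<close> empty, then so would be \<open>star U S\<close> by transfer,
  contrary to \<open>m\<close>. A standard code in \<open>S\<close> is what bounds the height of the
  universe from below.\<close>

lemma S_nonempty: "\<exists>u. elem U u S"
proof (rule ccontr)
  assume "\<not> ?thesis"
  then have "\<exists>v. (\<forall>c. v (C c) = star U c) \<and>
      bsat (ielem U) v (BNeg (BBex (X 0) (C S) (BEqu (X 0) (X 0))))"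
    by (intro bounded_transfer_const) auto
  then show False using m by auto
qed

lemma height: "enat 5 \<le> height U"
  using S_nonempty S codes_algebra_height[OF U] by blast

lemmas elem_nums = elem_nums[OF U height]
  and elem_reals_with = elem_reals_with[OF U height]
  and rnum_inject = rnum_inject[OF U height]

lemma star_mem: "elem U x y \<Longrightarrow> ielem U (star U x) (star U y)"
  using bounded_transfer_const[of "BMem (C x) (C y)"] by auto

lemma code_standard: "elem U u S \<Longrightarrow> code U (elem U) id u"
  using code_if_codes_algebra[OF U height] S by blast

sublocale algebra_code U "ielem U" "star U" m
proof
  show "code U (ielem U) (star U) m"
    using code_transfer[OF transfer _ code_standard m, of "BEqu (X 0) (X 0)"] by auto
  show "ielem U (star U (num U c)) (star U (nums U))" for c
    by (intro star_mem) (simp add: elem_nums)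
qed

lemma holds_standard:
  assumes "elem U u S" "decodes (elem U) id u v" "\<forall>i\<in>fvars \<phi>. v (X i) \<in> carrier (standard_algebra U u)"
  shows "bsat (elem U) v (form_of U \<phi>) \<longleftrightarrow> holds (filter_norm (standard_algebra U u)) (\<lambda>i. v (X i)) \<phi>"
proof -
  have u: "codes_algebra U u" using S assms(1) by blast
  have "bsat (elem U) v (form_of U \<phi>) \<longleftrightarrow> holds (alg U (elem U) id u) (\<lambda>i. v (X i)) \<phi>"
    by (rule algebra_code.bsat_form_of[OF algebra_code_standard[OF U height u] assms(2)])
      (use assms(3) in \<open>simp add: alg_standard[OF U height u]\<close>)
  then show ?thesis by (simp add: alg_standard[OF U height u])
qed

text \<open>The codes in \<open>S\<close> decode to P*-algebras, so validity in all P*-algebras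
  covers them, and \<open>code_transfer\<close> carries the sentence over to
  \<open>m\<close>.\<close>

lemma holds_transfer:
  assumes "fvars \<phi> = {}"
    and "\<And>(A :: (complex, 'u, real) star_algebra) e. P_star_algebra A \<Longrightarrow> holds (filter_norm A) e \<phi>"
  shows "holds D e \<phi>"
proof -
  obtain v where v: "decodes (ielem U) (star U) m v" "bsat (ielem U) v (form_of U \<phi>)"
    using code_transfer[OF transfer _ code_standard m, of "form_of U \<phi>"] holds_standard assms S by auto
  then have "holds D (\<lambda>i. v (X i)) \<phi>"
    using bsat_form_of[OF v(1), of \<phi>] assms(1) by simp
  then show ?thesis using holds_cong[of \<phi> e "\<lambda>i. v (X i)" D] assms(1) by simp
qed

lemma star_alg_D: "star_alg D"
proof
  fix s t and e :: "nat \<Rightarrow> 'w"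
  assume st: "law s t" and e: "range e \<subseteq> carrier D"
  have upd: "\<forall>i\<in>tvars r. (f(0 := f' 0, Suc 0 := f' 1, 2 := f' 2)) i = f' i" if "r \<in> {s, t}" for r f and f' :: "nat \<Rightarrow> 'b"
    using law_tvars[OF st] that by auto
  \<comment> \<open>The laws mention only the variables 0, 1 and 2, so three quantifiers close
    them.\<close>
  have "holds D e (AAll 0 (AAll 1 (AAll 2 (AEq s t))))"
  proof (rule holds_transfer)
    fix A :: "(complex, 'u, real) star_algebra" and f
    assume "P_star_algebra A"
    then interpret C_star_algebra A by (simp add: P_star_algebra_def)
    show "holds (filter_norm A) f (AAll 0 (AAll 1 (AAll 2 (AEq s t))))"
    proof (simp, intro ballI)
      fix x y z assume xyz: "x \<in> carrier A" "y \<in> carrier A" "z \<in> carrier A"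
      define f' where "f' = (\<lambda>i::nat. if i = 0 then x else if i = 1 then y else z)"
      have "tval A f' s = tval A f' t"
        unfolding f'_def by (rule law3[OF st xyz])
      then show "tval A (f(0 := x, Suc 0 := y, 2 := z)) s = tval A (f(0 := x, Suc 0 := y, 2 := z)) t"
        using tval_cong[OF upd[of s f f'], of A] tval_cong[OF upd[of t f f'], of A] by (simp add: f'_def del: fun_upd_apply)
    qed
  qed (use law_tvars[OF st] in auto)
  then have "\<forall>x\<in>carrier D. \<forall>y\<in>carrier D. \<forall>z\<in>carrier D.
      tval D (e(0 := x, 1 := y, 2 := z)) s = tval D (e(0 := x, 1 := y, 2 := z)) t"
    by simp
  moreover have "e i \<in> carrier D" for i using e by auto
  ultimately have "tval D (e(0 := e 0, 1 := e 1, 2 := e 2)) s = tval D (e(0 := e 0, 1 := e 1, 2 := e 2)) t"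
    by blast
  then show "tval D e s = tval D e t" by (simp only: fun_upd_triv)
qed (use one_zero_closed mult_graph(1) add_graph(1) smult_graph(1) adj_graph(1) in auto)

text \<open>Internal sets are obtained by transfer from the set of all subsets of the carriers of the
  algebras in \<open>S\<close>, which exists in the superstructure.\<close>

definition subsets :: 'u where
  "subsets = set_of U {s. s \<notin> individuals U \<and> (\<exists>u. elem U u S \<and> (\<forall>x. elem U x s \<longrightarrow> elem U x (coord (elem U) 0 u)))}"

text \<open>An element of a carrier lies four membership steps below \<open>S\<close>: the carrier
  belongs to an element of the pair \<open>u\<close>, and \<open>u\<close> belongs to
  \<open>S\<close>. So the subsets of the carriers, and also the set of these subsets, still fit
  under the height.\<close>

lemma carrier_level: "\<exists>n. enat (Suc n) < height U \<and>
  (\<forall>u x. elem U u S \<longrightarrow> elem U x (coord (elem U) 0 u) \<longrightarrow> x \<in> level U n)"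
proof -
  obtain n where n: "enat n \<le> height U" "S \<in> level U n"
    using superstructureD(6)[OF U] by blast
  have *: "\<exists>k. n = Suc (Suc (Suc (Suc k))) \<and> x \<in> level U k"
    if u: "elem U u S" and x: "elem U x (coord (elem U) 0 u)" for u x
  proof -
    have "is_octuple (elem U) u"
      using S[OF u] by (simp add: codes_algebra_def Let_def)
    then have "\<exists>x y. opair (elem U) ((psnd (elem U) ^^ 0) u) x y"
      unfolding is_octuple_def by (rule allE[of _ 0]) simp
    then have "\<exists>x y. opair (elem U) u x y" by simp
    then obtain y where "opair (elem U) u (coord (elem U) 0 u) y"
      by (auto simp: coord_def dest: pfst_eq)
    then obtain s where s: "elem U s u" "elem U (coord (elem U) 0 u) s"
      using opair_fst_mem by metis
    obtain n1 where "n = Suc n1" "u \<in> level U n1" using level_elem[OF U u n(2)] by blast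
    moreover from this obtain n2 where "n1 = Suc n2" "s \<in> level U n2"
      using level_elem[OF U s(1)] by blast
    moreover from this obtain n3 where "n2 = Suc n3" "coord (elem U) 0 u \<in> level U n3"
      using level_elem[OF U s(2)] by blast
    moreover from this obtain n4 where "n3 = Suc n4" "x \<in> level U n4"
      using level_elem[OF U x] by blast
    ultimately show ?thesis by blast
  qed
  \<comment> \<open>The unit of some algebra in \<open>S\<close> shows that \<open>n\<close> is at
    least 4, so that the level \<open>k\<close>, four below \<open>n\<close>, exists.\<close>
  obtain u where u: "elem U u S" using S_nonempty by blast
  have "elem U (coord (elem U) 2 u) (coord (elem U) 0 u)"
    using S[OF u] by (simp add: codes_algebra_def Let_def)
  from *[OF u this] obtain k where k: "n = Suc (Suc (Suc (Suc k)))" by blast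
  have "enat (Suc k) < height U"
    using n(1) k by (metis enat_ord_simps(2) lessI less_SucI order_less_le_trans)
  moreover have "\<forall>u x. elem U u S \<longrightarrow> elem U x (coord (elem U) 0 u) \<longrightarrow> x \<in> level U k"
    using * k by blast
  ultimately show ?thesis by blast
qed

lemma elem_subsets: "elem U s subsets \<longleftrightarrow>
  s \<notin> individuals U \<and> (\<exists>u. elem U u S \<and> (\<forall>x. elem U x s \<longrightarrow> elem U x (coord (elem U) 0 u)))"
proof -
  obtain n where n: "enat (Suc n) < height U"
    "\<forall>u x. elem U u S \<longrightarrow> elem U x (coord (elem U) 0 u) \<longrightarrow> x \<in> level U n"
    using carrier_level by blast
  have "{s. s \<notin> individuals U \<and> (\<exists>u. elem U u S \<and> (\<forall>x. elem U x s \<longrightarrow> elem U x (coord (elem U) 0 u)))} \<subseteq>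
      level U (Suc n)"
    using n(2) by auto
  from elem_set_of[OF U this n(1)] show ?thesis by (simp add: subsets_def)
qed

lemma subset_exists:
  assumes "elem U u S" "\<And>x. P x \<Longrightarrow> elem U x (coord (elem U) 0 u)"
  shows "\<exists>s. elem U s subsets \<and> (\<forall>x. elem U x s \<longleftrightarrow> P x)"
proof -
  obtain n where n: "enat (Suc n) < height U"
    "\<forall>u x. elem U u S \<longrightarrow> elem U x (coord (elem U) 0 u) \<longrightarrow> x \<in> level U n"
    using carrier_level by blast
  have "enat n < height U" using n(1) by (metis enat_ord_simps(2) lessI less_trans)
  moreover have "Collect P \<subseteq> level U n" using n(2) assms by blast
  ultimately obtain s where s: "s \<notin> individuals U" "\<forall>x. elem U x s \<longleftrightarrow> x \<in> Collect P"
    using superstructureD(5)[OF U] by blast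
  then have "elem U s subsets" unfolding elem_subsets using assms by auto
  with s show ?thesis by auto
qed

text \<open>In the superstructure, a formula with a parameter cuts out of each carrier a subset, and
  this belongs to \<open>subsets\<close>. Transfer of that bounded statement provides an element of
  \<open>star U subsets\<close>, which is internal.\<close>

lemma separation:
  assumes \<phi>: "fvars \<phi> \<subseteq> {0, 1}" and y: "y \<in> carrier D"
  shows "\<exists>b. internal U b \<and> (\<forall>x. ielem U x b \<longleftrightarrow> x \<in> carrier D \<and> holds D (e(0 := x, 1 := y)) \<phi>)"
proof -
  let ?f = "form_of U \<phi>"
  \<comment> \<open>\<open>K 8\<close> stands for the subset to be found. It lies outside the
    decoded components \<open>K 0\<close> to \<open>K 6\<close> and does not occur in
    \<open>?f\<close>.\<close>
  let ?\<psi> = "BAll (X 1) (K 0) (BBex (K 8) (C subsets)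
    (BConj (BAll (X 0) (K 0) (BConj (BImp (BMem (X 0) (K 8)) ?f) (BImp ?f (BMem (X 0) (K 8)))))
      (BAll (X 0) (K 8) (BMem (X 0) (K 0)))))"
  have "bsat (elem U) v ?\<psi>" if u: "elem U u S" and v: "decodes (elem U) id u v" for u v
  proof -
    let ?A = "coord (elem U) 0 u"
    have K0: "v (K 0) = ?A" using decodes_val(1)[OF v, of 0] by simp
    have "\<exists>s. elem U s subsets \<and> (\<forall>x. elem U x ?A \<longrightarrow>
          (elem U x s \<longrightarrow> bsat (elem U) (v(X 1 := z, K 8 := s, X 0 := x)) ?f) \<and>
          (bsat (elem U) (v(X 1 := z, K 8 := s, X 0 := x)) ?f \<longrightarrow> elem U x s)) \<and>
        (\<forall>x. elem U x s \<longrightarrow> elem U x ?A)" if z: "elem U z ?A" for z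
    proof -
      let ?P = "\<lambda>x. holds (filter_norm (standard_algebra U u)) ((\<lambda>_. z)(0 := x)) \<phi>"
      have *: "bsat (elem U) (v(X 1 := z, K 8 := s, X 0 := x)) ?f \<longleftrightarrow> ?P x" if x: "elem U x ?A" for x s
      proof -
        let ?w = "v(X 1 := z, K 8 := s, X 0 := x)"
        have "bsat (elem U) ?w ?f \<longleftrightarrow> holds (filter_norm (standard_algebra U u)) (\<lambda>i. ?w (X i)) \<phi>"
          using \<phi> x z v
          by (intro holds_standard[OF u]) (auto simp: standard_algebra_def decode_def Let_def)
        also have "\<dots> \<longleftrightarrow> ?P x"
          using \<phi> by (intro holds_cong) auto
        finally show ?thesis .
      qed
      obtain s where "elem U s subsets" "\<forall>x. elem U x s \<longleftrightarrow> elem U x ?A \<and> ?P x"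
        using subset_exists[OF u, of "\<lambda>x. elem U x ?A \<and> ?P x"] by blast
      then show ?thesis using * by (intro exI[of _ s]) simp
    qed
    then show ?thesis
      using decodes_val(3)[OF v, of subsets] by (auto simp: K0)
  qed
  then obtain v where v: "decodes (ielem U) (star U) m v" "bsat (ielem U) v ?\<psi>"
    using code_transfer[OF transfer _ code_standard m, of ?\<psi>] by blast
  have K0: "v (K 0) = coord (ielem U) 0 m" "v (C subsets) = star U subsets"
    using decodes_val[OF v(1)] by simp_all
  have "\<forall>z. ielem U z (coord (ielem U) 0 m) \<longrightarrow> (\<exists>b. ielem U b (star U subsets) \<and>
      (\<forall>x. ielem U x (coord (ielem U) 0 m) \<longrightarrow>
        (ielem U x b \<longrightarrow> bsat (ielem U) (v(X 1 := z, K 8 := b, X 0 := x)) ?f) \<and>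
        (bsat (ielem U) (v(X 1 := z, K 8 := b, X 0 := x)) ?f \<longrightarrow> ielem U x b)) \<and>
      (\<forall>x. ielem U x b \<longrightarrow> ielem U x (coord (ielem U) 0 m)))"
    using v(2) by (simp add: K0)
  from this[rule_format, OF y[unfolded mem_carrier]]
  obtain b where b: "ielem U b (star U subsets)"
      "\<forall>x. ielem U x (coord (ielem U) 0 m) \<longrightarrow>
        (ielem U x b \<longrightarrow> bsat (ielem U) (v(X 1 := y, K 8 := b, X 0 := x)) ?f) \<and>
        (bsat (ielem U) (v(X 1 := y, K 8 := b, X 0 := x)) ?f \<longrightarrow> ielem U x b)"
      "\<forall>x. ielem U x b \<longrightarrow> ielem U x (coord (ielem U) 0 m)"
    by (elim exE conjE) (rule that)
  have "bsat (ielem U) (v(X 1 := y, K 8 := b, X 0 := x)) ?f \<longleftrightarrow> holds D (e(0 := x, 1 := y)) \<phi>"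
    if x: "x \<in> carrier D" for x
  proof -
    let ?w = "v(X 1 := y, K 8 := b, X 0 := x)"
    have "bsat (ielem U) ?w ?f \<longleftrightarrow> holds D (\<lambda>i. ?w (X i)) \<phi>"
      using \<phi> x y v(1) by (intro bsat_form_of) auto
    also have "\<dots> \<longleftrightarrow> holds D (e(0 := x, 1 := y)) \<phi>"
      using \<phi> by (intro holds_cong) auto
    finally show ?thesis .
  qed
  then have "ielem U x b \<longleftrightarrow> x \<in> carrier D \<and> holds D (e(0 := x, 1 := y)) \<phi>" for x
    using b(2,3)[rule_format, of x] unfolding mem_carrier by metis
  then show ?thesis
    unfolding internal_def using b(1) by metis
qed

text \<open>Each ball is internal by \<open>separation\<close> with its centre \<open>f n\<close> as
  parameter; the sequence \<open>f\<close> as a whole need not be internal.\<close>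

lemma saturation_D:
  assumes "range f \<subseteq> carrier D"
    and "\<And>k. \<exists>x\<in>carrier D. \<forall>n\<le>k. nrm D (x \<oplus>\<^bsub>D\<^esub> (- 1) \<odot>\<^bsub>D\<^esub> f n) (\<lambda>r. r < \<epsilon> n)"
  shows "\<exists>x\<in>carrier D. \<forall>n::nat. nrm D (x \<oplus>\<^bsub>D\<^esub> (- 1) \<odot>\<^bsub>D\<^esub> f n) (\<lambda>r. r < \<epsilon> n)"
proof -
  have "\<exists>b. internal U b \<and> (\<forall>x. ielem U x b \<longleftrightarrow>
      x \<in> carrier D \<and> nrm D (x \<oplus>\<^bsub>D\<^esub> (- 1) \<odot>\<^bsub>D\<^esub> f n) (\<lambda>r. r < \<epsilon> n))" for n
    using separation[of "ANrm (\<lambda>r. r < \<epsilon> n) (AAdd (AVar 0) (ASmult (- 1) (AVar 1)))" "f n" f] assms(1)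
    by auto
  then obtain b where b: "\<And>n. internal U (b n)" "\<And>n x. ielem U x (b n) \<longleftrightarrow>
      x \<in> carrier D \<and> nrm D (x \<oplus>\<^bsub>D\<^esub> (- 1) \<odot>\<^bsub>D\<^esub> f n) (\<lambda>r. r < \<epsilon> n)"
    by metis
  have "\<exists>x. \<forall>n. ielem U x (b n)"
  proof (rule saturated)
    fix k
    from assms(2)[of k] show "\<exists>x. \<forall>n\<le>k. ielem U x (b n)"
      unfolding b(2) by metis
  qed (rule b(1))
  then show ?thesis unfolding b(2) by blast
qed

text \<open>Each norm axiom is transferred separately for every choice of its properties, thresholds
  and scalars, since these are symbols of the language and cannot be quantified in it.\<close>

lemma hyper_alg_D: "hyper_alg D"
proof -
  interpret star_alg D by (rule star_alg_D)
  show ?thesis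
  proof
    fix x P Q assume "x \<in> carrier D"
    then show "nrm D x (\<lambda>r. P r \<and> Q r) \<longleftrightarrow> nrm D x P \<and> nrm D x Q"
      using holds_transfer[of "AAll 0 (AIff (ANrm (\<lambda>r. P r \<and> Q r) (AVar 0))
        (AConj (ANrm P (AVar 0)) (ANrm Q (AVar 0))))" "\<lambda>_. x"] by auto
  next
    fix x P assume "x \<in> carrier D"
    then show "nrm D x (\<lambda>r. \<not> P r) \<longleftrightarrow> \<not> nrm D x P"
      using holds_transfer[of "AAll 0 (AIff (ANrm (\<lambda>r. \<not> P r) (AVar 0)) (ANeg (ANrm P (AVar 0))))" "\<lambda>_. x"]
      by auto
  next
    fix x assume "x \<in> carrier D"
    have "holds (filter_norm A) e (AAll 0 (ANrm (\<lambda>r. 0 \<le> r) (AVar 0)))"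
      if "P_star_algebra A" for A :: "(complex, 'u, real) star_algebra" and e
    proof -
      interpret A: C_star_algebra A using that by (simp add: P_star_algebra_def)
      show ?thesis using A.nrm_nonneg by simp
    qed
    from holds_transfer[OF _ this, of "\<lambda>_. x"] show "nrm D x (\<lambda>r. 0 \<le> r)"
      using \<open>x \<in> carrier D\<close> by auto
  next
    have "holds (filter_norm A) e (ANrm (\<lambda>r. r = 0) AZero)"
      if "P_star_algebra A" for A :: "(complex, 'u, real) star_algebra" and e
    proof -
      interpret A: C_star_algebra A using that by (simp add: P_star_algebra_def)
      show ?thesis using A.nrm_eq_0[OF A.closed_zero] A.closed_zero by simp
    qed
    then show "nrm D \<zero>\<^bsub>D\<^esub> (\<lambda>r. r = 0)"
      using holds_transfer[of "ANrm (\<lambda>r. r = 0) AZero"] by simp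
  next
    fix x y a b
    assume xy: "x \<in> carrier D" "y \<in> carrier D" and ab: "nrm D x (\<lambda>r. r < a)" "nrm D y (\<lambda>r. r < b)"
    have "holds (filter_norm A) e (AAll 0 (AAll 1 (AImp (ANrm (\<lambda>r. r < a) (AVar 0))
        (AImp (ANrm (\<lambda>r. r < b) (AVar 1)) (ANrm (\<lambda>r. r < a + b) (AAdd (AVar 0) (AVar 1)))))))"
      if "P_star_algebra A" for A :: "(complex, 'u, real) star_algebra" and e
    proof -
      interpret A: C_star_algebra A using that by (simp add: P_star_algebra_def)
      have "nrm A (x \<oplus>\<^bsub>A\<^esub> y) < a + b"
        if "x \<in> carrier A" "y \<in> carrier A" "nrm A x < a" "nrm A y < b" for x y
        using A.nrm_add[OF that(1,2)] that(3,4) by simp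
      then show ?thesis using A.closed_add by simp
    qed
    from holds_transfer[OF _ this, of "\<lambda>_. x"] show "nrm D (x \<oplus>\<^bsub>D\<^esub> y) (\<lambda>r. r < a + b)"
      using xy ab by auto
  next
    fix x y a b
    assume xy: "x \<in> carrier D" "y \<in> carrier D" and ab: "nrm D x (\<lambda>r. r < a)" "nrm D y (\<lambda>r. r < b)"
    have "holds (filter_norm A) e (AAll 0 (AAll 1 (AImp (ANrm (\<lambda>r. r < a) (AVar 0))
        (AImp (ANrm (\<lambda>r. r < b) (AVar 1)) (ANrm (\<lambda>r. r < a * b) (AMult (AVar 0) (AVar 1)))))))"
      if "P_star_algebra A" for A :: "(complex, 'u, real) star_algebra" and e
    proof -
      interpret A: C_star_algebra A using that by (simp add: P_star_algebra_def)
      have "nrm A (x \<otimes>\<^bsub>A\<^esub> y) < a * b"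
        if "x \<in> carrier A" "y \<in> carrier A" "nrm A x < a" "nrm A y < b" for x y
        using A.nrm_mult[OF that(1,2)] mult_strict_mono'[OF that(3,4) A.nrm_nonneg[OF that(1)] A.nrm_nonneg[OF that(2)]]
        by simp
      then show ?thesis using A.closed_mult by simp
    qed
    from holds_transfer[OF _ this, of "\<lambda>_. x"] show "nrm D (x \<otimes>\<^bsub>D\<^esub> y) (\<lambda>r. r < a * b)"
      using xy ab by auto
  next
    fix x c P assume x: "x \<in> carrier D"
    have "holds (filter_norm A) e (AAll 0 (AIff (ANrm P (ASmult c (AVar 0))) (ANrm (\<lambda>r. P (cmod c * r)) (AVar 0))))"
      if "P_star_algebra A" for A :: "(complex, 'u, real) star_algebra" and e
    proof -
      interpret A: C_star_algebra A using that by (simp add: P_star_algebra_def)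
      show ?thesis using A.closed_smult A.nrm_smult by simp
    qed
    from holds_transfer[OF _ this, of "\<lambda>_. x"]
    show "nrm D (c \<odot>\<^bsub>D\<^esub> x) P \<longleftrightarrow> nrm D x (\<lambda>r. P (cmod c * r))"
      using x by auto
  next
    fix x P assume x: "x \<in> carrier D"
    have "holds (filter_norm A) e (AAll 0 (AIff (ANrm P (AAdj (AVar 0))) (ANrm P (AVar 0))))"
      if "P_star_algebra A" for A :: "(complex, 'u, real) star_algebra" and e
    proof -
      interpret A: C_star_algebra A using that by (simp add: P_star_algebra_def)
      show ?thesis using A.closed_adj A.nrm_adj by simp
    qed
    from holds_transfer[OF _ this, of "\<lambda>_. x"] show "nrm D (adj D x) P \<longleftrightarrow> nrm D x P"
      using x by auto
  next
    fix x P assume x: "x \<in> carrier D"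
    have "holds (filter_norm A) e
        (AAll 0 (AIff (ANrm P (AMult (AAdj (AVar 0)) (AVar 0))) (ANrm (\<lambda>r. P (r\<^sup>2)) (AVar 0))))"
      if "P_star_algebra A" for A :: "(complex, 'u, real) star_algebra" and e
    proof -
      interpret A: C_star_algebra A using that by (simp add: P_star_algebra_def)
      show ?thesis using A.closed_adj A.closed_mult A.C_star_identity by simp
    qed
    from holds_transfer[OF _ this, of "\<lambda>_. x"]
    show "nrm D (adj D x \<otimes>\<^bsub>D\<^esub> x) P \<longleftrightarrow> nrm D x (\<lambda>r. P (r\<^sup>2))"
      using x by auto
  next
    fix p assume p: "p \<in> carrier D" "p \<otimes>\<^bsub>D\<^esub> p = p" "adj D p = p"
    have "holds (filter_norm A) e (AAll 0 (AImp (AEq (AMult (AVar 0) (AVar 0)) (AVar 0))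
        (AImp (AEq (AAdj (AVar 0)) (AVar 0)) (ANrm (\<lambda>r. r < 2) (AVar 0)))))"
      if "P_star_algebra A" for A :: "(complex, 'u, real) star_algebra" and e
    proof -
      interpret A: C_star_algebra A using that by (simp add: P_star_algebra_def)
      show ?thesis using A.nrm_projection by (fastforce simp: projections_def)
    qed
    from holds_transfer[OF _ this, of "\<lambda>_. p"] show "nrm D p (\<lambda>r. r < 2)"
      using p by auto
  next
    fix \<delta> b :: real assume "0 < \<delta>"
    \<comment> \<open>\<open>cs\<close> depends neither on the algebra nor on the element, so it can
      be written into the sentence \<open>?\<phi>\<close>.\<close>
    then obtain cs where cs: "\<forall>A :: (complex, 'u, real) star_algebra. P_star_algebra A \<longrightarrow>
      (\<forall>x\<in>carrier A. adj A x = x \<longrightarrow> nrm A x < b \<longrightarrow>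
        (\<exists>q\<in>carrier A. \<exists>y\<in>carrier A. orth A cs q y \<and> nrm A (x \<oplus>\<^bsub>A\<^esub> (- 1) \<odot>\<^bsub>A\<^esub> y) < \<delta>))"
      using P_star_algebra_uniform by blast
    let ?\<phi> = "AAll 0 (AImp (AEq (AAdj (AVar 0)) (AVar 0)) (AImp (ANrm (\<lambda>r. r < b) (AVar 0))
      (AEx 1 (AEx 2 (AConj (orth_form cs 1)
        (ANrm (\<lambda>r. r < \<delta>) (AAdd (AVar 0) (ASmult (- 1) (AVar 2)))))))))"
    have "holds (filter_norm A) e ?\<phi>"
      if "P_star_algebra A" for A :: "(complex, 'u, real) star_algebra" and e
    proof -
      interpret A: C_star_algebra A using that by (simp add: P_star_algebra_def)
      show ?thesis
        using cs that A.closed_add A.closed_smult by (simp add: holds_orth_form)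
    qed
    moreover have "fvars ?\<phi> = {}" using fvars_orth_form[of cs 1] by auto
    ultimately have "holds D (\<lambda>_. \<zero>\<^bsub>D\<^esub>) ?\<phi>" by (intro holds_transfer)
    then have "\<forall>x\<in>carrier D. adj D x = x \<longrightarrow> nrm D x (\<lambda>r. r < b) \<longrightarrow>
      (\<exists>q\<in>carrier D. \<exists>y\<in>carrier D. orth D cs q y \<and>
        nrm D (x \<oplus>\<^bsub>D\<^esub> (- 1) \<odot>\<^bsub>D\<^esub> y) (\<lambda>r. r < \<delta>))"
      by (simp add: holds_orth_form)
    then show "\<exists>cs. \<forall>x\<in>carrier D. adj D x = x \<longrightarrow> nrm D x (\<lambda>r. r < b) \<longrightarrow>
      (\<exists>q\<in>carrier D. \<exists>y\<in>carrier D. orth D cs q y \<and>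
        nrm D (x \<oplus>\<^bsub>D\<^esub> (- 1) \<odot>\<^bsub>D\<^esub> y) (\<lambda>r. r < \<delta>))"
      by blast
  qed (rule saturation_D)
qed

sublocale H: hyper_alg D by (rule hyper_alg_D)

section \<open>The nonstandard hull as an abstract hull\<close>

lemma opair_level:
  assumes "x \<in> level U 0" "y \<in> level U 0"
  shows "\<exists>p. opair (elem U) p x y"
proof -
  have h: "enat 0 < height U" "enat 1 < height U"
    using height by (cases "height U"; simp)+
  have "\<exists>s. s \<in> level U 1 \<and> upair (elem U) s x z" if "z \<in> level U 0" for z
  proof -
    have "{x, z} \<subseteq> level U 0" using assms(1) that by simp
    then obtain s where "\<forall>t. elem U t s \<longleftrightarrow> t \<in> {x, z}"
      using superstructureD(5)[OF U] h(1) by blast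
    then show ?thesis using assms(1) that by (intro exI[of _ s]) (auto simp: upair_def)
  qed
  then obtain s t where st: "s \<in> level U 1" "t \<in> level U 1" "upair (elem U) s x x" "upair (elem U) t x y"
    using assms by blast
  then have "{s, t} \<subseteq> level U 1" by simp
  then obtain p where "\<forall>r. elem U r p \<longleftrightarrow> r \<in> {s, t}"
    using superstructureD(5)[OF U] h(2) by blast
  then have "upair (elem U) p s t" by (simp add: upair_def)
  with st show ?thesis unfolding opair_def by blast
qed

lemma level_opair:
  assumes "opair (elem U) p x y" "x \<in> level U 0" "y \<in> level U 0"
  shows "p \<in> level U 2"
proof -
  obtain s t where st: "upair (elem U) s x x" "upair (elem U) t x y" "upair (elem U) p s t"
    using assms(1) unfolding opair_def by blast
  have "s \<in> level U 1" "t \<in> level U 1"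
    using st(1,2) assms(2,3) by (auto simp: upair_def)
  with st(3) show ?thesis by (simp add: upair_def numeral_2_eq_2)
qed

definition pairs_with :: "(real \<Rightarrow> real \<Rightarrow> bool) \<Rightarrow> 'u" where
  "pairs_with R = set_of U {p. \<exists>r s. R r s \<and> opair (elem U) p (rnum U r) (rnum U s)}"

lemma rnum_level: "rnum U r \<in> level U 0"
  using num_level[OF U] unfolding rnum_def .

lemma elem_pairs_with: "elem U p (pairs_with R) \<longleftrightarrow> (\<exists>r s. R r s \<and> opair (elem U) p (rnum U r) (rnum U s))"
proof -
  have "enat 2 < height U" using height by (cases "height U") auto
  moreover have "{p. \<exists>r s. R r s \<and> opair (elem U) p (rnum U r) (rnum U s)} \<subseteq> level U 2"
    using level_opair rnum_level by blast
  ultimately show ?thesis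
    unfolding pairs_with_def using elem_set_of[OF U, of _ 2] by simp
qed

lemma star_pred_iff: "star_pred U P x \<longleftrightarrow> ielem U x (star U (reals_with U P))"
  by (simp only: star_pred_def reals_with_def)

text \<open>The hull compares norms with standard reals only, so the binary relations in its
  definition reduce to the unary properties recorded by the norm ultrafilters. The transferred
  sentence says, for all reals s, that \<open>R s t\<close> holds iff a pair (s, t) belongs to the
  set coding \<open>R\<close>.\<close>

lemma star_rel_const:
  assumes "star_pred U (\<lambda>_. True) x"
  shows "star_rel U R x (star U (rnum U t)) \<longleftrightarrow> star_pred U (\<lambda>s. R s t) x"
proof -
  let ?mem = "BMem (X 0) (C (reals_with U (\<lambda>s. R s t)))"
  let ?rel = "BBex (X 1) (C (pairs_with R)) (opair_form 0 (X 1) (X 0) (C (rnum U t)))"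
  let ?\<psi> = "BAll (X 0) (C (reals_with U (\<lambda>_. True))) (BConj (BImp ?mem ?rel) (BImp ?rel ?mem))"
  have "(\<exists>p. elem U p (pairs_with R) \<and> opair (elem U) p (rnum U s) (rnum U t)) \<longleftrightarrow> R s t" for s
    using opair_inj[of "elem U"] opair_level[OF rnum_level rnum_level, of s t] rnum_inject
    unfolding elem_pairs_with by metis
  then have "bsat (elem U) v ?\<psi>" if "\<And>c. v (C c) = c" for v
    using that by (auto simp: bsat_opair_form elem_reals_with rnum_inject)
  then obtain v where v: "\<forall>c. v (C c) = star U c" "bsat (ielem U) v ?\<psi>"
    using bounded_transfer_const by blast
  have "ielem U x (star U (reals_with U (\<lambda>s. R s t))) \<longleftrightarrow>
      (\<exists>p. ielem U p (star U (pairs_with R)) \<and> opair (ielem U) p x (star U (rnum U t)))"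
    using v assms[unfolded star_pred_iff] by (auto simp: bsat_opair_form)
  then show ?thesis
    unfolding star_rel_def star_pred_iff pairs_with_def[symmetric] by (simp only: conj_commute)
qed

abbreviation "M \<equiv> decode (ielem U) m"

lemma nrm_D: "x \<in> carrier D \<Longrightarrow> nrm D x P \<longleftrightarrow> star_pred U P (nrm M x)"
  by (simp add: alg_def Let_def star_pred_iff)

lemma M_D: "carrier M = carrier D" "mult M = mult D" "one M = one D" "zero M = zero D" "add M = add D"
  "smult M (star U (num U c)) = smult D c" "adj M = adj D"
  by (simp_all add: alg_def Let_def)

text \<open>Subtraction depends only on the carrier, addition and zero, which \<open>M\<close> and
  \<open>D\<close> share.\<close>

lemma minus_M: "x \<ominus>\<^bsub>M\<^esub> y = x \<ominus>\<^bsub>D\<^esub> y"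
  by (simp add: a_minus_def a_inv_def m_inv_def M_D)

lemma real_approx_nrm:
  assumes "x \<in> carrier D"
  shows "real_approx U (nrm M x) (star U (rnum U t)) \<longleftrightarrow> H.near x t"
proof -
  have "star_pred U (\<lambda>_. True) (nrm M x)"
    using H.nrm_mono[OF assms H.nrm_nonneg[OF assms], of "\<lambda>_. True"] nrm_D[OF assms] by simp
  then show ?thesis
    using assms by (simp add: real_approx_def star_rel_const H.near_iff_inverse nrm_D)
qed

lemma Fin_eq: "Fin U m = H.fin"
  by (auto simp: Fin_def Let_def H.fin_def M_D finite_real_def nrm_D)

lemma hat_eq: "x \<in> H.fin \<Longrightarrow> hat U m x = H.cls x"
  using H.near_zero_diff[of x] H.fin_carrier H.cls_memD(1)
  by (auto simp: hat_def Let_def M_D minus_M H.minus_smult real_approx_nrm H.closed_smult)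

lemma standard_part_nrm: "x \<in> carrier D \<Longrightarrow> standard_part U (nrm M x) = H.N x"
  by (simp add: standard_part_def H.N_def real_approx_nrm)

text \<open>By the congruence lemmas for \<open>cls\<close>, the value inside each description is
  the same for all representatives, and \<open>x\<close> itself is one of them; so the descriptions
  have the expected values.\<close>

lemma hull_nonstandard_hull: "alg_hull D (nonstandard_hull U m) (hat U m)"
proof
  let ?Q = "nonstandard_hull U m"
  show "carrier ?Q = hat U m ` H.fin"
    by (simp add: nonstandard_hull_def Let_def Fin_eq)
  show "\<one>\<^bsub>?Q\<^esub> = hat U m \<one>\<^bsub>D\<^esub>" "\<zero>\<^bsub>?Q\<^esub> = hat U m \<zero>\<^bsub>D\<^esub>"
    by (simp_all add: nonstandard_hull_def Let_def M_D)
  fix x assume x: "x \<in> H.fin"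
  show "nrm ?Q (hat U m x) = H.N x"
  proof -
    have "(THE r. \<exists>a\<in>H.cls x. r = standard_part U (nrm M a)) = H.N x"
    proof (rule the_equality)
      show "\<exists>a\<in>H.cls x. H.N x = standard_part U (nrm M a)"
        using H.cls_self[OF x] standard_part_nrm[OF H.fin_carrier[OF x]] by metis
      show "r = H.N x" if "\<exists>a\<in>H.cls x. r = standard_part U (nrm M a)" for r
        using that H.N_cls[OF x] standard_part_nrm H.fin_carrier H.cls_memD(1) by metis
    qed
    then show ?thesis by (simp add: nonstandard_hull_def Let_def hat_eq[OF x])
  qed
  show "adj ?Q (hat U m x) = hat U m (adj D x)"
  proof -
    have eq: "hat U m (adj D a) = hat U m (adj D x)" if "a \<in> H.cls x" for a
      using H.cls_adj_cong[OF x that] H.N_adj x that by (simp add: hat_eq H.cls_memD(1))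
    have "(THE R. \<exists>a\<in>H.cls x. R = hat U m (adj M a)) = hat U m (adj D x)"
      unfolding M_D by (rule the_equality) (use eq H.cls_self[OF x] in blast)+
    then show ?thesis by (simp add: nonstandard_hull_def Let_def hat_eq[OF x])
  qed
  show "c \<odot>\<^bsub>?Q\<^esub> hat U m x = hat U m (c \<odot>\<^bsub>D\<^esub> x)" for c
  proof -
    have eq: "hat U m (c \<odot>\<^bsub>D\<^esub> a) = hat U m (c \<odot>\<^bsub>D\<^esub> x)" if "a \<in> H.cls x" for a
      using H.cls_smult_cong[OF x that] H.N_smult x that by (simp add: hat_eq H.cls_memD(1))
    have "(THE R. \<exists>a\<in>H.cls x. R = hat U m (star U (num U c) \<odot>\<^bsub>M\<^esub> a)) = hat U m (c \<odot>\<^bsub>D\<^esub> x)"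
      unfolding M_D by (rule the_equality) (use eq H.cls_self[OF x] in blast)+
    then show ?thesis by (simp add: nonstandard_hull_def Let_def hat_eq[OF x])
  qed
  fix y assume y: "y \<in> H.fin"
  show "hat U m x = hat U m y \<longleftrightarrow> H.N (H.diff x y) = 0"
    using H.cls_eq_iff[OF x y] by (simp add: hat_eq x y)
  show "hat U m x \<otimes>\<^bsub>?Q\<^esub> hat U m y = hat U m (x \<otimes>\<^bsub>D\<^esub> y)"
  proof -
    have eq: "hat U m (a \<otimes>\<^bsub>D\<^esub> b) = hat U m (x \<otimes>\<^bsub>D\<^esub> y)" if "a \<in> H.cls x" "b \<in> H.cls y" for a b
      using H.cls_mult_cong[OF x y that] H.N_mult x y that by (simp add: hat_eq H.cls_memD(1))
    have "(THE R. \<exists>a\<in>H.cls x. \<exists>b\<in>H.cls y. R = hat U m (a \<otimes>\<^bsub>M\<^esub> b)) = hat U m (x \<otimes>\<^bsub>D\<^esub> y)"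
      unfolding M_D by (rule the_equality) (use eq H.cls_self[OF x] H.cls_self[OF y] in blast)+
    then show ?thesis by (simp add: nonstandard_hull_def Let_def hat_eq[OF x] hat_eq[OF y])
  qed
  show "hat U m x \<oplus>\<^bsub>?Q\<^esub> hat U m y = hat U m (x \<oplus>\<^bsub>D\<^esub> y)"
  proof -
    have eq: "hat U m (a \<oplus>\<^bsub>D\<^esub> b) = hat U m (x \<oplus>\<^bsub>D\<^esub> y)" if "a \<in> H.cls x" "b \<in> H.cls y" for a b
      using H.cls_add_cong[OF x y that] H.N_add x y that by (simp add: hat_eq H.cls_memD(1))
    have "(THE R. \<exists>a\<in>H.cls x. \<exists>b\<in>H.cls y. R = hat U m (a \<oplus>\<^bsub>M\<^esub> b)) = hat U m (x \<oplus>\<^bsub>D\<^esub> y)"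
      unfolding M_D by (rule the_equality) (use eq H.cls_self[OF x] H.cls_self[OF y] in blast)+
    then show ?thesis by (simp add: nonstandard_hull_def Let_def hat_eq[OF x] hat_eq[OF y])
  qed
qed

end

theorem theorem27:
  fixes \<kappa> :: "'k rel" and U :: "('u, 'w) universe" and m :: 'w
  assumes "Card_order \<kappa>" and "|UNIV :: nat set| <o \<kappa>"
    and "nonstandard_universe \<kappa> U"
    and "internal_P_star_algebra U m"
  shows "P_star_algebra (nonstandard_hull U m)"
proof -
  obtain S where S: "\<forall>u. elem U u S \<longrightarrow> codes_algebra U u \<and> P_star_algebra (standard_algebra U u)"
      "ielem U m (star U S)"
    using assms(4) unfolding internal_P_star_algebra_def by blast
  interpret internal_algebra U S m
  proof
    fix b :: "nat \<Rightarrow> 'w"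
    assume b: "\<And>n. internal U (b n)" "\<And>k. \<exists>x. \<forall>n\<le>k. ielem U x (b n)"
    \<comment> \<open>A finite part of the range involves finitely many indices, hence is covered by
      an initial segment of \<open>b\<close>.\<close>
    have "\<exists>x. \<forall>c\<in>G. ielem U x c" if G: "finite G" "G \<subseteq> range b" for G
    proof -
      obtain J where J: "finite J" "G = b ` J" using finite_subset_image[OF G] by auto
      obtain k where k: "\<forall>n\<in>J. n \<le> k" using J(1) by (auto simp: finite_nat_set_iff_bounded_le)
      obtain x where "\<forall>n\<le>k. ielem U x (b n)" using b(2) by blast
      then show ?thesis using k J(2) by auto
    qed
    moreover have "|range b| <o \<kappa>"
      using ordLeq_ordLess_trans[OF card_of_image assms(2)] .
    moreover have "\<forall>c\<in>range b. internal U c" using b(1) by blast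
    moreover have "(\<forall>c\<in>range b. internal U c) \<and> |range b| <o \<kappa> \<and>
        (\<forall>G. finite G \<and> G \<subseteq> range b \<longrightarrow> (\<exists>x. \<forall>c\<in>G. ielem U x c)) \<longrightarrow>
        (\<exists>x. \<forall>c\<in>range b. ielem U x c)"
      using assms(3) unfolding nonstandard_universe_def saturated_def by (elim conjE) (rule spec)
    ultimately have "\<exists>x. \<forall>c\<in>range b. ielem U x c"
      by simp
    then show "\<exists>x. \<forall>n. ielem U x (b n)" by blast
  qed (use S assms(3) in \<open>auto simp: nonstandard_universe_def\<close>)
  interpret alg_hull D "nonstandard_hull U m" "hat U m" by (rule hull_nonstandard_hull)
  show ?thesis by (rule P_star_algebra_Q)
qed

end
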